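(* Let $P$ be a simple restricted $\mathcal{S}$-module. Suppose that there exists $c_2\in\mathbb{C}$, $c_2\neq0$, such that $C_2$ acts on $P$ as the scalar $c_2$. Then there exist $d\in\mathbb{N}$ and a simple $\mathcal{T}_d$-module $V$ such that $P\cong\mathrm{Ind}(V)=\mathcal{U}(\mathcal{S})\otimes_{\mathcal{U}(\mathcal{T}_d)}V$ and such that, for some $t\in\mathbb{N}$, the following two conditions hold: (a) if $t>0$, the action of $W_t$ on $V$ is injective; if $t=0$, then $c_2\neq0$; (b) $W_iV=0$ for all $i>t$ and $L_jV=0$ for all $j>t+d$.
   Context: Everything is over $\mathbb{C}$; $\mathbb{N}=\{0,1,2,\dots\}$. The super extended Ovsienko--Roger algebra $\mathcal{S}$ is the Lie superalgebra with basis $\{L_m,W_m,G_r,C_1,C_2 : m\in\mathbb{Z},\ r\in\mathbb{Z}+\frac12\}$, where $L_m,W_m,C_1,C_2$ are even and $G_r$ is odd, with super-brackets (for $m,n\in\mathbb{Z}$, $r,s\in\mathbb{Z}+\frac12$) $$[L_m,L_n]=(n-m)L_{m+n}+\tfrac{m^3-m}{12}\delta_{m+n,0}C_1,\quad [L_m,W_n]=(m+n)W_{m+n}+\delta_{m+n,0}C_2,$$ $$[L_m,G_r]=rG_{m+r},\quad [G_r,G_s]=(r+s)W_{r+s}+\delta_{r+s,0}C_2,\quad [W_m,W_n]=[W_m,G_r]=[\mathcal{S},C_1]=[\mathcal{S},C_2]=0.$$ For $d\in\mathbb{N}$, $\mathcal{T}_d$ is the subalgebra $\mathcal{T}_d=\bigoplus_{i\ge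 0}(\mathbb{C}L_i\oplus\mathbb{C}W_{i-d})\oplus\bigoplus_{i\ge1}\mathbb{C}G_{i-\frac12}\oplus\mathbb{C}C_1\oplus\mathbb{C}C_2$. An $\mathcal{S}$-module $M$ is restricted if for every $v\in M$, $L_iv=W_iv=G_{i+\frac12}v=0$ for all sufficiently large $i$. $\mathcal{U}(\cdot)$ denotes the universal enveloping (super)algebra. Conventions: all modules over Lie superalgebras are $\mathbb{Z}_2$-graded (with $\mathfrak{g}_{\bar i}V_{\bar j}\subseteq V_{\bar i+\bar j}$), all simple modules are assumed non-trivial, and the central elements $C_1,C_2$ are always assumed to act on the modules considered as scalars $c_1,c_2$. *)

theory Defs
  imports
    Complex_Main
    "HOL-Library.Poly_Mapping"
    "HOL-Library.Z2"
    "HOL-Algebra.Module"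
    "HOL-Algebra.QuotRing"
    "HOL-Algebra.Algebraic_Closure_Type"
begin

section \<open>Super vector spaces, Lie superalgebras and their modules\<close>

text \<open>
  Vector spaces over \<open>\<complex>\<close> are modules over the HOL-Algebra ring on the type \<^typ>\<open>complex\<close>.
  The fields \<open>mult\<close> and \<open>one\<close> that the record \<open>module\<close> inherits from \<open>ring\<close> play no role.
  Degrees are elements of \<^typ>\<open>bit\<close>, i.e. of \<open>\<int>/2\<close>.
\<close>

abbreviation CC :: "complex ring" where
  "CC \<equiv> ring_of_type_algebra"

text \<open>The Koszul sign \<open>(-1)\<close> to the power \<open>i j\<close>.\<close>

definition ksign :: "bit \<Rightarrow> bit \<Rightarrow> complex" where
  "ksign i j = (if i = 1 \<and> j = 1 then - 1 else 1)"

record 'v superspace = "(complex, 'v) module" +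
  hpart :: "bit \<Rightarrow> 'v set"

locale superspace = module CC M for M :: "('v, 'm) superspace_scheme" (structure) +
  assumes hpart_submodule: "submodule (hpart M i) CC M"
    and hpart_Int: "hpart M 0 \<inter> hpart M 1 = {\<zero>}"
    and hpart_sum: "hpart M 0 <+> hpart M 1 = carrier M"

record 'g lie_superalgebra = "'g superspace" +
  bracket :: "'g \<Rightarrow> 'g \<Rightarrow> 'g"

locale lie_superalgebra = superspace G for G :: "('g, 'm) lie_superalgebra_scheme" (structure) +
  assumes bracket_hpart:
      "\<lbrakk>x \<in> hpart G i; y \<in> hpart G j\<rbrakk> \<Longrightarrow> bracket G x y \<in> hpart G (i + j)"
    and bracket_add_left: "\<lbrakk>x \<in> carrier G; y \<in> carrier G; z \<in> carrier G\<rbrakk> \<Longrightarrow>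
      bracket G (x \<oplus> y) z = bracket G x z \<oplus> bracket G y z"
    and bracket_add_right: "\<lbrakk>x \<in> carrier G; y \<in> carrier G; z \<in> carrier G\<rbrakk> \<Longrightarrow>
      bracket G x (y \<oplus> z) = bracket G x y \<oplus> bracket G x z"
    and bracket_smult_left: "\<lbrakk>x \<in> carrier G; y \<in> carrier G\<rbrakk> \<Longrightarrow>
      bracket G (c \<odot> x) y = c \<odot> bracket G x y"
    and bracket_smult_right: "\<lbrakk>x \<in> carrier G; y \<in> carrier G\<rbrakk> \<Longrightarrow>
      bracket G x (c \<odot> y) = c \<odot> bracket G x y"
    and super_skew: "\<lbrakk>x \<in> hpart G i; y \<in> hpart G j\<rbrakk> \<Longrightarrow>
      bracket G x y = (- ksign i j) \<odot> bracket G y x"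
    and super_jacobi: "\<lbrakk>x \<in> hpart G i; y \<in> hpart G j; z \<in> hpart G k\<rbrakk> \<Longrightarrow>
      bracket G x (bracket G y z) =
        bracket G (bracket G x y) z \<oplus> ksign i j \<odot> bracket G y (bracket G x z)"

record ('g, 'v) supermodule = "'v superspace" +
  act :: "'g \<Rightarrow> 'v \<Rightarrow> 'v"

locale supermodule = G: lie_superalgebra G + M: superspace M
  for G :: "('g, 'm) lie_superalgebra_scheme" (structure)
    and M :: "('g, 'v, 'n) supermodule_scheme" (structure) +
  assumes act_hpart:
      "\<lbrakk>x \<in> hpart G i; v \<in> hpart M j\<rbrakk> \<Longrightarrow> act M x v \<in> hpart M (i + j)"
    and act_add_left: "\<lbrakk>x \<in> carrier G; y \<in> carrier G; v \<in> carrier M\<rbrakk> \<Longrightarrow>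
      act M (x \<oplus>\<^bsub>G\<^esub> y) v = act M x v \<oplus>\<^bsub>M\<^esub> act M y v"
    and act_add_right: "\<lbrakk>x \<in> carrier G; v \<in> carrier M; w \<in> carrier M\<rbrakk> \<Longrightarrow>
      act M x (v \<oplus>\<^bsub>M\<^esub> w) = act M x v \<oplus>\<^bsub>M\<^esub> act M x w"
    and act_smult_left: "\<lbrakk>x \<in> carrier G; v \<in> carrier M\<rbrakk> \<Longrightarrow>
      act M (c \<odot>\<^bsub>G\<^esub> x) v = c \<odot>\<^bsub>M\<^esub> act M x v"
    and act_smult_right: "\<lbrakk>x \<in> carrier G; v \<in> carrier M\<rbrakk> \<Longrightarrow>
      act M x (c \<odot>\<^bsub>M\<^esub> v) = c \<odot>\<^bsub>M\<^esub> act M x v"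
    and act_bracket: "\<lbrakk>x \<in> hpart G i; y \<in> hpart G j; v \<in> carrier M\<rbrakk> \<Longrightarrow>
      act M (bracket G x y) v =
        act M x (act M y v) \<ominus>\<^bsub>M\<^esub> ksign i j \<odot>\<^bsub>M\<^esub> act M y (act M x v)"

definition graded_submodule ::
  "'v set \<Rightarrow> ('g, 'm) lie_superalgebra_scheme \<Rightarrow> ('g, 'v, 'n) supermodule_scheme \<Rightarrow> bool" where
  "graded_submodule N G M \<longleftrightarrow>
     submodule N CC M \<and>
     (\<forall>x\<in>carrier G. \<forall>v\<in>N. act M x v \<in> N) \<and>
     N = (N \<inter> hpart M 0) <+>\<^bsub>M\<^esub> (N \<inter> hpart M 1)"

text \<open>
  Simple modules are required to be non-trivial: some element acts non-trivially, which in
  particular excludes the zero module.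
\<close>

definition simple_supermodule ::
  "('g, 'm) lie_superalgebra_scheme \<Rightarrow> ('g, 'v, 'n) supermodule_scheme \<Rightarrow> bool" where
  "simple_supermodule G M \<longleftrightarrow>
     supermodule G M \<and>
     (\<exists>x\<in>carrier G. \<exists>v\<in>carrier M. act M x v \<noteq> \<zero>\<^bsub>M\<^esub>) \<and>
     (\<forall>N. graded_submodule N G M \<longrightarrow> N = {\<zero>\<^bsub>M\<^esub>} \<or> N = carrier M)"

definition isomorphic_supermodules ::
  "('g, 'm) lie_superalgebra_scheme \<Rightarrow> ('g, 'v, 'n) supermodule_scheme
    \<Rightarrow> ('g, 'w, 'k) supermodule_scheme \<Rightarrow> bool" where
  "isomorphic_supermodules G M N \<longleftrightarrow>
     (\<exists>\<phi>. bij_betw \<phi> (carrier M) (carrier N) \<and>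
       (\<forall>v\<in>carrier M. \<forall>w\<in>carrier M. \<phi> (v \<oplus>\<^bsub>M\<^esub> w) = \<phi> v \<oplus>\<^bsub>N\<^esub> \<phi> w) \<and>
       (\<forall>c. \<forall>v\<in>carrier M. \<phi> (c \<odot>\<^bsub>M\<^esub> v) = c \<odot>\<^bsub>N\<^esub> \<phi> v) \<and>
       (\<forall>x\<in>carrier G. \<forall>v\<in>carrier M. \<phi> (act M x v) = act N x (\<phi> v)) \<and>
       (\<forall>i. \<phi> ` hpart M i = hpart N i))"


section \<open>Universal enveloping superalgebras and induced modules\<close>

text \<open>
  Formal linear combinations are finitely supported functions. Words are lists; they form a
  monoid under concatenation, which has to be written additively in order that
  \<^theory>\<open>HOL-Library.Poly_Mapping\<close> provide the concatenation product on \<open>'a list \<Rightarrow>\<^sub>0 complex\<close>.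
\<close>

instantiation list :: (type) monoid_add
begin

definition zero_list :: "'a list" where "zero_list = []"

definition plus_list :: "'a list \<Rightarrow> 'a list \<Rightarrow> 'a list" where "plus_list xs ys = xs @ ys"

instance by standard (simp_all add: zero_list_def plus_list_def)

end

definition pscale :: "complex \<Rightarrow> ('a \<Rightarrow>\<^sub>0 complex) \<Rightarrow> ('a \<Rightarrow>\<^sub>0 complex)" where
  "pscale c p = Poly_Mapping.map ((*) c) p"

definition free_space :: "'a set \<Rightarrow> (complex, 'a \<Rightarrow>\<^sub>0 complex) module" where
  "free_space A =
     \<lparr>carrier = {p. Poly_Mapping.keys p \<subseteq> A}, monoid.mult = undefined, one = undefined,
      zero = 0, add = (+), module.smult = pscale\<rparr>"

definition free_algebra :: "'a set \<Rightarrow> ('a list \<Rightarrow>\<^sub>0 complex) ring" where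
  "free_algebra A =
     \<lparr>carrier = {p. Poly_Mapping.keys p \<subseteq> lists A}, monoid.mult = (*), one = 1, zero = 0, add = (+)\<rparr>"

text \<open>
  The free algebra here is the one on the underlying \<^emph>\<open>set\<close> of \<open>G\<close>. The first two families of
  relations turn it into the tensor algebra of the vector space \<open>G\<close>, the third one is
  \<open>x y - (-1)\<^bsup>ij\<^esup> y x = [x, y]\<close>.
\<close>

definition uea_rels :: "('g, 'm) lie_superalgebra_scheme \<Rightarrow> ('g list \<Rightarrow>\<^sub>0 complex) set" where
  "uea_rels G =
     {Poly_Mapping.single [x \<oplus>\<^bsub>G\<^esub> y] 1 - Poly_Mapping.single [x] 1 - Poly_Mapping.single [y] 1 | x y.
        x \<in> carrier G \<and> y \<in> carrier G} \<union>
     {Poly_Mapping.single [c \<odot>\<^bsub>G\<^esub> x] 1 - Poly_Mapping.single [x] c | c x. x \<in> carrier G} \<union>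
     {Poly_Mapping.single [x, y] 1 - Poly_Mapping.single [y, x] (ksign i j)
        - Poly_Mapping.single [bracket G x y] 1 | x y i j. x \<in> hpart G i \<and> y \<in> hpart G j}"

definition uea_ideal :: "('g, 'm) lie_superalgebra_scheme \<Rightarrow> ('g list \<Rightarrow>\<^sub>0 complex) set" where
  "uea_ideal G = Idl\<^bsub>free_algebra (carrier G)\<^esub> (uea_rels G)"

definition uea :: "('g, 'm) lie_superalgebra_scheme \<Rightarrow> ('g list \<Rightarrow>\<^sub>0 complex) set ring" where
  "uea G = free_algebra (carrier G) Quot uea_ideal G"

definition uea_class ::
  "('g, 'm) lie_superalgebra_scheme \<Rightarrow> ('g list \<Rightarrow>\<^sub>0 complex) \<Rightarrow> ('g list \<Rightarrow>\<^sub>0 complex) set" where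
  "uea_class G p = uea_ideal G +>\<^bsub>free_algebra (carrier G)\<^esub> p"

text \<open>The empty list of degrees covers the empty word, so scalars are even.\<close>

definition uea_part ::
  "('g, 'm) lie_superalgebra_scheme \<Rightarrow> bit \<Rightarrow> ('g list \<Rightarrow>\<^sub>0 complex) set set" where
  "uea_part G i =
     uea_class G ` {p. Poly_Mapping.keys p \<subseteq>
       {xs. \<exists>ds. list_all2 (\<lambda>x d. x \<in> hpart G d) xs ds \<and> sum_list ds = i}}"

text \<open>The homomorphism \<open>U(H) \<rightarrow> U(G)\<close> induced by the inclusion of a subalgebra \<open>H\<close> of \<open>G\<close>.\<close>

definition uea_incl ::
  "('g, 'm) lie_superalgebra_scheme \<Rightarrow> ('g, 'n) lie_superalgebra_scheme
    \<Rightarrow> ('g list \<Rightarrow>\<^sub>0 complex) set \<Rightarrow> ('g list \<Rightarrow>\<^sub>0 complex) set" where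
  "uea_incl H G Y = the_elem (uea_class G ` Y)"

text \<open>The \<open>U(H)\<close>-module structure of an \<open>H\<close>-module: a word acts letter by letter.\<close>

definition word_act :: "('g, 'v, 'n) supermodule_scheme \<Rightarrow> ('g list \<Rightarrow>\<^sub>0 complex) \<Rightarrow> 'v \<Rightarrow> 'v" where
  "word_act V p v =
     (\<Oplus>\<^bsub>V\<^esub>xs\<in>Poly_Mapping.keys p. Poly_Mapping.lookup p xs \<odot>\<^bsub>V\<^esub> foldr (act V) xs v)"

definition uea_act ::
  "('g, 'v, 'n) supermodule_scheme \<Rightarrow> ('g list \<Rightarrow>\<^sub>0 complex) set \<Rightarrow> 'v \<Rightarrow> 'v" where
  "uea_act V Y v = the_elem ((\<lambda>p. word_act V p v) ` Y)"

text \<open>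
  \<open>U(G) \<otimes>\<^bsub>U(H)\<^esub> V\<close> is the free vector space on \<open>U(G) \<times> V\<close> modulo the subspace spanned by the
  relations of \<open>\<complex>\<close>-bilinearity and \<open>U(H)\<close>-balancedness.
\<close>

type_synonym ('g, 'v) pretensor = "(('g list \<Rightarrow>\<^sub>0 complex) set \<times> 'v) \<Rightarrow>\<^sub>0 complex"

definition tensor_rels ::
  "('g, 'm) lie_superalgebra_scheme \<Rightarrow> ('g, 'k) lie_superalgebra_scheme
    \<Rightarrow> ('g, 'v, 'n) supermodule_scheme \<Rightarrow> ('g, 'v) pretensor set" where
  "tensor_rels G H V =
     {Poly_Mapping.single (Q \<oplus>\<^bsub>uea G\<^esub> R, v) 1 - Poly_Mapping.single (Q, v) 1
        - Poly_Mapping.single (R, v) 1 | Q R v.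
        Q \<in> carrier (uea G) \<and> R \<in> carrier (uea G) \<and> v \<in> carrier V} \<union>
     {Poly_Mapping.single (Q, v \<oplus>\<^bsub>V\<^esub> w) 1 - Poly_Mapping.single (Q, v) 1
        - Poly_Mapping.single (Q, w) 1 | Q v w.
        Q \<in> carrier (uea G) \<and> v \<in> carrier V \<and> w \<in> carrier V} \<union>
     {Poly_Mapping.single (uea_class G (Poly_Mapping.single [] c) \<otimes>\<^bsub>uea G\<^esub> Q, v) 1
        - Poly_Mapping.single (Q, v) c | c Q v.
        Q \<in> carrier (uea G) \<and> v \<in> carrier V} \<union>
     {Poly_Mapping.single (Q, c \<odot>\<^bsub>V\<^esub> v) 1 - Poly_Mapping.single (Q, v) c | c Q v.
        Q \<in> carrier (uea G) \<and> v \<in> carrier V} \<union>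
     {Poly_Mapping.single (Q \<otimes>\<^bsub>uea G\<^esub> uea_incl H G R, v) 1
        - Poly_Mapping.single (Q, uea_act V R v) 1 | Q R v.
        Q \<in> carrier (uea G) \<and> R \<in> carrier (uea H) \<and> v \<in> carrier V}"

definition pretensor_space ::
  "('g, 'm) lie_superalgebra_scheme \<Rightarrow> ('g, 'v, 'n) supermodule_scheme
    \<Rightarrow> (complex, ('g, 'v) pretensor) module" where
  "pretensor_space G V = free_space (carrier (uea G) \<times> carrier V)"

definition tensor_null ::
  "('g, 'm) lie_superalgebra_scheme \<Rightarrow> ('g, 'k) lie_superalgebra_scheme
    \<Rightarrow> ('g, 'v, 'n) supermodule_scheme \<Rightarrow> ('g, 'v) pretensor set" where
  "tensor_null G H V = \<Inter>{N. submodule N CC (pretensor_space G V) \<and> tensor_rels G H V \<subseteq> N}"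

definition tensor_class ::
  "('g, 'm) lie_superalgebra_scheme \<Rightarrow> ('g, 'k) lie_superalgebra_scheme
    \<Rightarrow> ('g, 'v, 'n) supermodule_scheme \<Rightarrow> ('g, 'v) pretensor \<Rightarrow> ('g, 'v) pretensor set" where
  "tensor_class G H V f = tensor_null G H V +>\<^bsub>pretensor_space G V\<^esub> f"

definition left_mult ::
  "('g, 'm) lie_superalgebra_scheme \<Rightarrow> 'g \<Rightarrow> ('g, 'v) pretensor \<Rightarrow> ('g, 'v) pretensor" where
  "left_mult G x f =
     (\<Sum>(Q, v)\<in>Poly_Mapping.keys f.
        Poly_Mapping.single (uea_class G (Poly_Mapping.single [x] 1) \<otimes>\<^bsub>uea G\<^esub> Q, v)
          (Poly_Mapping.lookup f (Q, v)))"

text \<open>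
  Operations on cosets are unions over representatives, as in \<^const>\<open>rcoset_mult\<close>.
\<close>

definition induced_module ::
  "('g, 'm) lie_superalgebra_scheme \<Rightarrow> ('g, 'k) lie_superalgebra_scheme
    \<Rightarrow> ('g, 'v, 'n) supermodule_scheme \<Rightarrow> ('g, ('g, 'v) pretensor set) supermodule" where
  "induced_module G H V =
     \<lparr>carrier = a_rcosets\<^bsub>pretensor_space G V\<^esub> (tensor_null G H V),
      monoid.mult = undefined, one = undefined,
      zero = tensor_null G H V,
      add = set_add (pretensor_space G V),
      module.smult = (\<lambda>c A. \<Union>f\<in>A. tensor_class G H V (pscale c f)),
      hpart = (\<lambda>k. tensor_class G H V ` {f. Poly_Mapping.keys f \<subseteq>
        {(Q, v). \<exists>i j. Q \<in> uea_part G i \<and> v \<in> hpart V j \<and> i + j = k}}),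
      act = (\<lambda>x A. \<Union>f\<in>A. tensor_class G H V (left_mult G x f))\<rparr>"


section \<open>The super extended Ovsienko--Roger algebra\<close>

text \<open>Half-integral indices are shifted: \<open>bG k\<close> is the basis vector \<open>G\<^bsub>k + 1/2\<^esub>\<close>.\<close>

datatype or_basis = bL int | bW int | bG int | bC1 | bC2

type_synonym or_space = "or_basis \<Rightarrow>\<^sub>0 complex"

fun or_degree :: "or_basis \<Rightarrow> bit" where
  "or_degree (bG k) = 1"
| "or_degree _ = 0"

text \<open>
  With \<open>r = j + 1/2\<close> and \<open>s = k + 1/2\<close> one has \<open>r + s = j + k + 1\<close>. The equations with the
  arguments in the opposite order are forced by super skew-symmetry.
\<close>

fun basis_bracket :: "or_basis \<Rightarrow> or_basis \<Rightarrow> or_space" where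
  "basis_bracket (bL m) (bL n) =
     Poly_Mapping.single (bL (m + n)) (of_int (n - m))
     + Poly_Mapping.single bC1 (if m + n = 0 then of_int (m ^ 3 - m) / 12 else 0)"
| "basis_bracket (bL m) (bW n) =
     Poly_Mapping.single (bW (m + n)) (of_int (m + n))
     + Poly_Mapping.single bC2 (if m + n = 0 then 1 else 0)"
| "basis_bracket (bW n) (bL m) =
     - (Poly_Mapping.single (bW (m + n)) (of_int (m + n))
        + Poly_Mapping.single bC2 (if m + n = 0 then 1 else 0))"
| "basis_bracket (bL m) (bG k) = Poly_Mapping.single (bG (m + k)) (of_int k + 1 / 2)"
| "basis_bracket (bG k) (bL m) = - Poly_Mapping.single (bG (m + k)) (of_int k + 1 / 2)"
| "basis_bracket (bG j) (bG k) =
     Poly_Mapping.single (bW (j + k + 1)) (of_int (j + k + 1))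
     + Poly_Mapping.single bC2 (if j + k + 1 = 0 then 1 else 0)"
| "basis_bracket _ _ = 0"

definition or_bracket :: "or_space \<Rightarrow> or_space \<Rightarrow> or_space" where
  "or_bracket x y =
     (\<Sum>a\<in>Poly_Mapping.keys x. \<Sum>b\<in>Poly_Mapping.keys y.
        pscale (Poly_Mapping.lookup x a * Poly_Mapping.lookup y b) (basis_bracket a b))"

definition OR :: "or_space lie_superalgebra" where
  "OR =
     \<lparr>carrier = UNIV, monoid.mult = undefined, one = undefined, zero = 0, add = (+), module.smult = pscale,
      hpart = (\<lambda>i. {x. Poly_Mapping.keys x \<subseteq> {b. or_degree b = i}}),
      bracket = or_bracket\<rparr>"

definition L :: "int \<Rightarrow> or_space" where "L m = Poly_Mapping.single (bL m) 1"

definition W :: "int \<Rightarrow> or_space" where "W m = Poly_Mapping.single (bW m) 1"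

text \<open>\<open>G_half k\<close> is \<open>G\<^bsub>k + 1/2\<^esub>\<close>.\<close>

definition G_half :: "int \<Rightarrow> or_space" where "G_half k = Poly_Mapping.single (bG k) 1"

definition C1 :: or_space where "C1 = Poly_Mapping.single bC1 1"

definition C2 :: or_space where "C2 = Poly_Mapping.single bC2 1"

text \<open>In the description of the odd part, \<open>bG (i - 1)\<close> is \<open>G\<^bsub>i - 1/2\<^esub>\<close>.\<close>

definition T_basis :: "nat \<Rightarrow> or_basis set" where
  "T_basis d =
     {bL (int i) | i. True} \<union> {bW (int i - int d) | i. True} \<union> {bG (int i - 1) | i. 1 \<le> i}
     \<union> {bC1, bC2}"

definition T_space :: "nat \<Rightarrow> or_space set" where
  "T_space d = {x. Poly_Mapping.keys x \<subseteq> T_basis d}"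

definition T :: "nat \<Rightarrow> or_space lie_superalgebra" where
  "T d = OR\<lparr>carrier := T_space d, hpart := (\<lambda>i. hpart OR i \<inter> T_space d)\<rparr>"

definition restricted :: "(or_space, 'v, 'n) supermodule_scheme \<Rightarrow> bool" where
  "restricted M \<longleftrightarrow>
     (\<forall>v\<in>carrier M. \<exists>N. \<forall>i\<ge>N.
        act M (L i) v = \<zero>\<^bsub>M\<^esub> \<and> act M (W i) v = \<zero>\<^bsub>M\<^esub> \<and> act M (G_half i) v = \<zero>\<^bsub>M\<^esub>)"

definition central_scalars ::
  "(or_space, 'v, 'n) supermodule_scheme \<Rightarrow> complex \<Rightarrow> complex \<Rightarrow> bool" where
  "central_scalars M c1 c2 \<longleftrightarrow>
     (\<forall>v\<in>carrier M. act M C1 v = c1 \<odot>\<^bsub>M\<^esub> v \<and> act M C2 v = c2 \<odot>\<^bsub>M\<^esub> v)"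


subsection \<open>The Lie superalgebra axioms\<close>

lemma lookup_pscale [simp]: "Poly_Mapping.lookup (pscale c p) k = c * Poly_Mapping.lookup p k"
  by (simp add: pscale_def Poly_Mapping.map.rep_eq when_def)

lemma keys_pscale: "Poly_Mapping.keys (pscale c p) \<subseteq> Poly_Mapping.keys p"
  by (auto simp: in_keys_iff)

lemma pscale_simps:
  "pscale c (x + y) = pscale c x + pscale c y" "pscale (a + b) x = pscale a x + pscale b x"
  "pscale a (pscale b x) = pscale (a * b) x" "pscale 1 x = x" "pscale 0 x = 0" "pscale a 0 = 0"
  "pscale a (- x) = - pscale a x" "pscale (- a) x = - pscale a x"
  "pscale a (x - y) = pscale a x - pscale a y"
  "pscale a (Poly_Mapping.single k b) = Poly_Mapping.single k (a * b)"
  by (auto intro!: poly_mapping_eqI simp: lookup_add algebra_simps lookup_minus lookup_single when_def)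

lemma pscale_sum: "pscale c (sum f A) = (\<Sum>a\<in>A. pscale c (f a))"
  by (induction A rule: infinite_finite_induct) (auto simp: pscale_simps)

lemma or_bracket_superset:
  assumes "finite A" "finite B" "Poly_Mapping.keys x \<subseteq> A" "Poly_Mapping.keys y \<subseteq> B"
  shows "or_bracket x y = (\<Sum>a\<in>A. \<Sum>b\<in>B.
    pscale (Poly_Mapping.lookup x a * Poly_Mapping.lookup y b) (basis_bracket a b))"
proof -
  have "(\<Sum>b\<in>Poly_Mapping.keys y. pscale (Poly_Mapping.lookup x a * Poly_Mapping.lookup y b) (basis_bracket a b))
    = (\<Sum>b\<in>B. pscale (Poly_Mapping.lookup x a * Poly_Mapping.lookup y b) (basis_bracket a b))" for a
    using assms by (intro sum.mono_neutral_left) (auto simp: in_keys_iff pscale_simps)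
  then show ?thesis unfolding or_bracket_def
    using assms by (auto intro!: sum.mono_neutral_left sum.neutral simp: in_keys_iff pscale_simps)
qed

lemma or_bracket_add_left: "or_bracket (x + y) z = or_bracket x z + or_bracket y z"
proof -
  let ?A = "Poly_Mapping.keys x \<union> Poly_Mapping.keys y" and ?B = "Poly_Mapping.keys z"
  show ?thesis
    by (subst (1 2 3) or_bracket_superset[of ?A ?B])
      (auto simp: Poly_Mapping.keys_add[THEN subsetD] lookup_add distrib_right pscale_simps sum.distrib
        dest: Poly_Mapping.keys_add[THEN subsetD])
qed

lemma or_bracket_add_right: "or_bracket z (x + y) = or_bracket z x + or_bracket z y"
proof -
  let ?A = "Poly_Mapping.keys x \<union> Poly_Mapping.keys y" and ?B = "Poly_Mapping.keys z"
  show ?thesis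
    by (subst (1 2 3) or_bracket_superset[of ?B ?A])
      (auto simp: lookup_add distrib_left pscale_simps sum.distrib
        dest: Poly_Mapping.keys_add[THEN subsetD])
qed

lemma or_bracket_pscale_left: "or_bracket (pscale c x) y = pscale c (or_bracket x y)"
  by (subst or_bracket_superset[of "Poly_Mapping.keys x" "Poly_Mapping.keys y"])
    (auto simp: or_bracket_def pscale_sum pscale_simps mult.assoc dest: keys_pscale[THEN subsetD])

lemma or_bracket_pscale_right: "or_bracket x (pscale c y) = pscale c (or_bracket x y)"
  by (subst or_bracket_superset[of "Poly_Mapping.keys x" "Poly_Mapping.keys y"])
    (auto simp: or_bracket_def pscale_sum pscale_simps mult_ac dest: keys_pscale[THEN subsetD])

lemma or_bracket_single:
  "or_bracket (Poly_Mapping.single a c) (Poly_Mapping.single b d) = pscale (c * d) (basis_bracket a b)"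
  by (subst or_bracket_superset[of "{a}" "{b}"]) auto

lemma or_bracket_zero [simp]: "or_bracket 0 x = 0" "or_bracket x 0 = 0"
  by (simp_all add: or_bracket_def)

lemma or_bracket_minus: "or_bracket (- x) y = - or_bracket x y" "or_bracket x (- y) = - or_bracket x y"
  using or_bracket_pscale_left[of "-1" x y] or_bracket_pscale_right[of x "-1" y]
  by (simp_all add: pscale_simps)

lemmas or_bracket_simps = or_bracket_add_left or_bracket_add_right or_bracket_pscale_left
  or_bracket_pscale_right or_bracket_single or_bracket_minus

lemma free_space_induct [consumes 1, case_names single add zero]:
  assumes "Poly_Mapping.keys x \<subseteq> S"
    and "\<And>b c. b \<in> S \<Longrightarrow> P (Poly_Mapping.single b c)"
    and "\<And>f g. P f \<Longrightarrow> P g \<Longrightarrow> P (f + g)"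
    and "P 0"
  shows "P (x :: 'b \<Rightarrow>\<^sub>0 complex)"
proof -
  have *: "x = (\<Sum>b\<in>Poly_Mapping.keys x. Poly_Mapping.single b (Poly_Mapping.lookup x b))"
    by (rule poly_mapping_eqI) (simp add: lookup_sum lookup_single when_def in_keys_iff)
  have "P (\<Sum>b\<in>K. Poly_Mapping.single b (Poly_Mapping.lookup x b))" if "finite K" "K \<subseteq> S" for K
    using that by induction (auto intro: assms)
  with * assms(1) show ?thesis by (metis finite_keys)
qed

lemma basis_skew: "basis_bracket a b = pscale (- ksign (or_degree a) (or_degree b)) (basis_bracket b a)"
proof -
  have "Poly_Mapping.single bC1 ((complex_of_int m ^ 3 - complex_of_int m) / 12) =
      Poly_Mapping.single bC1 (- ((complex_of_int n ^ 3 - complex_of_int n) / 12))"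
    if "m + n = 0" for m n
  proof -
    have "n = - m" using that by simp
    then have "(complex_of_int m ^ 3 - complex_of_int m) / 12 = - ((complex_of_int n ^ 3 - complex_of_int n) / 12)"
      by (simp add: divide_simps)
    then show ?thesis by (rule arg_cong)
  qed
  then show ?thesis
    by (cases a; cases b)
      (auto simp: ksign_def pscale_simps algebra_simps simp flip: single_uminus)
qed

lemma or_bracket_diff: "or_bracket (x - z) y = or_bracket x y - or_bracket z y"
    "or_bracket y (x - z) = or_bracket y x - or_bracket y z"
  using or_bracket_add_left[of x "- z" y] or_bracket_add_right[of y x "- z"]
  by (simp_all add: or_bracket_minus)

lemma virasoro_cocycle:
  fixes x y z :: int
  shows "(complex_of_int z - complex_of_int y) *
      (if x + (y + z) = 0 then complex_of_int (x ^ 3 - x) / 12 else 0) =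
    (complex_of_int z - complex_of_int x) *
      (if x + (y + z) = 0 then complex_of_int (y ^ 3 - y) / 12 else 0) +
    (complex_of_int y - complex_of_int x) *
      (if x + (y + z) = 0 then complex_of_int ((x + y) ^ 3 - (x + y)) / 12 else 0)"
proof (cases "x + (y + z) = 0")
  case True
  then have z: "z = - x - y" by simp
  show ?thesis unfolding z by (simp add: field_simps power3_eq_cube)
qed simp

lemma when_rules:
  fixes A B C :: complex
  shows "A = B + C \<Longrightarrow> (A when c) = (B when c) + (C when c)"
    and "A = B + C \<Longrightarrow> A * D = B * D + C * D"
    and "- A = - B - C \<Longrightarrow> - (A when c) = - (B when c) - (C when c)"
    and "- A = - B - C \<Longrightarrow> - (A * D) = - (B * D) - C * D"
    and "- A = B - C \<Longrightarrow> - (A when c) = (B when c) - (C when c)"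
    and "- A = B - C \<Longrightarrow> - (A * D) = B * D - C * D"
    and "A = B - C \<Longrightarrow> (A when c) = (B when c) - (C when c)"
    and "A = B - C \<Longrightarrow> A * D = B * D - C * D"
  by (simp add: when_def)
    (simp only: flip: distrib_right,
     simp add: when_def,
     simp only: minus_mult_left flip: left_diff_distrib,
     simp add: when_def,
     simp only: minus_mult_left flip: left_diff_distrib,
     simp add: when_def,
     simp only: flip: left_diff_distrib)

lemma basis_jacobi:
  "or_bracket (Poly_Mapping.single a 1) (basis_bracket b c) =
     or_bracket (basis_bracket a b) (Poly_Mapping.single c 1)
     + pscale (ksign (or_degree a) (or_degree b)) (or_bracket (Poly_Mapping.single b 1) (basis_bracket a c))"
  apply (cases a; cases b; cases c)
  apply (simp_all add: ksign_def or_bracket_simps or_bracket_diff pscale_simps split del: if_split)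
  apply (rule_tac [!] poly_mapping_eqI)
  apply (case_tac [!] k)
  apply (simp_all add: lookup_add lookup_minus lookup_single ac_simps split del: if_split)
  apply (rule_tac [2] virasoro_cocycle)
  apply (rule_tac [!] when_rules)
  apply (simp_all (no_asm) add: algebra_simps)
  done

lemma basis_bracket_degree:
  "Poly_Mapping.keys (basis_bracket a b) \<subseteq> {c. or_degree c = or_degree a + or_degree b}"
  by (cases a; cases b) (auto dest!: Poly_Mapping.keys_add[THEN subsetD] keys_diff[THEN subsetD] split: if_splits)

definition OR_on :: "or_basis set \<Rightarrow> or_space lie_superalgebra" where
  "OR_on S = OR\<lparr>carrier := {x. Poly_Mapping.keys x \<subseteq> S},
     hpart := (\<lambda>i. hpart OR i \<inter> {x. Poly_Mapping.keys x \<subseteq> S})\<rparr>"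

lemma OR_on_simps [simp]:
  "carrier (OR_on S) = {x. Poly_Mapping.keys x \<subseteq> S}" "zero (OR_on S) = 0" "add (OR_on S) = (+)"
  "module.smult (OR_on S) = pscale" "bracket (OR_on S) = or_bracket"
  "hpart (OR_on S) i = {x. Poly_Mapping.keys x \<subseteq> {b \<in> S. or_degree b = i}}"
  by (auto simp: OR_on_def OR_def)

lemma CC_simps [simp]:
  "carrier CC = UNIV" "zero CC = 0" "one CC = 1" "add CC = (+)" "monoid.mult CC = (*)"
  by (simp_all add: ring_of_type_algebra_def)

lemma keys_add_subset: "Poly_Mapping.keys x \<subseteq> S \<Longrightarrow> Poly_Mapping.keys y \<subseteq> S \<Longrightarrow> Poly_Mapping.keys (x + y) \<subseteq> S"
  by (meson Poly_Mapping.keys_add Un_least order_trans)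

lemma keys_pscale_subset: "Poly_Mapping.keys x \<subseteq> S \<Longrightarrow> Poly_Mapping.keys (pscale c x) \<subseteq> S"
  by (meson keys_pscale order_trans)

lemma OR_on_module: "module CC (OR_on S)"
proof (rule moduleI)
  show "cring CC" by (rule cring_from_type_algebra)
  show "abelian_group (OR_on S)"
  proof (rule abelian_groupI)
    fix x assume "x \<in> carrier (OR_on S)"
    then show "\<exists>y\<in>carrier (OR_on S). y \<oplus>\<^bsub>OR_on S\<^esub> x = \<zero>\<^bsub>OR_on S\<^esub>"
      by (intro bexI[of _ "- x"]) auto
  qed (auto simp: keys_add_subset add_ac)
qed (auto simp: keys_pscale_subset pscale_simps keys_add_subset)

lemma or_bracket_keys:
  assumes "\<And>a b. a \<in> A \<Longrightarrow> b \<in> B \<Longrightarrow> Poly_Mapping.keys (basis_bracket a b) \<subseteq> C"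
    and "Poly_Mapping.keys x \<subseteq> A" "Poly_Mapping.keys y \<subseteq> B"
  shows "Poly_Mapping.keys (or_bracket x y) \<subseteq> C"
  using assms(2)
proof (induction x rule: free_space_induct)
  case (single a c)
  from assms(3) show ?case
    by (induction y rule: free_space_induct)
      (simp_all add: or_bracket_add_right or_bracket_single keys_add_subset keys_pscale_subset assms(1) single)
qed (simp_all add: or_bracket_add_left keys_add_subset)

lemma or_skew:
  assumes "Poly_Mapping.keys x \<subseteq> {b. or_degree b = i}" "Poly_Mapping.keys y \<subseteq> {b. or_degree b = j}"
  shows "or_bracket x y = pscale (- ksign i j) (or_bracket y x)"
  using assms(1)
proof (induction x rule: free_space_induct)
  case (single a c)
  from assms(2) show ?case
  proof (induction y rule: free_space_induct)
    case (single b d)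
    with \<open>a \<in> _\<close> show ?case
      by (simp add: or_bracket_simps basis_skew[of a b] pscale_simps mult_ac)
  qed (auto simp: or_bracket_simps pscale_simps)
qed (auto simp: or_bracket_simps pscale_simps)

lemma single_pscale: "Poly_Mapping.single a c = pscale c (Poly_Mapping.single a 1)"
  by (simp add: pscale_simps)

lemma or_jacobi:
  assumes "Poly_Mapping.keys x \<subseteq> {b. or_degree b = i}" "Poly_Mapping.keys y \<subseteq> {b. or_degree b = j}"
    "Poly_Mapping.keys z \<subseteq> {b. or_degree b = k}"
  shows "or_bracket x (or_bracket y z) =
    or_bracket (or_bracket x y) z + pscale (ksign i j) (or_bracket y (or_bracket x z))"
  using assms(1)
proof (induction x rule: free_space_induct)
  case (single a c)
  from assms(2) show ?case
  proof (induction y rule: free_space_induct)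
    case (single b d)
    from assms(3) show ?case
    proof (induction z rule: free_space_induct)
      case (single e f)
      with \<open>a \<in> _\<close> \<open>b \<in> _\<close> basis_jacobi[of a b e] show ?case
        by (subst (1 2 3 4 5 6) single_pscale)
          (simp add: or_bracket_pscale_left or_bracket_pscale_right or_bracket_single pscale_simps mult_ac
            del: pscale_simps(10))
    qed (auto simp: or_bracket_simps pscale_simps)
  qed (auto simp: or_bracket_simps pscale_simps)
qed (auto simp: or_bracket_simps pscale_simps)

lemma OR_on_lie_superalgebra:
  assumes "\<And>a b. a \<in> S \<Longrightarrow> b \<in> S \<Longrightarrow> Poly_Mapping.keys (basis_bracket a b) \<subseteq> S"
  shows "lie_superalgebra (OR_on S)"
proof -
  interpret module CC "OR_on S" by (rule OR_on_module)
  have neg: "\<ominus>\<^bsub>OR_on S\<^esub> x = - x" if "Poly_Mapping.keys x \<subseteq> S" for x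
    using that by (intro minus_equality) auto
  show ?thesis
  proof (intro lie_superalgebra.intro superspace.intro superspace_axioms.intro
      lie_superalgebra_axioms.intro OR_on_module)
    fix i show "submodule (hpart (OR_on S) i) CC (OR_on S)"
      by (rule submoduleI)
        (auto simp: neg keys_add_subset keys_pscale_subset subset_iff dest: Poly_Mapping.keys_add[THEN subsetD]
          keys_pscale[THEN subsetD])
  next
    have "x = 0" if "Poly_Mapping.keys x \<subseteq> {b \<in> S. or_degree b = 0}"
      "Poly_Mapping.keys x \<subseteq> {b \<in> S. or_degree b = 1}" for x :: or_space
    proof -
      from that have "Poly_Mapping.keys x \<subseteq> {b \<in> S. or_degree b = 0} \<inter> {b \<in> S. or_degree b = 1}"
        by blast
      also have "\<dots> = {}" by auto
      finally show ?thesis by simp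
    qed
    then show "hpart (OR_on S) 0 \<inter> hpart (OR_on S) 1 = {\<zero>\<^bsub>OR_on S\<^esub>}"
      by auto
  next
    have split: "\<exists>y z. x = y + z \<and> Poly_Mapping.keys y \<subseteq> {b \<in> S. or_degree b = 0} \<and>
        Poly_Mapping.keys z \<subseteq> {b \<in> S. or_degree b = 1}"
      if "Poly_Mapping.keys x \<subseteq> S" for x :: or_space
      using that
    proof (induction x rule: free_space_induct)
      case (single b c)
      show ?case
      proof (cases "or_degree b = 0")
        case True
        with single show ?thesis
          by (rule_tac exI[of _ "Poly_Mapping.single b c"], rule_tac exI[of _ 0]) simp
      next
        case False
        with single show ?thesis
          by (rule_tac exI[of _ 0], rule_tac exI[of _ "Poly_Mapping.single b c"]) simp
      qed
    next
      case (add f g)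
      then obtain y z y' z' where "f = y + z" "g = y' + z'"
        "Poly_Mapping.keys y \<subseteq> {b \<in> S. or_degree b = 0}" "Poly_Mapping.keys z \<subseteq> {b \<in> S. or_degree b = 1}"
        "Poly_Mapping.keys y' \<subseteq> {b \<in> S. or_degree b = 0}" "Poly_Mapping.keys z' \<subseteq> {b \<in> S. or_degree b = 1}"
        by blast
      then show ?case
        by (rule_tac exI[of _ "y + y'"], rule_tac exI[of _ "z + z'"]) (simp add: keys_add_subset add_ac)
    next
      case zero
      show ?case
        by (rule_tac exI[of _ 0], rule_tac exI[of _ 0]) simp
    qed
    have sum: "Poly_Mapping.keys (y + z) \<subseteq> S"
      if "Poly_Mapping.keys y \<subseteq> {b \<in> S. or_degree b = 0}" "Poly_Mapping.keys z \<subseteq> {b \<in> S. or_degree b = 1}"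
      for y z :: or_space
      using that by (intro keys_add_subset) auto
    have "hpart (OR_on S) 0 <+>\<^bsub>OR_on S\<^esub> hpart (OR_on S) 1 =
        {y + z | y z. Poly_Mapping.keys y \<subseteq> {b \<in> S. or_degree b = 0} \<and>
          Poly_Mapping.keys z \<subseteq> {b \<in> S. or_degree b = 1}}"
      by (auto simp: set_add_def set_mult_def)
    also have "\<dots> = carrier (OR_on S)"
    proof (intro equalityI subsetI)
      fix x assume "x \<in> carrier (OR_on S)"
      with split[of x] show "x \<in> {y + z | y z. Poly_Mapping.keys y \<subseteq> {b \<in> S. or_degree b = 0} \<and>
          Poly_Mapping.keys z \<subseteq> {b \<in> S. or_degree b = 1}}"
        by simp
    next
      fix x :: or_space assume "x \<in> {y + z | y z. Poly_Mapping.keys y \<subseteq> {b \<in> S. or_degree b = 0} \<and>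
          Poly_Mapping.keys z \<subseteq> {b \<in> S. or_degree b = 1}}"
      then obtain y z where x: "x = y + z" and y: "Poly_Mapping.keys y \<subseteq> {b \<in> S. or_degree b = 0}"
        and z: "Poly_Mapping.keys z \<subseteq> {b \<in> S. or_degree b = 1}"
        by blast
      from sum[OF y z] x show "x \<in> carrier (OR_on S)" by simp
    qed
    finally show "hpart (OR_on S) 0 <+>\<^bsub>OR_on S\<^esub> hpart (OR_on S) 1 = carrier (OR_on S)" .
  next
    fix x y i j assume "x \<in> hpart (OR_on S) i" "y \<in> hpart (OR_on S) j"
    then have x: "Poly_Mapping.keys x \<subseteq> {b \<in> S. or_degree b = i}"
      and y: "Poly_Mapping.keys y \<subseteq> {b \<in> S. or_degree b = j}" by simp_all
    have "Poly_Mapping.keys (basis_bracket a b) \<subseteq> {c \<in> S. or_degree c = i + j}"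
      if "a \<in> {b \<in> S. or_degree b = i}" "b \<in> {b \<in> S. or_degree b = j}" for a b
      using that assms[of a b] basis_bracket_degree[of a b] by blast
    from or_bracket_keys[OF this x y]
    show "bracket (OR_on S) x y \<in> hpart (OR_on S) (i + j)" by simp
    from x have x': "Poly_Mapping.keys x \<subseteq> {b. or_degree b = i}" by blast
    from y have y': "Poly_Mapping.keys y \<subseteq> {b. or_degree b = j}" by blast
    show "bracket (OR_on S) x y = (- ksign i j) \<odot>\<^bsub>OR_on S\<^esub> bracket (OR_on S) y x"
      using or_skew[OF x' y'] by simp
    fix z k assume "z \<in> hpart (OR_on S) k"
    then have z': "Poly_Mapping.keys z \<subseteq> {b. or_degree b = k}" by auto
    show "bracket (OR_on S) x (bracket (OR_on S) y z) =
        bracket (OR_on S) (bracket (OR_on S) x y) z \<oplus>\<^bsub>OR_on S\<^esub>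
        ksign i j \<odot>\<^bsub>OR_on S\<^esub> bracket (OR_on S) y (bracket (OR_on S) x z)"
      using or_jacobi[OF x' y' z'] by simp
  qed (simp_all add: or_bracket_add_left or_bracket_add_right or_bracket_pscale_left or_bracket_pscale_right)
qed

theorem OR_lie_superalgebra: "lie_superalgebra OR"
proof -
  have "OR = OR_on UNIV" by (simp add: OR_on_def OR_def)
  with OR_on_lie_superalgebra[of UNIV] show ?thesis by simp
qed

lemma T_basis_bracket:
  assumes "a \<in> T_basis d" "b \<in> T_basis d"
  shows "Poly_Mapping.keys (basis_bracket a b) \<subseteq> T_basis d"
proof -
  have T: "T_basis d = {bL m | m. 0 \<le> m} \<union> {bW m | m. - int d \<le> m} \<union> {bG k | k. 0 \<le> k} \<union> {bC1, bC2}"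
  proof -
    have "\<exists>i. m = int i \<and> True" if "0 \<le> m" for m using that by (intro exI[of _ "nat m"]) auto
    moreover have "\<exists>i. m = int i - int d" if "- int d \<le> m" for m
      using that by (intro exI[of _ "nat (m + int d)"]) auto
    moreover have "\<exists>i. m = int i - 1 \<and> 1 \<le> i" if "0 \<le> m" for m
      using that by (intro exI[of _ "nat (m + 1)"]) auto
    ultimately show ?thesis unfolding T_basis_def by auto
  qed
  show ?thesis
    using assms unfolding T
    by (cases a; cases b) (auto dest!: Poly_Mapping.keys_add[THEN subsetD] keys_diff[THEN subsetD] split: if_splits)
qed

theorem T_lie_superalgebra: "lie_superalgebra (T d)"
proof -
  have "T d = OR_on (T_basis d)" by (simp add: OR_on_def T_def T_space_def)
  with OR_on_lie_superalgebra[of "T_basis d"] T_basis_bracket show ?thesis by simp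
qed

end

theory Submission
  imports Defs "HOL-Library.Multiset"
begin

text \<open>
  Put \<open>Z\<^sub>k = k W\<^sub>k + \<delta>\<^bsub>k,0\<^esub> C\<^sub>2\<close>. Then \<open>[L\<^sub>m, W\<^sub>n] = Z\<^bsub>m+n\<^esub>\<close> and
  \<open>[G\<^sub>r, G\<^sub>s] = Z\<^bsub>r+s\<^esub>\<close>. Let \<open>V\<close> be the space of vectors killed by the raising elements \<open>W\<^sub>i\<close>,
  \<open>G\<^sub>r\<close> (\<open>i, r > t\<close>) and \<open>L\<^sub>j\<close> (\<open>j > t + d\<close>), where \<open>t\<close> is the least number for which some \<open>d\<close> gives
  a nonzero space. By minimality and \<open>c\<^sub>2 \<noteq> 0\<close>, \<open>Z\<^sub>t\<close> is injective on \<open>V\<close>. The elements that \<open>T\<^sub>d\<close>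
  lacks, \<open>W\<^bsub>-d-i\<^esub>\<close>, \<open>G\<^bsub>-r\<^esub>\<close> and \<open>L\<^bsub>-i\<^esub>\<close>, pair with the raising elements \<open>L\<^bsub>t+d+i\<^esub>\<close>,
  \<open>G\<^bsub>t+r\<^esub>\<close> and \<open>W\<^bsub>t+i\<^esub>\<close> to \<open>Z\<^sub>t\<close>, like creation and annihilation operators. Hence in a module \<open>M\<close>
  generated by \<open>V\<close>, with a submodule \<open>K\<close> meeting \<open>V\<close> trivially, a vector mapped into \<open>K\<close> by all
  raising elements lies in \<open>V\<close>. For \<open>M = Ind V\<close> and \<open>K\<close> the kernel of \<open>Ind V \<rightarrow> P\<close> this gives \<open>K = 0\<close>;
  for \<open>M = Ind V\<close>, \<open>K = 0\<close> and a submodule of \<open>V\<close> in the role of \<open>V\<close> it gives the simplicity of \<open>V\<close>.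
\<close>

section \<open>Modules generated by singular vectors\<close>

text \<open>The obstacle is that Z_t is only injective on V, neither invertible nor central:
  [L_m, Z_t] = t Z_{m+t}. Annihilation operators return coefficients multiplied by powers of Z_t,
  and such a power can be cancelled only where Z_t commutes with the operator applied. It commutes
  with all W and G, but with L_m only on vectors killed by Z_{m+t}. This dictates the order of the
  layers over V. The negative W come lowest: they are removed by positive L, and this happens where
  the W_i with i > t still kill everything. The negative G follow. The negative L come last, since
  the W that remove them commute with Z_t. The map Ind V \<rightarrow> P is a left inverse of v
  \<mapsto> 1 \<otimes> v, so V embeds in Ind V. The pairing of words in W with words in L does the
  work of linear independence of monomials.\<close>

lemma T_basis_iff [simp]:
  "bL m \<in> T_basis d \<longleftrightarrow> 0 \<le> m" "bW m \<in> T_basis d \<longleftrightarrow> - int d \<le> m" "bG k \<in> T_basis d \<longleftrightarrow> 0 \<le> k"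
  "bC1 \<in> T_basis d" "bC2 \<in> T_basis d"
proof -
  show "bL m \<in> T_basis d \<longleftrightarrow> 0 \<le> m"
    by (auto simp: T_basis_def intro: nonneg_int_cases)
  show "bW m \<in> T_basis d \<longleftrightarrow> - int d \<le> m"
    by (auto simp: T_basis_def intro: exI[of _ "nat (m + int d)"])
  show "bG k \<in> T_basis d \<longleftrightarrow> 0 \<le> k"
    by (auto simp: T_basis_def intro: exI[of _ "nat (k + 1)"])
qed (simp_all add: T_basis_def)

text \<open>The space is a whole type, so that linear algebra needs no carrier sets; the induced
  module is brought into this form later. Signs come from the degrees of the basis vectors alone,
  hence no grading of the space appears.\<close>

locale or_rep = vector_space scale
  for scale :: "complex \<Rightarrow> 'm::ab_group_add \<Rightarrow> 'm" (infixr \<open>*s\<close> 75) +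
  fixes ac :: "or_basis \<Rightarrow> 'm \<Rightarrow> 'm"
  assumes ac_add: "ac b (x + y) = ac b x + ac b y"
    and ac_scale: "ac b (c *s x) = c *s ac b x"
    and ac_bracket: "ac a (ac b x) = ksign (or_degree a) (or_degree b) *s ac b (ac a x) +
      (\<Sum>k\<in>Poly_Mapping.keys (basis_bracket a b). Poly_Mapping.lookup (basis_bracket a b) k *s ac k x)"
begin

definition lin :: "or_space \<Rightarrow> 'm \<Rightarrow> 'm" where
  "lin p x = (\<Sum>k\<in>Poly_Mapping.keys p. Poly_Mapping.lookup p k *s ac k x)"

lemma lin_superset: "finite A \<Longrightarrow> Poly_Mapping.keys p \<subseteq> A \<Longrightarrow> lin p x = (\<Sum>k\<in>A. Poly_Mapping.lookup p k *s ac k x)"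
  unfolding lin_def by (rule sum.mono_neutral_left) (auto simp: in_keys_iff)

lemma lin_add: "lin (p + q) x = lin p x + lin q x"
  using Poly_Mapping.keys_add[of p q]
  by (subst (1 2 3) lin_superset[of "Poly_Mapping.keys p \<union> Poly_Mapping.keys q"])
    (auto simp: lookup_add scale_left_distrib sum.distrib)

lemma lin_zero [simp]: "lin 0 x = 0"
  by (simp add: lin_def)

lemma lin_single [simp]: "lin (Poly_Mapping.single k c) x = c *s ac k x"
  by (subst lin_superset[of "{k}"]) auto

lemma ac_commute: "ac a (ac b x) = ksign (or_degree a) (or_degree b) *s ac b (ac a x) + lin (basis_bracket a b) x"
  using ac_bracket[of a b x] by (simp add: lin_def)

text \<open>In these terms \<open>[L\<^sub>m, Z\<^sub>k] = k Z\<^bsub>m+k\<^esub>\<close> holds for all \<open>m\<close> and \<open>k\<close>, without a central correction.\<close>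

definition Z :: "int \<Rightarrow> 'm \<Rightarrow> 'm" where
  "Z k x = of_int k *s ac (bW k) x + (if k = 0 then ac bC2 x else 0)"

lemma ac_0 [simp]: "ac b 0 = 0"
  using ac_add[of b 0 0] by simp

lemma ac_minus: "ac b (- x) = - ac b x"
  by (metis add.left_inverse add_eq_0_iff ac_add ac_0)

lemma ac_diff: "ac b (x - y) = ac b x - ac b y"
  using ac_add[of b x "- y"] by (simp add: ac_minus)

lemma Z_add: "Z k (x + y) = Z k x + Z k y"
  by (simp add: Z_def ac_add scale_right_distrib)

lemma Z_scale: "Z k (c *s x) = c *s Z k x"
  by (simp add: Z_def ac_scale scale_right_distrib mult.commute)

lemma Z_0 [simp]: "Z k 0 = 0"
  by (simp add: Z_def)

section \<open>Commutation relations\<close>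

lemma L_L: "m + n \<noteq> 0 \<Longrightarrow>
    ac (bL m) (ac (bL n) x) = ac (bL n) (ac (bL m) x) + of_int (n - m) *s ac (bL (m + n)) x"
  using ac_commute[of "bL m" "bL n" x] by (simp add: ksign_def lin_add)

lemma L_W: "ac (bL m) (ac (bW n) x) = ac (bW n) (ac (bL m) x) + Z (m + n) x"
  using ac_commute[of "bL m" "bW n" x] by (simp add: ksign_def lin_add Z_def)

lemma W_L: "ac (bW n) (ac (bL m) x) = ac (bL m) (ac (bW n) x) - Z (m + n) x"
  by (simp add: L_W)

lemma L_G: "ac (bL m) (ac (bG k) x) = ac (bG k) (ac (bL m) x) + (of_int k + 1 / 2) *s ac (bG (m + k)) x"
  using ac_commute[of "bL m" "bG k" x] by (simp add: ksign_def)

lemma G_G: "ac (bG j) (ac (bG k) x) = Z (j + k + 1) x - ac (bG k) (ac (bG j) x)"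
  using ac_commute[of "bG j" "bG k" x] by (simp add: ksign_def lin_add Z_def scale_left_distrib)

lemma W_W: "ac (bW j) (ac (bW k) x) = ac (bW k) (ac (bW j) x)"
  using ac_commute[of "bW j" "bW k" x] by (simp add: ksign_def)

lemma G_W: "ac (bG j) (ac (bW k) x) = ac (bW k) (ac (bG j) x)"
  using ac_commute[of "bG j" "bW k" x] by (simp add: ksign_def)

lemma C1_comm: "ac bC1 (ac b x) = ac b (ac bC1 x)"
  using ac_commute[of bC1 b x] by (cases b) (simp_all add: ksign_def)

lemma C2_comm: "ac bC2 (ac b x) = ac b (ac bC2 x)"
  using ac_commute[of bC2 b x] by (cases b) (simp_all add: ksign_def)

lemma Z_W: "Z k (ac (bW n) x) = ac (bW n) (Z k x)"
  by (simp add: Z_def ac_add ac_scale C2_comm[of "bW n"] W_W[of k n])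

lemma Z_G: "Z k (ac (bG n) x) = ac (bG n) (Z k x)"
  by (simp add: Z_def ac_add ac_scale C2_comm[of "bG n"] G_W)

lemma Z_Z: "Z j (Z k x) = Z k (Z j x)"
proof -
  have "Z j (ac bC2 x) = ac bC2 (Z j x)"
    by (simp add: Z_def ac_add ac_scale C2_comm[of "bW j"])
  then show ?thesis
    by (simp add: Z_def[of k] Z_add Z_scale Z_W)
qed

lemma L_Z: "ac (bL m) (Z k x) = Z k (ac (bL m) x) + of_int k *s Z (m + k) x"
  by (simp add: Z_def[of k] ac_add ac_scale L_W C2_comm[of "bL m"] scale_right_distrib)

section \<open>Stable subspaces and generated submodules\<close>

definition stable :: "or_basis set \<Rightarrow> 'm set \<Rightarrow> bool" where
  "stable B N \<longleftrightarrow> subspace N \<and> (\<forall>b\<in>B. \<forall>x\<in>N. ac b x \<in> N)"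

lemma stableD: "stable B N \<Longrightarrow> b \<in> B \<Longrightarrow> x \<in> N \<Longrightarrow> ac b x \<in> N"
  and stable_subspace: "stable B N \<Longrightarrow> subspace N"
  by (auto simp: stable_def)

lemma Z_mem: "stable B N \<Longrightarrow> bW k \<in> B \<Longrightarrow> bC2 \<in> B \<Longrightarrow> x \<in> N \<Longrightarrow> Z k x \<in> N"
  by (auto simp: Z_def stable_def intro!: subspace_add subspace_scale subspace_0)

lemma ac_span:
  assumes "x \<in> span S" "subspace Y" "\<And>y. y \<in> S \<Longrightarrow> ac b y \<in> Y"
  shows "ac b x \<in> Y"
proof -
  have "x \<in> {x. ac b x \<in> Y}"
    by (rule span_induct[OF assms(1)])
      (use assms(2,3) in \<open>auto simp: subspace_def ac_add ac_scale\<close>)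
  then show ?thesis by simp
qed

lemma ac_span_0:
  assumes "x \<in> span S" "\<And>y. y \<in> S \<Longrightarrow> ac b y = 0"
  shows "ac b x = 0"
  using ac_span[OF assms(1) subspace_single_0, of b] assms(2) by auto

lemma subspace_chain:
  fixes N :: "nat \<Rightarrow> 'm set"
  assumes "\<And>e. subspace (N e)" "\<And>e. N e \<subseteq> N (Suc e)"
  shows "subspace (\<Union>e. N e)"
proof -
  have mono: "N e \<subseteq> N (e + e')" for e e'
    by (induction e') (use assms(2) in auto)
  show ?thesis
  proof (rule subspaceI)
    fix x y assume "x \<in> (\<Union>e. N e)" "y \<in> (\<Union>e. N e)"
    then obtain e e' where "x \<in> N e" "y \<in> N e'" by auto
    then have "x \<in> N (e + e')" "y \<in> N (e + e')"
      using mono[of e e'] mono[of e' e] by (auto simp: add.commute)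
    then show "x + y \<in> (\<Union>e. N e)"
      using assms(1) subspace_add by blast
  next
    show "0 \<in> (\<Union>e. N e)" using assms(1) subspace_0 by blast
    show "c *s x \<in> (\<Union>e. N e)" if "x \<in> (\<Union>e. N e)" for c x
      using assms(1) subspace_scale that by blast
  qed
qed

definition gen :: "'m set \<Rightarrow> 'm set" where
  "gen V = \<Inter>{N. stable UNIV N \<and> V \<subseteq> N}"

lemma gen_stable: "stable UNIV (gen V)" and gen_base: "V \<subseteq> gen V"
  by (auto simp: gen_def stable_def subspace_def)

lemma gen_least: "stable UNIV N \<Longrightarrow> V \<subseteq> N \<Longrightarrow> gen V \<subseteq> N"
  by (auto simp: gen_def)

section \<open>Polynomials in one operator\<close>

definition polys :: "or_basis \<Rightarrow> 'm set \<Rightarrow> 'm set" where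
  "polys b N = span {(ac b ^^ n) u | n u. u \<in> N}"

lemma funpow_ac_add: "(ac b ^^ n) (x + y) = (ac b ^^ n) x + (ac b ^^ n) y"
  by (induction n) (simp_all add: ac_add)

lemma funpow_ac_scale: "(ac b ^^ n) (c *s x) = c *s (ac b ^^ n) x"
  by (induction n) (simp_all add: ac_scale)

lemma funpow_ac_0 [simp]: "(ac b ^^ n) 0 = 0"
  by (induction n) simp_all

lemma polysE:
  assumes "x \<in> polys b N" "subspace N"
  obtains m u where "\<And>n. u n \<in> N" "x = (\<Sum>n\<le>m. (ac b ^^ n) (u n))"
proof -
  \<comment> \<open>The coefficients are kept zero beyond \<open>m\<close>: expansions of different
    lengths can then be added under one summation bound.\<close>
  have "\<exists>m u. (\<forall>n. u n \<in> N) \<and> (\<forall>n>m. u n = 0) \<and> x = (\<Sum>n\<le>m. (ac b ^^ n) (u n))"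
    using assms(1) unfolding polys_def
  proof (induction rule: span_induct_alt)
    case base
    show ?case
      by (rule exI[of _ 0], rule exI[of _ "\<lambda>_. 0"]) (simp add: assms(2) subspace_0)
  next
    case (step c y z)
    then obtain k v where y: "y = (ac b ^^ k) v" "v \<in> N" by auto
    from step obtain m u where u: "\<And>n. u n \<in> N" "\<And>n. n > m \<Longrightarrow> u n = 0"
      and z: "z = (\<Sum>n\<le>m. (ac b ^^ n) (u n))" by blast
    have z': "z = (\<Sum>n\<le>m + k. (ac b ^^ n) (u n))"
      unfolding z by (rule sum.mono_neutral_left) (auto simp: u(2))
    let ?w = "\<lambda>n. if n = k then c *s v + u n else u n"
    have "(\<Sum>n\<le>m + k. (ac b ^^ n) (?w n)) =
        (\<Sum>n\<le>m + k. (if n = k then c *s (ac b ^^ k) v else 0) + (ac b ^^ n) (u n))"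
      by (rule sum.cong) (simp_all add: funpow_ac_add funpow_ac_scale)
    also have "\<dots> = c *s y + z"
      by (simp add: sum.distrib z' y)
    finally show ?case
      using u y(2) assms(2)
      by (intro exI[of _ "m + k"] exI[of _ ?w]) (auto intro: subspace_add subspace_scale)
  qed
  then show thesis using that by blast
qed

lemma polys_base: "N \<subseteq> polys b N"
proof
  fix x assume "x \<in> N"
  then have "x \<in> {(ac b ^^ n) u | n u. u \<in> N}"
    by (intro CollectI exI[of _ 0] exI[of _ x]) auto
  then show "x \<in> polys b N" unfolding polys_def by (rule span_base)
qed

lemma polys_power: "u \<in> N \<Longrightarrow> (ac b ^^ n) u \<in> polys b N"
  unfolding polys_def by (rule span_base) blast

lemma polys_subspace: "subspace (polys b N)"
  by (simp add: polys_def subspace_span)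

lemma polys_closed:
  assumes "x \<in> polys b N"
  shows "ac b x \<in> polys b N"
proof (rule ac_span[OF assms[unfolded polys_def] polys_subspace])
  fix y assume "y \<in> {(ac b ^^ n) u | n u. u \<in> N}"
  then obtain n u where "y = (ac b ^^ n) u" "u \<in> N" by auto
  with polys_power[of u N "Suc n" b] show "ac b y \<in> polys b N" by simp
qed

end

text \<open>\<open>V\<close> is any stable space of singular vectors; that it contains all of them,
  modulo \<open>K\<close> and inside \<open>gen V\<close>, is the conclusion
  \<open>singular_in_V\<close>. The bound in \<open>G_V\<close> includes \<open>t\<close> because
  \<open>bG t\<close> is G_{t+1/2}.\<close>

locale or_rep_T = or_rep +
  fixes t d :: nat and V K :: "'a set"
  assumes V_stable: "stable (T_basis d) V"
    and W_V: "i > int t \<Longrightarrow> x \<in> V \<Longrightarrow> ac (bW i) x = 0"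
    and L_V: "i > int t + int d \<Longrightarrow> x \<in> V \<Longrightarrow> ac (bL i) x = 0"
    and G_V: "i \<ge> int t \<Longrightarrow> x \<in> V \<Longrightarrow> ac (bG i) x = 0"
    and Z_V: "x \<in> V \<Longrightarrow> Z (int t) x = 0 \<Longrightarrow> x = 0"
    and K_stable: "stable UNIV K"
    and K_V: "K \<inter> V \<subseteq> {0}"
begin

abbreviation z where "z \<equiv> Z (int t)"

text \<open>
  Raising operators recover the coefficients of a vector only up to a power of \<open>Z\<^sub>t\<close>, hence the
  saturation of \<open>K\<close>.
\<close>

definition Ksat where "Ksat = {x. \<exists>n. (z ^^ n) x \<in> K}"

lemma zpow_add: "(z ^^ n) (x + y) = (z ^^ n) x + (z ^^ n) y"
  by (induction n) (simp_all add: Z_add)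

lemma zpow_scale: "(z ^^ n) (c *s x) = c *s (z ^^ n) x"
  by (induction n) (simp_all add: Z_scale)

lemma zpow_0 [simp]: "(z ^^ n) 0 = 0"
  by (induction n) simp_all

lemma zpow_K: "x \<in> K \<Longrightarrow> (z ^^ n) x \<in> K"
  by (induction n) (auto intro: Z_mem[OF K_stable])

lemma K_Ksat: "x \<in> K \<Longrightarrow> x \<in> Ksat"
  unfolding Ksat_def by (intro CollectI exI[of _ 0]) simp

lemma Ksat_subspace: "subspace Ksat"
proof (rule subspaceI)
  show "0 \<in> Ksat" using K_Ksat K_stable subspace_0 stable_subspace by blast
  fix x y assume "x \<in> Ksat" "y \<in> Ksat"
  then obtain m n where "(z ^^ m) x \<in> K" "(z ^^ n) y \<in> K" by (auto simp: Ksat_def)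
  then have "(z ^^ n) ((z ^^ m) x) \<in> K" "(z ^^ m) ((z ^^ n) y) \<in> K" by (simp_all add: zpow_K)
  then have "(z ^^ (n + m)) x \<in> K" "(z ^^ (m + n)) y \<in> K"
    by (simp_all only: funpow_add comp_apply)
  then have "(z ^^ (m + n)) x \<in> K" "(z ^^ (m + n)) y \<in> K"
    by (simp_all only: add.commute[of n m])
  then show "x + y \<in> Ksat"
    unfolding Ksat_def using subspace_add[OF stable_subspace[OF K_stable]]
    by (auto simp: zpow_add intro!: exI[of _ "m + n"])
next
  fix c x assume "x \<in> Ksat"
  then show "c *s x \<in> Ksat"
    unfolding Ksat_def using subspace_scale[OF stable_subspace[OF K_stable]] by (auto simp: zpow_scale)
qed

lemma Ksat_z: "z x \<in> Ksat \<Longrightarrow> x \<in> Ksat"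
  unfolding Ksat_def using funpow_swap1[of z] by (auto intro: exI[of _ "Suc _"])

lemma Ksat_zpow: "(z ^^ n) x \<in> Ksat \<Longrightarrow> x \<in> Ksat"
  by (induction n) (auto intro: Ksat_z)

lemma Ksat_W: "x \<in> Ksat \<Longrightarrow> ac (bW k) x \<in> Ksat"
proof -
  have "(z ^^ n) (ac (bW k) x) = ac (bW k) ((z ^^ n) x)" for n x
    by (induction n) (simp_all add: Z_W)
  then show "x \<in> Ksat \<Longrightarrow> ac (bW k) x \<in> Ksat"
    unfolding Ksat_def using stableD[OF K_stable] by fastforce
qed

lemma Ksat_G: "x \<in> Ksat \<Longrightarrow> ac (bG k) x \<in> Ksat"
proof -
  have "(z ^^ n) (ac (bG k) x) = ac (bG k) ((z ^^ n) x)" for n x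
    by (induction n) (simp_all add: Z_G)
  then show "x \<in> Ksat \<Longrightarrow> ac (bG k) x \<in> Ksat"
    unfolding Ksat_def using stableD[OF K_stable] by fastforce
qed

text \<open>Commuting \<open>z\<close> past L_k produces t Z_{k+t}. Since the Z commute with one
  another, the second hypothesis kills this error at every power of \<open>z\<close>.\<close>

lemma Ksat_L:
  assumes "x \<in> Ksat" "Z (k + int t) x = 0"
  shows "ac (bL k) x \<in> Ksat"
proof -
  have "(z ^^ n) (ac (bL k) x) = ac (bL k) ((z ^^ n) x) \<and> Z (k + int t) ((z ^^ n) x) = 0" for n
    by (induction n) (simp_all add: assms(2) L_Z Z_Z[of "k + int t" "int t"])
  then show ?thesis
    using assms(1) unfolding Ksat_def using stableD[OF K_stable] by auto
qed

lemma Ksat_scale: "c \<noteq> 0 \<Longrightarrow> c *s x \<in> Ksat \<Longrightarrow> x \<in> Ksat"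
  using subspace_scale[OF Ksat_subspace, of "c *s x" "1 / c"] by simp

text \<open>A power of \<open>z\<close> moves \<open>x\<close> into \<open>K\<close> without leaving
  \<open>V\<close>, so the result is 0; injectivity of Z_t on \<open>V\<close> cancels the
  power.\<close>

lemma Ksat_V: "x \<in> Ksat \<Longrightarrow> x \<in> V \<Longrightarrow> x = 0"
proof -
  assume "x \<in> Ksat" "x \<in> V"
  then obtain n where n: "(z ^^ n) x \<in> K" by (auto simp: Ksat_def)
  have V: "(z ^^ m) x \<in> V" for m
    by (induction m) (auto simp: \<open>x \<in> V\<close> intro!: Z_mem[OF V_stable])
  have "(z ^^ n) x = 0" using K_V n V by auto
  then show "x = 0"
    by (induction n) (use V Z_V in auto)
qed

subsection \<open>Adjoining the negative \<open>W\<close>\<close>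

definition good_W :: "nat \<Rightarrow> 'a set \<Rightarrow> bool" where
  "good_W D N \<longleftrightarrow> stable (T_basis D) N \<and> (\<forall>i>int t. \<forall>x\<in>N. ac (bW i) x = 0) \<and>
     (\<forall>i>int t + int D. \<forall>x\<in>N. ac (bL i) x = 0) \<and> (\<forall>i\<ge>int t. \<forall>x\<in>N. ac (bG i) x = 0) \<and>
     Ksat \<inter> N \<subseteq> {0}"

lemma Z_vanish: "\<forall>i>int t. ac (bW i) x = 0 \<Longrightarrow> k > int t \<Longrightarrow> Z k x = 0"
  by (simp add: Z_def)

text \<open>With a = L_{t+D+1} one has [a, b] = Z_t, which commutes with b, and a kills
  \<open>N\<close>. So a acts on polynomials in b over \<open>N\<close> as Z_t times the derivative
  in b, and in characteristic 0 a polynomial with derivative 0 is constant.\<close>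

lemma W_step:
  assumes N: "good_W D N"
  defines "b \<equiv> bW (- int D - 1)"
  shows "good_W (Suc D) (polys b N)"
    and "x \<in> polys b N \<Longrightarrow> ac (bL (int t + int D + 1)) x \<in> Ksat \<Longrightarrow> x \<in> N"
proof -
  let ?a = "bL (int t + int D + 1)"
  have N_stable: "stable (T_basis D) N" and N_sub: "subspace N"
    and WN: "\<And>i x. i > int t \<Longrightarrow> x \<in> N \<Longrightarrow> ac (bW i) x = 0"
    and LN: "\<And>i x. i > int t + int D \<Longrightarrow> x \<in> N \<Longrightarrow> ac (bL i) x = 0"
    and GN: "\<And>i x. i \<ge> int t \<Longrightarrow> x \<in> N \<Longrightarrow> ac (bG i) x = 0"
    and KN: "\<And>x. x \<in> Ksat \<Longrightarrow> x \<in> N \<Longrightarrow> x = 0"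
    using N by (auto simp: good_W_def stable_def)
  have W_pow: "ac (bW i) ((ac b ^^ n) u) = (ac b ^^ n) (ac (bW i) u)" for i n u
    by (induction n) (simp_all add: b_def W_W[of i "- int D - 1"])
  have G_pow: "ac (bG i) ((ac b ^^ n) u) = (ac b ^^ n) (ac (bG i) u)" for i n u
    by (induction n) (simp_all add: b_def G_W)
  have W_kill: "ac (bW i) x = 0" if "i > int t" "x \<in> polys b N" for i x
    using that(2) unfolding polys_def by (rule ac_span_0) (use that(1) in \<open>auto simp: W_pow WN\<close>)
  have G_kill: "ac (bG i) x = 0" if "i \<ge> int t" "x \<in> polys b N" for i x
    using that(2) unfolding polys_def by (rule ac_span_0) (use that(1) in \<open>auto simp: G_pow GN\<close>)
  have L_kill: "ac (bL i) x = 0" if "i > int t + int D + 1" "x \<in> polys b N" for i x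
    using that(2) unfolding polys_def
  proof (rule ac_span_0)
    fix y assume "y \<in> {(ac b ^^ n) u | n u. u \<in> N}"
    then obtain n u where y: "y = (ac b ^^ n) u" "u \<in> N" by auto
    show "ac (bL i) y = 0"
      unfolding y
    proof (induction n)
      case 0
      show ?case using LN y that by simp
    next
      case (Suc n)
      \<comment> \<open>The index exceeds \<open>t\<close>, so the commutator is a multiple of one
        of the W that kill \<open>polys b N\<close>.\<close>
      have "Z (i + (- int D - 1)) ((ac b ^^ n) u) = 0"
        using that y by (intro Z_vanish) (auto intro: W_kill polys_power)
      then show ?case
        using Suc by (simp add: b_def L_W)
    qed
  qed
  have W_closed: "ac (bW i) x \<in> polys b N" if "x \<in> polys b N" "i \<ge> - int D - 1" for i x
  proof (cases "i = - int D - 1")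
    case True
    then show ?thesis using polys_closed[OF that(1)] by (simp add: b_def)
  next
    case False
    with that(2) have "ac (bW i) u \<in> N" if "u \<in> N" for u
      using stableD[OF N_stable _ that, of "bW i"] by simp
    with that(1) show ?thesis
      using polys_subspace[of b N] polys_power[where N = N and b = b] by (subst (asm) polys_def) (auto intro: ac_span simp: W_pow)
  qed
  have simple_closed: "ac c x \<in> polys b N"
    if "x \<in> polys b N" "\<And>u. u \<in> N \<Longrightarrow> ac c u \<in> N" "\<And>n u. ac c ((ac b ^^ n) u) = (ac b ^^ n) (ac c u)" for c x
    using that(1,2) polys_subspace[of b N] polys_power[where N = N and b = b]
    by (subst (asm) polys_def) (auto intro: ac_span simp: that(3))
  have C_pow: "ac bC1 ((ac b ^^ n) u) = (ac b ^^ n) (ac bC1 u)" "ac bC2 ((ac b ^^ n) u) = (ac b ^^ n) (ac bC2 u)" for n u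
    by (induction n) (simp_all add: C1_comm C2_comm)
  have C_closed: "ac bC1 x \<in> polys b N" "ac bC2 x \<in> polys b N" if "x \<in> polys b N" for x
    using that stableD[OF N_stable] by (auto intro!: simple_closed simp: C_pow)
  have G_closed: "ac (bG i) x \<in> polys b N" if "x \<in> polys b N" "i \<ge> 0" for i x
    using that stableD[OF N_stable] by (auto intro!: simple_closed simp: G_pow)
  have Z_closed: "Z i x \<in> polys b N" if "x \<in> polys b N" "i \<ge> - int D - 1" for i x
    using that polys_subspace[of b N] C_closed W_closed
    by (auto simp: Z_def intro!: subspace_add subspace_scale subspace_0)
  have L_closed: "ac (bL i) x \<in> polys b N" if "x \<in> polys b N" "i \<ge> 0" for i x
    using that(1) unfolding polys_def
  proof (rule ac_span[OF _ subspace_span])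
    fix y assume "y \<in> {(ac b ^^ n) u | n u. u \<in> N}"
    then obtain n u where y: "y = (ac b ^^ n) u" "u \<in> N" by auto
    show "ac (bL i) y \<in> span {(ac b ^^ n) u | n u. u \<in> N}"
      unfolding y polys_def[symmetric]
    proof (induction n)
      case 0
      have "ac (bL i) u \<in> N" using stableD[OF N_stable] y that by simp
      then show ?case using polys_base[of N b] by auto
    next
      case (Suc n)
      have "Z (i + (- int D - 1)) ((ac b ^^ n) u) \<in> polys b N"
        using that y by (intro Z_closed polys_power) auto
      then show ?case
        using Suc polys_closed[OF Suc] polys_subspace[of b N] by (auto simp: b_def L_W intro: subspace_add)
    qed
  qed
  have stab: "stable (T_basis (Suc D)) (polys b N)"
    unfolding stable_def
  proof (intro conjI ballI polys_subspace)
    fix c x assume "c \<in> T_basis (Suc D)" "x \<in> polys b N"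
    then show "ac c x \<in> polys b N"
      by (cases c) (auto intro: L_closed W_closed G_closed C_closed)
  qed
  have a_pow: "ac ?a ((ac b ^^ Suc n) u) = of_nat (Suc n) *s z ((ac b ^^ n) u)" if "u \<in> N" for n u
  proof (induction n)
    case 0
    show ?case using LN[OF _ that, of "int t + int D + 1"] by (simp add: b_def L_W)
  next
    case (Suc n)
    have "ac ?a ((ac b ^^ Suc (Suc n)) u) = ac b (ac ?a ((ac b ^^ Suc n) u)) + z ((ac b ^^ Suc n) u)"
      by (simp add: b_def L_W)
    also have "\<dots> = of_nat (Suc n) *s z ((ac b ^^ Suc n) u) + z ((ac b ^^ Suc n) u)"
      unfolding Suc by (simp add: ac_scale b_def Z_W)
    also have "\<dots> = (of_nat (Suc n) + 1) *s z ((ac b ^^ Suc n) u)"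
      by (simp only: scale_left_distrib scale_one)
    finally show ?case by (simp only: of_nat_Suc ac_simps)
  qed
  have ac_sum: "ac c (sum f A) = (\<Sum>i\<in>A. ac c (f i))" for c f and A :: "nat set"
    by (induction A rule: infinite_finite_induct) (simp_all add: ac_add)
  have z_sum: "z (sum f A) = (\<Sum>i\<in>A. z (f i))" for f and A :: "nat set"
    by (induction A rule: infinite_finite_induct) (simp_all add: Z_add)
  \<comment> \<open>The derivative by coefficients: (n+1) u_{n+1} takes the place of u_n, and one
    factor \<open>z\<close> comes out.\<close>
  have lower: "ac ?a (\<Sum>n\<le>Suc m. (ac b ^^ n) (u n)) = z (\<Sum>n\<le>m. (ac b ^^ n) (of_nat (Suc n) *s u (Suc n)))"
    if u: "\<And>n. u n \<in> N" for u m
  proof -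
    have "ac ?a (\<Sum>n\<le>Suc m. (ac b ^^ n) (u n)) =
        ac ?a (u 0) + (\<Sum>n\<le>m. ac ?a ((ac b ^^ Suc n) (u (Suc n))))"
      by (subst sum.atMost_Suc_shift) (simp add: ac_add ac_sum)
    also have "ac ?a (u 0) = 0" using LN u by simp
    also have "(\<Sum>n\<le>m. ac ?a ((ac b ^^ Suc n) (u (Suc n)))) =
        (\<Sum>n\<le>m. of_nat (Suc n) *s z ((ac b ^^ n) (u (Suc n))))"
      by (simp add: a_pow[OF u] del: funpow.simps)
    finally show ?thesis
      by (simp add: z_sum funpow_ac_scale Z_scale del: of_nat_Suc)
  qed
  have mem: "(\<Sum>n\<le>m. (ac b ^^ n) (u n)) \<in> polys b N" if "\<And>n. u n \<in> N" for u m
    by (intro subspace_sum[OF polys_subspace] polys_power that)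
  have a_Ksat: "ac ?a x \<in> Ksat" if "x \<in> Ksat" "x \<in> polys b N" for x
    using that by (intro Ksat_L Z_vanish) (auto intro: W_kill)
  \<comment> \<open>Induction on the degree: \<open>?a\<close> maps the sum to \<open>z\<close>
    times its derivative, saturation strips \<open>z\<close>, and the derivative has lower
    degree.\<close>
  have coeffs: "\<forall>n\<le>m. u n = 0" if "(\<Sum>n\<le>m. (ac b ^^ n) (u n)) \<in> Ksat" "\<And>n. u n \<in> N" for m u
    using that
  proof (induction m arbitrary: u)
    case 0
    then show ?case using KN by simp
  next
    case (Suc m)
    have "z (\<Sum>n\<le>m. (ac b ^^ n) (of_nat (Suc n) *s u (Suc n))) \<in> Ksat"
      using a_Ksat[OF Suc.prems(1) mem[OF Suc.prems(2)]] by (simp only: lower[OF Suc.prems(2)])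
    then have "\<forall>n\<le>m. of_nat (Suc n) *s u (Suc n) = 0"
      by (intro Suc.IH) (auto intro: Ksat_z subspace_scale[OF N_sub] Suc.prems simp del: of_nat_Suc)
    then have u: "u (Suc n) = 0" if "n \<le> m" for n
      using that by (simp del: of_nat_Suc)
    then have "(\<Sum>n\<le>Suc m. (ac b ^^ n) (u n)) = u 0"
      by (subst sum.atMost_Suc_shift) simp
    then have "u 0 = 0" using KN Suc.prems by simp
    with u show ?case by (metis Suc_le_mono not0_implies_Suc)
  qed
  have "Ksat \<inter> polys b N \<subseteq> {0}"
  proof clarify
    fix x assume x: "x \<in> Ksat" "x \<in> polys b N"
    obtain m u where "\<And>n. u n \<in> N" "x = (\<Sum>n\<le>m. (ac b ^^ n) (u n))"
      using polysE[OF x(2) N_sub] by blast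
    with coeffs[of u m] x(1) show "x = 0" by simp
  qed
  with stab show "good_W (Suc D) (polys b N)"
    by (auto simp: good_W_def W_kill G_kill L_kill)
  \<comment> \<open>Here only \<open>z\<close> times the derivative is known to lie in
    \<open>Ksat\<close>, so all coefficients but the constant one vanish.\<close>
  assume x: "x \<in> polys b N" "ac ?a x \<in> Ksat"
  obtain m u where u: "\<And>n. u n \<in> N" and xu: "x = (\<Sum>n\<le>m. (ac b ^^ n) (u n))"
    using polysE[OF x(1) N_sub] by blast
  show "x \<in> N"
  proof (cases m)
    case 0
    with u xu show ?thesis by simp
  next
    case (Suc m')
    have "z (\<Sum>n\<le>m'. (ac b ^^ n) (of_nat (Suc n) *s u (Suc n))) \<in> Ksat"
      using x(2) unfolding xu Suc by (simp only: lower[OF u])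
    then have "\<forall>n\<le>m'. of_nat (Suc n) *s u (Suc n) = 0"
      by (intro coeffs) (auto intro: Ksat_z subspace_scale[OF N_sub] u simp del: of_nat_Suc)
    then have "u (Suc n) = 0" if "n \<le> m'" for n
      using that by (simp del: of_nat_Suc)
    then have "x = u 0"
      unfolding xu Suc by (subst sum.atMost_Suc_shift) simp
    with u show ?thesis by simp
  qed
qed

lemma good_W_V: "good_W d V"
  unfolding good_W_def using V_stable W_V L_V G_V Ksat_V by auto

fun W_ext :: "nat \<Rightarrow> 'a set" where
  "W_ext 0 = V"
| "W_ext (Suc e) = polys (bW (- int (d + e) - 1)) (W_ext e)"

lemma good_W_ext: "good_W (d + e) (W_ext e)"
proof (induction e)
  case (Suc e)
  then show ?case using W_step(1)[of "d + e"] by simp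
qed (simp add: good_W_V)

definition V1 where "V1 = (\<Union>e. W_ext e)"

subsection \<open>Adjoining the negative \<open>G\<close>\<close>

text \<open>All W_{-n} are present and [L_{n+t}, W_{-n}] = Z_t, so no L_i is asked to vanish any
  more. \<open>bG i\<close> with i \<ge> -D is G_r with r \<ge> -D + 1/2.\<close>

definition good_G :: "nat \<Rightarrow> 'a set \<Rightarrow> bool" where
  "good_G D N \<longleftrightarrow> subspace N \<and> (\<forall>x\<in>N. (\<forall>i\<ge>0. ac (bL i) x \<in> N) \<and> (\<forall>i. ac (bW i) x \<in> N) \<and>
      (\<forall>i\<ge>- int D. ac (bG i) x \<in> N) \<and> ac bC1 x \<in> N \<and> ac bC2 x \<in> N) \<and>
     (\<forall>i>int t. \<forall>x\<in>N. ac (bW i) x = 0) \<and> (\<forall>i\<ge>int t + int D. \<forall>x\<in>N. ac (bG i) x = 0) \<and>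
     Ksat \<inter> N \<subseteq> {0}"

lemma W_ext_mono: "e \<le> e' \<Longrightarrow> W_ext e \<subseteq> W_ext e'"
  by (rule lift_Suc_mono_le[of W_ext]) (auto intro: polys_base[THEN subsetD])

lemma good_G_V1: "good_G 0 V1"
proof -
  have st: "stable (T_basis (d + e)) (W_ext e)" for e
    using good_W_ext[of e] by (simp add: good_W_def)
  have "subspace V1"
    unfolding V1_def
    by (rule subspace_chain) (use st stable_subspace W_ext_mono[of _ "Suc _"] in auto)
  moreover have "ac b x \<in> V1" if "x \<in> V1" "b \<in> range bW \<union> bL ` {0..} \<union> bG ` {0..} \<union> {bC1, bC2}" for b x
  proof -
    from that(1) obtain e where e: "x \<in> W_ext e" by (auto simp: V1_def)
    obtain e' where e': "b \<in> T_basis (d + e')"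
    proof (cases "b \<in> range bW")
      case True
      then obtain i where "b = bW i" by auto
      then show ?thesis by (intro that[of "nat (- i)"]) auto
    next
      case False
      with \<open>b \<in> _\<close> show ?thesis by (intro that[of 0]) auto
    qed
    have "b \<in> T_basis (d + (e + e'))" using e' by (cases b) auto
    moreover have "x \<in> W_ext (e + e')" using e W_ext_mono[of e "e + e'"] by auto
    ultimately have "ac b x \<in> W_ext (e + e')" using stableD[OF st] by blast
    then show ?thesis by (auto simp: V1_def)
  qed
  moreover have "ac (bW i) x = 0" if "i > int t" "x \<in> V1" for i x
    using that good_W_ext by (auto simp: V1_def good_W_def)
  moreover have "ac (bG i) x = 0" if "i \<ge> int t" "x \<in> V1" for i x
    using that good_W_ext by (auto simp: V1_def good_W_def)
  moreover have "Ksat \<inter> V1 \<subseteq> {0}"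
    using good_W_ext by (auto simp: V1_def good_W_def)
  ultimately show ?thesis by (auto simp: good_G_def)
qed

lemma V1_V:
  assumes "x \<in> V1" "\<And>i. i > int t + int d \<Longrightarrow> ac (bL i) x \<in> Ksat"
  shows "x \<in> V"
proof -
  from assms(1) obtain e where "x \<in> W_ext e" by (auto simp: V1_def)
  then show ?thesis
  proof (induction e)
    case (Suc e)
    have "x \<in> W_ext e"
      by (rule W_step(2)[OF good_W_ext]) (use Suc.prems assms(2) in simp_all)
    then show ?case by (rule Suc.IH)
  qed simp
qed

text \<open>In use b is an odd basis vector, and degree at most 1 suffices: 2 b^2 = [b, b] = Z_k for
  some k, which preserves \<open>N\<close>.\<close>

definition adjoin where "adjoin b N = {u + ac b v | u v. u \<in> N \<and> v \<in> N}"

lemma adjoin_base: "subspace N \<Longrightarrow> N \<subseteq> adjoin b N"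
  unfolding adjoin_def by (force simp: subspace_def intro: exI[of _ 0])

text \<open>For a = G_{t+D+1/2} and b = G_{-D-1/2} one has a b + b a = Z_t, and a kills
  \<open>N\<close>. So a (u + b v) = Z_t v isolates the second coefficient up to \<open>z\<close>,
  which saturation removes.\<close>

lemma G_step:
  assumes N: "good_G D N"
  defines "b \<equiv> bG (- int D - 1)"
  shows "good_G (Suc D) (adjoin b N)"
    and "x \<in> adjoin b N \<Longrightarrow> ac (bG (int t + int D)) x \<in> Ksat \<Longrightarrow> x \<in> N"
proof -
  let ?a = "bG (int t + int D)"
  have N_sub: "subspace N"
    and cl: "\<And>x i. x \<in> N \<Longrightarrow> i \<ge> 0 \<Longrightarrow> ac (bL i) x \<in> N" "\<And>x i. x \<in> N \<Longrightarrow> ac (bW i) x \<in> N"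
      "\<And>x i. x \<in> N \<Longrightarrow> i \<ge> - int D \<Longrightarrow> ac (bG i) x \<in> N"
      "\<And>x. x \<in> N \<Longrightarrow> ac bC1 x \<in> N" "\<And>x. x \<in> N \<Longrightarrow> ac bC2 x \<in> N"
    and WN: "\<And>i x. i > int t \<Longrightarrow> x \<in> N \<Longrightarrow> ac (bW i) x = 0"
    and GN: "\<And>i x. i \<ge> int t + int D \<Longrightarrow> x \<in> N \<Longrightarrow> ac (bG i) x = 0"
    and KN: "\<And>x. x \<in> Ksat \<Longrightarrow> x \<in> N \<Longrightarrow> x = 0"
    using N by (auto simp: good_G_def)
  have Z_cl: "Z i x \<in> N" if "x \<in> N" for i x
    using that N_sub cl by (auto simp: Z_def intro!: subspace_add subspace_scale subspace_0)
  have mem: "u + ac b v \<in> adjoin b N" if "u \<in> N" "v \<in> N" for u v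
    using that by (auto simp: adjoin_def)
  note base = adjoin_base[OF N_sub, of b, THEN subsetD]
  have sub: "subspace (adjoin b N)"
  proof (rule subspaceI)
    show "0 \<in> adjoin b N" using base subspace_0[OF N_sub] .
    fix x y assume "x \<in> adjoin b N" "y \<in> adjoin b N"
    then obtain u v u' v' where "x = u + ac b v" "y = u' + ac b v'" "u \<in> N" "v \<in> N" "u' \<in> N" "v' \<in> N"
      by (auto simp: adjoin_def)
    with mem[of "u + u'" "v + v'"] subspace_add[OF N_sub] show "x + y \<in> adjoin b N"
      by (simp add: ac_add algebra_simps)
  next
    fix c x assume "x \<in> adjoin b N"
    then obtain u v where "x = u + ac b v" "u \<in> N" "v \<in> N"
      by (auto simp: adjoin_def)
    with mem[of "c *s u" "c *s v"] subspace_scale[OF N_sub] show "c *s x \<in> adjoin b N"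
      by (simp add: ac_scale scale_right_distrib)
  qed
  have bmem: "ac b v \<in> adjoin b N" if "v \<in> N" for v
    using mem[OF subspace_0[OF N_sub] that] by simp
  have closed: "ac c x \<in> adjoin b N"
    if "x \<in> adjoin b N" "\<And>u. u \<in> N \<Longrightarrow> ac c u \<in> adjoin b N" "\<And>u. u \<in> N \<Longrightarrow> ac c (ac b u) \<in> adjoin b N" for c x
    using that subspace_add[OF sub] by (auto simp: adjoin_def[of b N, THEN eqset_imp_iff] ac_add)
  have bb: "ac b (ac b u) \<in> N" if "u \<in> N" for u
  proof -
    let ?k = "(- int D - 1) + (- int D - 1) + 1"
    have "ac b (ac b u) = Z ?k u - ac b (ac b u)"
      unfolding b_def by (rule G_G)
    then have "ac b (ac b u) + ac b (ac b u) = Z ?k u"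
      by (simp only: eq_diff_eq)
    then have "(1/2) *s (ac b (ac b u) + ac b (ac b u)) \<in> N"
      using Z_cl[OF that] subspace_scale[OF N_sub] by simp
    moreover have "(1/2) *s (ac b (ac b u) + ac b (ac b u)) = (1/2 + 1/2) *s ac b (ac b u)"
      by (simp only: scale_left_distrib scale_right_distrib)
    ultimately show ?thesis by simp
  qed
  have L_cl: "ac (bL i) x \<in> adjoin b N" if "x \<in> adjoin b N" "i \<ge> 0" for i x
    using that(1)
  proof (rule closed)
    fix u assume u: "u \<in> N"
    show "ac (bL i) u \<in> adjoin b N" using base cl(1)[OF u that(2)] .
    \<comment> \<open>[L_i, b] is a multiple of a G with shifted index: b itself when i = 0, an
      element that already preserves \<open>N\<close> when i > 0.\<close>
    have "ac (bG (i - int D - 1)) u \<in> adjoin b N"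
    proof (cases "i = 0")
      case True
      then show ?thesis using bmem[OF u] by (simp add: b_def)
    next
      case False
      then show ?thesis using that(2) base cl(3)[OF u] by simp
    qed
    then have "ac (bG (i + (- int D - 1))) u \<in> adjoin b N"
      by (simp add: algebra_simps)
    moreover have "ac (bL i) (ac b u) =
        ac b (ac (bL i) u) + (of_int (- int D - 1) + 1 / 2) *s ac (bG (i + (- int D - 1))) u"
      unfolding b_def by (rule L_G)
    ultimately show "ac (bL i) (ac b u) \<in> adjoin b N"
      using bmem[OF cl(1)[OF u that(2)]] subspace_add[OF sub] subspace_scale[OF sub] by simp
  qed
  have W_cl: "ac (bW i) x \<in> adjoin b N" if "x \<in> adjoin b N" for i x
    using that(1)
    by (rule closed) (use base cl(2) bmem in \<open>auto simp: b_def G_W[symmetric]\<close>)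
  have C_cl: "ac bC1 x \<in> adjoin b N" "ac bC2 x \<in> adjoin b N" if "x \<in> adjoin b N" for x
    by (rule closed[OF that]; use base cl(4,5) bmem in \<open>simp add: C1_comm[of b] C2_comm[of b]\<close>)+
  have G_cl: "ac (bG i) x \<in> adjoin b N" if "x \<in> adjoin b N" "i \<ge> - int D - 1" for i x
    using that(1)
  proof (rule closed)
    fix u assume u: "u \<in> N"
    show "ac (bG i) u \<in> adjoin b N"
      using that(2) base[OF cl(3)[OF u, of i]] bmem[OF u] by (cases "i = - int D - 1") (auto simp: b_def)
    show "ac (bG i) (ac b u) \<in> adjoin b N"
    proof (cases "i = - int D - 1")
      case True
      then show ?thesis using base[OF bb[OF u]] by (simp add: b_def)
    next
      case False
      then have "ac b (ac (bG i) u) \<in> adjoin b N" using that(2) bmem cl(3)[OF u] by simp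
      moreover have "ac (bG i) (ac b u) = Z (i + (- int D - 1) + 1) u - ac b (ac (bG i) u)"
        unfolding b_def by (rule G_G)
      ultimately show ?thesis
        using base[OF Z_cl[OF u]] subspace_diff[OF sub] by simp
    qed
  qed
  have G_kill: "ac (bG i) x = 0" if "x \<in> adjoin b N" "i \<ge> int t + int D + 1" for i x
  proof -
    from that(1) obtain u v where x: "x = u + ac b v" and uv: "u \<in> N" "v \<in> N"
      by (auto simp: adjoin_def)
    have "Z (i + (- int D - 1) + 1) v = 0" using that(2) WN uv by (intro Z_vanish) auto
    then show ?thesis
      using uv that(2) GN unfolding x ac_add b_def by (simp add: G_G[of i])
  qed
  have W_kill: "ac (bW i) x = 0" if "x \<in> adjoin b N" "i > int t" for i x
    using that WN by (auto simp: adjoin_def ac_add b_def G_W[symmetric])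
  have lower: "ac ?a (u + ac b v) = z v" if "u \<in> N" "v \<in> N" for u v
    using that GN by (simp add: ac_add b_def G_G[of "int t + int D"])
  have "Ksat \<inter> adjoin b N \<subseteq> {0}"
  proof clarify
    fix x assume x: "x \<in> Ksat" "x \<in> adjoin b N"
    then obtain u v where uv: "x = u + ac b v" "u \<in> N" "v \<in> N"
      by (auto simp: adjoin_def)
    have "z v \<in> Ksat" using Ksat_G[OF x(1)] lower uv by metis
    then have "v = 0" using Ksat_z KN uv by blast
    then show "x = 0" using uv x KN by simp
  qed
  with sub show "good_G (Suc D) (adjoin b N)"
    unfolding good_G_def using L_cl W_cl G_cl C_cl G_kill W_kill by auto
  assume x: "x \<in> adjoin b N" "ac ?a x \<in> Ksat"
  then obtain u v where uv: "x = u + ac b v" "u \<in> N" "v \<in> N"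
    by (auto simp: adjoin_def)
  have "z v \<in> Ksat" using x lower uv by metis
  then have "v = 0" using Ksat_z KN uv by blast
  then show "x \<in> N" using uv by simp
qed

fun G_ext :: "nat \<Rightarrow> 'a set" where
  "G_ext 0 = V1"
| "G_ext (Suc D) = adjoin (bG (- int D - 1)) (G_ext D)"

lemma good_G_ext: "good_G D (G_ext D)"
  by (induction D) (use good_G_V1 G_step(1) in auto)

definition V2 where "V2 = (\<Union>D. G_ext D)"

lemma G_ext_mono: "e \<le> e' \<Longrightarrow> G_ext e \<subseteq> G_ext e'"
proof (rule lift_Suc_mono_le[of G_ext])
  show "G_ext n \<subseteq> G_ext (Suc n)" for n
    using adjoin_base good_G_ext[of n] by (simp add: good_G_def)
qed

lemma V2_subspace: "subspace V2"
  unfolding V2_def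
  by (rule subspace_chain) (use good_G_ext G_ext_mono[of _ "Suc _"] in \<open>auto simp: good_G_def\<close>)

lemma V2_closed: "x \<in> V2 \<Longrightarrow> i \<ge> 0 \<Longrightarrow> ac (bL i) x \<in> V2" "x \<in> V2 \<Longrightarrow> ac (bW i) x \<in> V2"
    "x \<in> V2 \<Longrightarrow> ac (bG i) x \<in> V2" "x \<in> V2 \<Longrightarrow> ac bC1 x \<in> V2" "x \<in> V2 \<Longrightarrow> ac bC2 x \<in> V2"
proof -
  assume "x \<in> V2"
  then obtain D where D: "x \<in> G_ext D" by (auto simp: V2_def)
  then show "ac (bW i) x \<in> V2" "ac bC1 x \<in> V2" "ac bC2 x \<in> V2" "i \<ge> 0 \<Longrightarrow> ac (bL i) x \<in> V2"
    using good_G_ext[of D] by (auto simp: V2_def good_G_def intro!: exI[of _ D])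
  have "x \<in> G_ext (D + nat (- i))" using D G_ext_mono[of D "D + nat (- i)"] by auto
  then have "ac (bG i) x \<in> G_ext (D + nat (- i))"
    using good_G_ext[of "D + nat (- i)"] by (auto simp: good_G_def)
  then show "ac (bG i) x \<in> V2" by (auto simp: V2_def)
qed

lemma V2_W: "x \<in> V2 \<Longrightarrow> i > int t \<Longrightarrow> ac (bW i) x = 0"
  and V2_Ksat: "x \<in> V2 \<Longrightarrow> x \<in> Ksat \<Longrightarrow> x = 0"
  using good_G_ext by (auto simp: V2_def good_G_def)

lemma V_V2: "V \<subseteq> V2"
  unfolding V2_def V1_def using G_ext.simps(1) W_ext.simps(1) V1_def by blast

lemma V2_V1:
  assumes "x \<in> V2" "\<And>i. i \<ge> int t \<Longrightarrow> ac (bG i) x \<in> Ksat"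
  shows "x \<in> V1"
proof -
  from assms(1) obtain e where "x \<in> G_ext e" by (auto simp: V2_def)
  then show ?thesis
  proof (induction e)
    case (Suc e)
    have "x \<in> G_ext e"
      by (rule G_step(2)[OF good_G_ext]) (use Suc.prems assms(2) in simp_all)
    then show ?case by (rule Suc.IH)
  qed simp
qed

subsection \<open>Adjoining the negative \<open>L\<close>\<close>

text \<open>The negative L do not commute, so they are adjoined all at once and filtered by length,
  as in a PBW filtration.\<close>

fun L_ext :: "nat \<Rightarrow> 'a set" where
  "L_ext 0 = V2"
| "L_ext (Suc n) = span (L_ext n \<union> {ac (bL (- i)) y | i y. i > 0 \<and> y \<in> L_ext n})"

lemma L_ext_subspace: "subspace (L_ext n)"
  by (cases n) (simp_all add: V2_subspace)

lemma L_ext_Suc: "x \<in> L_ext n \<Longrightarrow> x \<in> L_ext (Suc n)"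
  by (simp add: span_base)

lemma L_ext_L: "x \<in> L_ext n \<Longrightarrow> i < 0 \<Longrightarrow> ac (bL i) x \<in> L_ext (Suc n)"
  by (auto intro!: span_base exI[of _ "- i"])

text \<open>Moving c to the right past L_{-i} leaves [c, L_{-i}] applied to a shorter word. Even
  when this bracket is again a negative L, the length stays within the bound.\<close>

lemma L_ext_closed:
  assumes "x \<in> L_ext n" "c \<notin> bL ` {..<0}"
  shows "ac c x \<in> L_ext n"
  using assms
proof (induction n arbitrary: x c)
  case 0
  then show ?case using V2_closed[of x] by (cases c) (force simp: image_iff)+
next
  case (Suc n)
  let ?Y = "L_ext (Suc n)"
  have Z_cl: "Z k y \<in> L_ext n" if "y \<in> L_ext n" for k y
    using that by (auto simp: Z_def intro!: subspace_add subspace_scale subspace_0 L_ext_subspace Suc.IH)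
  note add = subspace_add[OF L_ext_subspace] and scale = subspace_scale[OF L_ext_subspace]
    and diff = subspace_diff[OF L_ext_subspace]
  have L: "ac c (ac (bL (- i)) y) \<in> ?Y" if i: "i > 0" and y: "y \<in> L_ext n" and c: "c \<notin> bL ` {..<0}" for c i y
  proof -
    have cy: "ac (bL (- i)) (ac c y) \<in> ?Y"
      using i Suc.IH[OF y c] by (intro L_ext_L) auto
    show ?thesis
    proof (cases c)
      case (bL j)
      show ?thesis
      proof (cases "j = i")
        case False
        have "ac (bL (j - i)) y \<in> ?Y"
        proof (cases "j < i")
          case True
          then show ?thesis using y by (intro L_ext_L) auto
        next
          case False
          then show ?thesis using y by (intro L_ext_Suc Suc.IH) auto
        qed
        then show ?thesis
          using False cy L_L[of j "- i" y] by (simp add: bL add scale del: L_ext.simps)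
      next
        case True
        \<comment> \<open>Opposite indices: the case excluded from \<open>L_L\<close>, where the
          Virasoro cocycle adds a multiple of C_1.\<close>
        have "ac (bL 0) y \<in> ?Y" "ac bC1 y \<in> ?Y"
          by (rule L_ext_Suc, rule Suc.IH[OF y], force)+
        moreover have "ac (bL j) (ac (bL (- i)) y) = ac (bL (- i)) (ac (bL j) y) +
            (of_int (- i - j) *s ac (bL 0) y + (of_int (j ^ 3 - j) / 12) *s ac bC1 y)"
          using ac_commute[of "bL j" "bL (- i)" y] True by (simp add: ksign_def lin_add)
        ultimately show ?thesis
          using cy unfolding bL by (simp add: add scale del: L_ext.simps)
      qed
    next
      case (bW j)
      show ?thesis
        using cy L_ext_Suc[OF Z_cl[OF y]] unfolding bW W_L by (rule diff)
    next
      case (bG j)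
      have "ac (bG (- i + j)) y \<in> ?Y" by (rule L_ext_Suc, rule Suc.IH[OF y]) auto
      moreover have "ac (bG j) (ac (bL (- i)) y) =
          ac (bL (- i)) (ac (bG j) y) - (of_int j + 1 / 2) *s ac (bG (- i + j)) y"
        by (simp add: L_G)
      ultimately show ?thesis
        using cy unfolding bG by (simp add: diff scale del: L_ext.simps)
    next
      case bC1
      then show ?thesis using cy by (simp add: C1_comm[of "bL (- i)"] del: L_ext.simps)
    next
      case bC2
      then show ?thesis using cy by (simp add: C2_comm[of "bL (- i)"] del: L_ext.simps)
    qed
  qed
  show ?case
  proof (rule ac_span[OF Suc.prems(1)[unfolded L_ext.simps] L_ext_subspace])
    fix y assume "y \<in> L_ext n \<union> {ac (bL (- i)) y | i y. i > 0 \<and> y \<in> L_ext n}"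
    then show "ac c y \<in> ?Y"
      using L L_ext_Suc[OF Suc.IH] Suc.prems(2) by blast
  qed
qed

lemma gen_L_ext: "gen V \<subseteq> (\<Union>n. L_ext n)"
proof (rule gen_least)
  show "V \<subseteq> (\<Union>n. L_ext n)" using V_V2 L_ext.simps(1) by blast
  show "stable UNIV (\<Union>n. L_ext n)"
    unfolding stable_def
  proof (intro conjI ballI)
    show "subspace (\<Union>n. L_ext n)"
      by (rule subspace_chain) (use L_ext_subspace L_ext_Suc in blast)+
    fix b x assume "x \<in> (\<Union>n. L_ext n)"
    then obtain n where n: "x \<in> L_ext n" by auto
    show "ac b x \<in> (\<Union>n. L_ext n)"
    proof (cases "b \<in> bL ` {..<0}")
      case True
      then show ?thesis using L_ext_L[OF n] by blast
    next
      case False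
      then show ?thesis using L_ext_closed[OF n] by blast
    qed
  qed
qed

section \<open>Words in the negative L paired with words in the positive W\<close>

definition L_word :: "int list \<Rightarrow> 'a \<Rightarrow> 'a" where
  "L_word = foldr (\<lambda>i. ac (bL (- i)))"

text \<open>Letters are shifted by \<open>t\<close>: k stands for W_{t+k}, whose bracket with L_{-k}
  is -Z_t.\<close>

definition W_word :: "int list \<Rightarrow> 'a \<Rightarrow> 'a" where
  "W_word = foldr (\<lambda>k. ac (bW (int t + k)))"

lemma word_simps [simp]:
  "L_word [] x = x" "L_word (i # is) x = ac (bL (- i)) (L_word is x)"
  "W_word [] x = x" "W_word (k # ks) x = ac (bW (int t + k)) (W_word ks x)"
  by (simp_all add: L_word_def W_word_def)

abbreviation pos :: "int list \<Rightarrow> bool" where "pos is \<equiv> \<forall>i\<in>set is. i > 0"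

lemma L_word_mem: "pos is \<Longrightarrow> u \<in> V2 \<Longrightarrow> L_word is u \<in> L_ext (length is)"
  by (induction "is") (simp_all add: L_ext_L del: L_ext.simps(2))

lemma L_word_add: "L_word is (x + y) = L_word is x + L_word is y"
  by (induction "is") (simp_all add: ac_add)

lemma L_word_scale: "L_word is (c *s x) = c *s L_word is x"
  by (induction "is") (simp_all add: ac_scale)

lemma L_word_0 [simp]: "L_word is 0 = 0"
  by (induction "is") simp_all

lemma W_word_add: "W_word ks (x + y) = W_word ks x + W_word ks y"
  by (induction ks) (simp_all add: ac_add)

lemma W_word_scale: "W_word ks (c *s x) = c *s W_word ks x"
  by (induction ks) (simp_all add: ac_scale)

lemma W_word_0 [simp]: "W_word ks 0 = 0"
  by (induction ks) simp_all

lemma W_word_sum: "W_word ks (sum f A) = (\<Sum>a\<in>A. W_word ks (f a))"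
  by (induction A rule: infinite_finite_induct) (simp_all add: W_word_add)

lemma W_word_mset:
  assumes "mset ks = mset ks'"
  shows "W_word ks = W_word ks'"
proof -
  have "fold (\<lambda>k. ac (bW (int t + k))) (rev ks) = fold (\<lambda>k. ac (bW (int t + k))) (rev ks')"
    by (rule fold_multiset_equiv) (use assms in \<open>auto simp: W_W\<close>)
  then show ?thesis by (simp add: W_word_def foldr_conv_fold)
qed

text \<open>Leibniz rule: each W_{t+k} that L_m passes costs -Z_{t+k+m} and drops out of the word.
  Which copy of k is removed is immaterial, as the W commute.\<close>

lemma W_word_L: "W_word ks (ac (bL m) y) =
    ac (bL m) (W_word ks y) - (\<Sum>k\<leftarrow>ks. Z (int t + k + m) (W_word (remove1 k ks) y))"
proof (induction ks)
  case (Cons k' ks)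
  have ac_sum_list: "ac b (sum_list xs) = sum_list (map (ac b) xs)" for b xs
    by (induction xs) (simp_all add: ac_add)
  have "(\<Sum>k\<leftarrow>ks. ac (bW (int t + k')) (Z (int t + k + m) (W_word (remove1 k ks) y))) =
      (\<Sum>k\<leftarrow>ks. Z (int t + k + m) (W_word (remove1 k (k' # ks)) y))"
  proof (intro arg_cong[of _ _ sum_list] map_cong refl)
    fix k assume "k \<in> set ks"
    then have "W_word (remove1 k (k' # ks)) = W_word (k' # remove1 k ks)"
      by (intro W_word_mset) auto
    then show "ac (bW (int t + k')) (Z (int t + k + m) (W_word (remove1 k ks) y)) =
        Z (int t + k + m) (W_word (remove1 k (k' # ks)) y)"
      by (simp only: word_simps Z_W)
  qed
  then show ?case
    by (simp add: Cons.IH ac_diff ac_sum_list comp_def W_L algebra_simps)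
qed simp

text \<open>By the Leibniz rule each L consumes at most one W. With more W than L, one W with index
  above \<open>t\<close> is left over and kills \<open>V2\<close>.\<close>

lemma W_word_vanish: "x \<in> L_ext n \<Longrightarrow> pos ks \<Longrightarrow> n < length ks \<Longrightarrow> W_word ks x = 0"
proof (induction n arbitrary: x ks)
  case 0
  then show ?case
  proof (induction ks)
    case (Cons k ks)
    then show ?case by (cases ks) (auto simp: V2_W)
  qed simp
next
  case (Suc n)
  have sub: "subspace {x. W_word ks x = 0}"
    by (rule subspaceI) (simp_all add: W_word_add W_word_scale)
  show ?case
  proof (rule span_induct[OF Suc.prems(1)[unfolded L_ext.simps] sub])
    fix y assume "y \<in> L_ext n \<union> {ac (bL (- i)) y | i y. i > 0 \<and> y \<in> L_ext n}"
    then consider "y \<in> L_ext n" | i y' where "y = ac (bL (- i)) y'" "y' \<in> L_ext n" by blast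
    then show "W_word ks y = 0"
    proof cases
      case 1
      then show ?thesis using Suc.IH Suc.prems by simp
    next
      case (2 i y')
      have "W_word ks y' = 0" using Suc.IH 2 Suc.prems by simp
      moreover have "W_word (remove1 k ks) y' = 0" if "k \<in> set ks" for k
        using Suc.IH[of y' "remove1 k ks"] 2 Suc.prems that notin_set_remove1
        by (force simp: length_remove1 dest: set_remove1_subset[THEN subsetD])
      then have "(\<Sum>k\<leftarrow>ks. Z (int t + k - i) (W_word (remove1 k ks) y')) = (\<Sum>k\<leftarrow>ks. 0)"
        by (intro arg_cong[of _ _ sum_list] map_cong) auto
      ultimately show ?thesis by (simp add: 2 W_word_L)
    qed
  qed
qed

text \<open>The pairing is triangular for the weight \<open>sum_list\<close>. Matching L_{-i} with
  W_{t+k} yields Z_{t+k-i}: for k > i the term vanishes, for k < i the remaining words fall under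
  the weight condition, and k = i leaves Z_t. The constant is (-1)^n, with n the length, times the
  product of the factorials of the multiplicities.\<close>

lemma W_word_L_word:
  assumes "pos ks" "pos is" "length ks = length is" "u \<in> V2"
  shows "sum_list is < sum_list ks \<or> sum_list is = sum_list ks \<and> mset is \<noteq> mset ks \<Longrightarrow>
      W_word ks (L_word is u) = 0"
    and "mset is = mset ks \<Longrightarrow> \<exists>c. c \<noteq> 0 \<and> W_word ks (L_word is u) = c *s (z ^^ length is) u"
proof -
  have "(sum_list is < sum_list ks \<or> sum_list is = sum_list ks \<and> mset is \<noteq> mset ks \<longrightarrow>
      W_word ks (L_word is u) = 0) \<and>
    (mset is = mset ks \<longrightarrow> (\<exists>c. c \<noteq> 0 \<and> W_word ks (L_word is u) = c *s (z ^^ length is) u))"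
    using assms(1-3)
  proof (induction "is" arbitrary: ks)
    case Nil
    then show ?case by (auto intro: exI[of _ 1])
  next
    case (Cons i "is")
    let ?y = "L_word is u"
    let ?f = "\<lambda>k. Z (int t + k - i) (W_word (remove1 k ks) ?y)"
    have y: "?y \<in> L_ext (length is)" using Cons.prems assms(4) by (intro L_word_mem) auto
    have "W_word ks ?y = 0" using y Cons.prems by (intro W_word_vanish) auto
    then have eq: "W_word ks (L_word (i # is) u) = - (\<Sum>k\<leftarrow>ks. ?f k)"
      by (simp add: W_word_L)
    have rem: "pos (remove1 k ks)" "length (remove1 k ks) = length is"
        "sum_list (remove1 k ks) = sum_list ks - k" "mset (remove1 k ks) = mset ks - {#k#}" if "k \<in> set ks" for k
      using Cons.prems that set_remove1_subset[of k ks]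
      by (auto simp: length_remove1 sum_list_map_remove1[OF that, of "\<lambda>x. x", simplified])
    have IH: "sum_list is < sum_list ks - k \<or> sum_list is = sum_list ks - k \<and> mset is \<noteq> mset ks - {#k#} \<Longrightarrow> ?f k = 0"
        "mset is = mset ks - {#k#} \<Longrightarrow> \<exists>c. c \<noteq> 0 \<and> W_word (remove1 k ks) ?y = c *s (z ^^ length is) u"
      if "k \<in> set ks" for k
      using Cons.IH[of "remove1 k ks"] rem[OF that] Cons.prems by auto
    \<comment> \<open>Z_{t+k-i} is a nonzero multiple of W_{t+k-i}; counted as a further letter it
      makes the W-word longer than the L-word.\<close>
    have big: "?f k = 0" if "k \<in> set ks" "k > i" for k
    proof -
      let ?k = "k - i"
      have *: "pos (?k # remove1 k ks)" "length is < length (?k # remove1 k ks)" using rem[OF that(1)] that(2) by auto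
      have "W_word (?k # remove1 k ks) ?y = 0" by (rule W_word_vanish[OF y *])
      then show ?thesis using that by (simp add: Z_def add_diff_eq)
    qed
    show ?case
    proof (intro conjI impI)
      assume A: "sum_list (i # is) < sum_list ks \<or> sum_list (i # is) = sum_list ks \<and> mset (i # is) \<noteq> mset ks"
      have "?f k = 0" if k: "k \<in> set ks" for k
      proof (cases "k > i")
        case False
        have "mset is \<noteq> mset ks - {#k#}" if "k = i" "mset (i # is) \<noteq> mset ks"
          using that k by (auto simp: insert_DiffM)
        with A False have "sum_list is < sum_list ks - k \<or>
            sum_list is = sum_list ks - k \<and> mset is \<noteq> mset ks - {#k#}"
          by (cases "k = i") auto
        then show ?thesis by (rule IH(1)[OF k])
      qed (use big k in simp)
      then have "(\<Sum>k\<leftarrow>ks. ?f k) = (\<Sum>k\<leftarrow>ks. 0)"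
        by (intro arg_cong[of _ _ sum_list] map_cong) auto
      then show "W_word ks (L_word (i # is) u) = 0" unfolding eq by simp
    next
      assume A: "mset (i # is) = mset ks"
      then have s: "sum_list ks = i + sum_list is"
        by (metis sum_list.Cons sum_mset_sum_list)
      have i: "i \<in> set ks" using A by (metis list.set_intros(1) set_mset_mset)
      have "mset is = mset ks - {#i#}" by (simp flip: A)
      then obtain c where c: "c \<noteq> 0" "W_word (remove1 i ks) ?y = c *s (z ^^ length is) u"
        using IH(2)[OF i] by blast
      have f: "?f k = (if k = i then c *s z ((z ^^ length is) u) else 0)" if k: "k \<in> set ks" for k
      proof (cases k i rule: linorder_cases)
        case less
        then show ?thesis using s by (auto intro: IH(1)[OF k])
      qed (use big k c in \<open>auto simp: Z_scale\<close>)
      have "(\<Sum>k\<leftarrow>ks. ?f k) = (\<Sum>k\<leftarrow>ks. if k = i then c *s z ((z ^^ length is) u) else 0)"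
        by (intro arg_cong[of _ _ sum_list] map_cong f) auto
      \<comment> \<open>Every copy of i in \<open>ks\<close> contributes the same term, whence the
        multiplicity as a factor.\<close>
      also have "\<dots> = of_nat (count_list ks i) *s c *s z ((z ^^ length is) u)"
        by (induction ks) (simp_all add: scale_left_distrib distrib_right)
      finally show "\<exists>c. c \<noteq> 0 \<and> W_word ks (L_word (i # is) u) = c *s (z ^^ length (i # is)) u"
        unfolding eq using c(1) i
        by (intro exI[of _ "- (of_nat (count_list ks i) * c)"]) (auto simp: count_list_0_iff)
    qed
  qed
  then show "sum_list is < sum_list ks \<or> sum_list is = sum_list ks \<and> mset is \<noteq> mset ks \<Longrightarrow>
      W_word ks (L_word is u) = 0"
    and "mset is = mset ks \<Longrightarrow> \<exists>c. c \<noteq> 0 \<and> W_word ks (L_word is u) = c *s (z ^^ length is) u"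
    by blast+
qed

text \<open>Exchanging two letters costs a multiple of L_{-w-i}, which merges both into one; the
  correction is therefore shorter by one letter.\<close>

lemma L_word_insort:
  assumes "u \<in> V2" "i > 0" "pos ws"
  shows "L_word (insort i ws) u - ac (bL (- i)) (L_word ws u) \<in> L_ext (length ws)"
  using assms(3)
proof (induction ws)
  case Nil
  then show ?case by (simp add: V2_subspace subspace_0)
next
  case (Cons w ws)
  let ?y = "L_word ws u"
  show ?case
  proof (cases "i \<le> w")
    case True
    then show ?thesis by (simp add: subspace_0)
  next
    case False
    let ?d = "L_word (insort i ws) u - ac (bL (- i)) ?y"
    have pos: "pos ws" "w > 0" using Cons.prems by auto
    have "ac (bL (- w)) (ac (bL (- i)) ?y) =
        ac (bL (- i)) (ac (bL (- w)) ?y) + of_int (- i - - w) *s ac (bL (- w + - i)) ?y"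
      using pos assms(2) by (intro L_L) auto
    then have "L_word (insort i (w # ws)) u - ac (bL (- i)) (L_word (w # ws) u) =
        ac (bL (- w)) ?d + of_int (- i - - w) *s ac (bL (- w + - i)) ?y"
      using False by (simp add: ac_diff)
    moreover have "ac (bL (- w)) ?d \<in> L_ext (Suc (length ws))"
      using Cons.IH pos by (intro L_ext_L) auto
    moreover have "ac (bL (- w + - i)) ?y \<in> L_ext (Suc (length ws))"
      using pos assms by (intro L_ext_L L_word_mem) auto
    ultimately show ?thesis
      using subspace_add[OF L_ext_subspace] subspace_scale[OF L_ext_subspace] by (simp del: L_ext.simps)
  qed
qed

text \<open>Sorted lists stand for multisets: distinct words of this set differ as multisets, as the
  pairing requires.\<close>

definition sorted_words :: "nat \<Rightarrow> int list set" where
  "sorted_words n = {w. sorted w \<and> length w = n \<and> pos w}"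

definition L_prev :: "nat \<Rightarrow> 'a set" where
  "L_prev n = (case n of 0 \<Rightarrow> {0} | Suc m \<Rightarrow> L_ext m)"

text \<open>The spanning half of a PBW argument: sorting changes a word only by shorter ones, which
  \<open>L_prev\<close> absorbs.\<close>

lemma L_ext_span:
  "x \<in> L_ext n \<Longrightarrow> x \<in> span ({L_word w u | w u. w \<in> sorted_words n \<and> u \<in> V2} \<union> L_prev n)"
proof (induction n arbitrary: x)
  case 0
  then have "x = L_word [] x \<and> [] \<in> sorted_words 0 \<and> x \<in> V2" by (simp add: sorted_words_def)
  then show ?case by (intro span_base) blast
next
  case (Suc n)
  let ?S = "{L_word w u | w u. w \<in> sorted_words (Suc n) \<and> u \<in> V2} \<union> L_ext n"
  have L: "ac (bL (- i)) y \<in> span ?S" if "i > 0" "y \<in> L_ext n" for i y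
  proof (rule ac_span[OF Suc.IH[OF that(2)] subspace_span])
    fix y assume "y \<in> {L_word w u | w u. w \<in> sorted_words n \<and> u \<in> V2} \<union> L_prev n"
    then consider w u where "y = L_word w u" "w \<in> sorted_words n" "u \<in> V2" | "y \<in> L_prev n" by blast
    then show "ac (bL (- i)) y \<in> span ?S"
    proof cases
      case (1 w u)
      then have "insort i w \<in> sorted_words (Suc n)" and len: "length w = n" "pos w"
        using that(1) by (auto simp: sorted_words_def sorted_insort set_insort_key)
      then have "L_word (insort i w) u \<in> span ?S"
        using 1 by (intro span_base) blast
      moreover have "L_word (insort i w) u - ac (bL (- i)) (L_word w u) \<in> span ?S"
        using L_word_insort[of u i w] 1 len that(1) by (intro span_base) auto
      ultimately have "L_word (insort i w) u - (L_word (insort i w) u - ac (bL (- i)) (L_word w u)) \<in> span ?S"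
        by (rule span_diff)
      then show ?thesis by (simp add: 1)
    next
      case 2
      then have "ac (bL (- i)) y \<in> L_ext n"
        using that(1) V2_subspace by (cases n) (auto simp: L_prev_def subspace_0 L_ext_L simp del: L_ext.simps(2))
      then show ?thesis by (intro span_base) blast
    qed
  qed
  have "span (L_ext n \<union> {ac (bL (- i)) y | i y. i > 0 \<and> y \<in> L_ext n}) \<subseteq> span ?S"
    using L by (intro span_minimal subspace_span) (auto intro: span_base)
  then show ?case using Suc.prems by (auto simp: L_prev_def)
qed

lemma L_ext_sum:
  assumes "x \<in> L_ext n"
  obtains A u y where "finite A" "A \<subseteq> sorted_words n" "\<And>w. u w \<in> V2" "y \<in> L_prev n"
    "x = (\<Sum>w\<in>A. L_word w (u w)) + y"
proof -
  have prev: "subspace (L_prev n)"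
    by (cases n) (simp_all add: L_prev_def L_ext_subspace)
  have "\<exists>A u y. finite A \<and> A \<subseteq> sorted_words n \<and> (\<forall>w. u w \<in> V2) \<and> y \<in> L_prev n \<and>
      x = (\<Sum>w\<in>A. L_word w (u w)) + y"
    using L_ext_span[OF assms]
  proof (induction rule: span_induct_alt)
    case base
    show ?case
      by (intro exI[of _ "{}"] exI[of _ "\<lambda>_. 0"] exI[of _ 0])
        (simp add: subspace_0 V2_subspace prev)
  next
    case (step c a x)
    then obtain A u y where A: "finite A" "A \<subseteq> sorted_words n" "\<And>w. u w \<in> V2" "y \<in> L_prev n"
      and x: "x = (\<Sum>w\<in>A. L_word w (u w)) + y" by blast
    from step(1) consider w v where "a = L_word w v" "w \<in> sorted_words n" "v \<in> V2" | "a \<in> L_prev n" by blast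
    then show ?case
    proof cases
      case (1 w v)
      \<comment> \<open>Outside \<open>A\<close> the values of \<open>u\<close> are arbitrary; they
        are cut off there so that a new word \<open>w\<close> starts from coefficient 0.\<close>
      let ?g = "\<lambda>w'. if w' \<in> A then u w' else 0"
      let ?u = "\<lambda>w'. (if w' = w then c *s v else 0) + ?g w'"
      have s1: "(\<Sum>w'\<in>insert w A. L_word w' (?u w')) =
          (\<Sum>w'\<in>insert w A. L_word w' (if w' = w then c *s v else 0)) + (\<Sum>w'\<in>insert w A. L_word w' (?g w'))"
        by (subst sum.distrib[symmetric], rule sum.cong, rule refl, rule L_word_add)
      have s2: "(\<Sum>w'\<in>insert w A. L_word w' (if w' = w then c *s v else 0)) =
          (\<Sum>w'\<in>insert w A. if w' = w then L_word w (c *s v) else 0)"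
        by (rule sum.cong) auto
      have s3: "(\<Sum>w'\<in>insert w A. if w' = w then L_word w (c *s v) else 0) = c *s a"
        using A(1) 1 by (simp add: L_word_scale)
      have s4: "(\<Sum>w'\<in>insert w A. L_word w' (?g w')) = (\<Sum>w'\<in>A. L_word w' (u w'))"
        using A(1) by (intro sum.mono_neutral_cong_right) auto
      have "c *s a + x = (\<Sum>w'\<in>insert w A. L_word w' (?u w')) + y"
        unfolding x s1 s2 s3 s4 by (rule add.assoc[symmetric])
      moreover have "?u w' \<in> V2" for w'
        using A(3) 1 by (auto intro!: subspace_add subspace_scale subspace_0 V2_subspace)
      ultimately show ?thesis
        using A 1 by (intro exI[of _ "insert w A"] exI[of _ ?u] exI[of _ y]) auto
    next
      case 2
      have "c *s a + x = (\<Sum>w\<in>A. L_word w (u w)) + (c *s a + y)"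
        by (simp add: x algebra_simps)
      moreover have "c *s a + y \<in> L_prev n"
        using 2 A prev by (intro subspace_add subspace_scale)
      ultimately show ?thesis using A by blast
    qed
  qed
  then show thesis using that by blast
qed

text \<open>The last letter acts first and lands in \<open>Ksat\<close>; the others preserve
  it.\<close>

lemma W_word_Ksat:
  assumes "\<And>k. k > 0 \<Longrightarrow> ac (bW (int t + k)) x \<in> Ksat"
  shows "pos ks \<Longrightarrow> ks \<noteq> [] \<Longrightarrow> W_word ks x \<in> Ksat"
proof (induction ks)
  case (Cons k ks)
  then show ?case by (cases "ks = []") (auto simp: assms Ksat_W)
qed simp

text \<open>
  Among the words of maximal length in an expansion of \<open>x\<close> pick one, \<open>w\<close>, of maximal weight: the
  word in the \<open>W\<^bsub>t+i\<^esub>\<close> opposite to \<open>w\<close> kills all terms except that of \<open>w\<close>.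
\<close>

lemma L_ext_down:
  assumes x: "x \<in> L_ext (Suc n)" and W: "\<And>k. k > 0 \<Longrightarrow> ac (bW (int t + k)) x \<in> Ksat"
  shows "x \<in> L_ext n"
proof -
  obtain A u y where A: "finite A" "A \<subseteq> sorted_words (Suc n)" and u: "\<And>w. u w \<in> V2" and y: "y \<in> L_ext n"
    and xu: "x = (\<Sum>w\<in>A. L_word w (u w)) + y"
    using L_ext_sum[OF x] unfolding L_prev_def nat.case by blast
  let ?B = "{w \<in> A. u w \<noteq> 0}"
  have "?B = {}"
  proof (rule ccontr)
    assume "?B \<noteq> {}"
    with A(1) have "Max (sum_list ` ?B) \<in> sum_list ` ?B" by (intro Max_in) auto
    then obtain w where w: "w \<in> ?B" "sum_list w = Max (sum_list ` ?B)" by auto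
    have max: "sum_list w' \<le> sum_list w" if "w' \<in> ?B" for w'
      unfolding w(2) using A(1) that by (intro Max_ge) auto
    have words: "pos w'" "length w' = Suc n" "sorted w'" if "w' \<in> A" for w'
      using that A(2) by (auto simp: sorted_words_def)
    have wA: "w \<in> A" using w by simp
    have other: "W_word w (L_word w' (u w')) = 0" if "w' \<in> A" "w' \<noteq> w" for w'
    proof (cases "u w' = 0")
      case False
      have "mset w' \<noteq> mset w" using that words wA properties_for_sort by metis
      moreover have "sum_list w' \<le> sum_list w" using max that False by simp
      ultimately show ?thesis
        using words that(1) wA u by (intro W_word_L_word(1)) auto
    qed simp
    obtain c where c: "c \<noteq> 0" "W_word w (L_word w (u w)) = c *s (z ^^ length w) (u w)"
      using W_word_L_word(2)[of w w "u w"] words[OF wA] u by auto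
    have "W_word w x = (\<Sum>w'\<in>A. W_word w (L_word w' (u w')))"
      using words[OF wA] y by (simp add: xu W_word_add W_word_sum W_word_vanish[of y n])
    also have "\<dots> = (\<Sum>w'\<in>A. if w' = w then W_word w (L_word w (u w)) else 0)"
      using other by (intro sum.cong) auto
    also have "\<dots> = c *s (z ^^ length w) (u w)" using A(1) wA c by simp
    finally have "c *s (z ^^ length w) (u w) \<in> Ksat"
      using W_word_Ksat[OF W, of w] words[OF wA] by force
    then have "u w = 0"
      using V2_Ksat[OF u] Ksat_zpow Ksat_scale[OF c(1)] by blast
    then show False using w by simp
  qed
  then have "(\<Sum>w\<in>A. L_word w (u w)) = 0" by (intro sum.neutral) auto
  then show ?thesis using xu y by simp
qed

text \<open>The layers come off in the reverse order of adjoining: the hypothesis on W removes the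
  negative L, that on G the negative G, and that on L the negative W.\<close>

theorem singular_in_V:
  assumes "x \<in> gen V" and "\<And>i. i > int t \<Longrightarrow> ac (bW i) x \<in> K"
    and "\<And>i. i \<ge> int t \<Longrightarrow> ac (bG i) x \<in> K" and "\<And>i. i > int t + int d \<Longrightarrow> ac (bL i) x \<in> K"
  shows "x \<in> V"
proof -
  obtain n where "x \<in> L_ext n" using gen_L_ext assms(1) by blast
  then have "x \<in> V2"
  proof (induction n)
    case (Suc n)
    have "x \<in> L_ext n" by (rule L_ext_down[OF Suc.prems], rule K_Ksat, rule assms(2)) simp
    then show ?case by (rule Suc.IH)
  qed simp
  then show ?thesis by (intro V1_V V2_V1) (auto intro: K_Ksat assms(3,4))
qed

text \<open>Raising elements keep the submodule \<open>K\<close> inside itself, so its elements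
  satisfy the hypotheses of \<open>singular_in_V\<close>.\<close>

corollary K_trivial:
  assumes "K \<subseteq> gen V"
  shows "K \<subseteq> {0}"
proof
  fix x assume "x \<in> K"
  then have "x \<in> V"
    by (intro singular_in_V) (use assms stableD[OF K_stable] in auto)
  with \<open>x \<in> K\<close> K_V show "x \<in> {0}" by blast
qed

end

section \<open>Enveloping algebras\<close>

locale cmodule = module CC M for M (structure)
begin

definition lincomb :: "('k \<Rightarrow> 'a) \<Rightarrow> ('k \<Rightarrow>\<^sub>0 complex) \<Rightarrow> 'a" where
  "lincomb h p = (\<Oplus>\<^bsub>M\<^esub>k\<in>Poly_Mapping.keys p. Poly_Mapping.lookup p k \<odot>\<^bsub>M\<^esub> h k)"

lemma lincomb_superset:
  assumes "finite A" "Poly_Mapping.keys p \<subseteq> A" "h \<in> A \<rightarrow> carrier M"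
  shows "lincomb h p = (\<Oplus>\<^bsub>M\<^esub>k\<in>A. Poly_Mapping.lookup p k \<odot>\<^bsub>M\<^esub> h k)"
  unfolding lincomb_def
proof (rule M.add.finprod_mono_neutral_cong_left[OF assms(1,2)])
  fix k assume "k \<in> A - Poly_Mapping.keys p"
  then have "Poly_Mapping.lookup p k = \<zero>\<^bsub>CC\<^esub>" "h k \<in> carrier M"
    using assms(3) by (auto simp: in_keys_iff)
  then show "Poly_Mapping.lookup p k \<odot>\<^bsub>M\<^esub> h k = \<zero>\<^bsub>M\<^esub>"
    by (simp only: smult_l_null)
qed (use assms(3) in auto)

lemma smult_mem [simp]: "x \<in> carrier M \<Longrightarrow> c \<odot>\<^bsub>M\<^esub> x \<in> carrier M"
  by (rule smult_closed) simp

lemma smult_add: "x \<in> carrier M \<Longrightarrow> (a + b) \<odot>\<^bsub>M\<^esub> x = a \<odot>\<^bsub>M\<^esub> x \<oplus>\<^bsub>M\<^esub> b \<odot>\<^bsub>M\<^esub> x"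
  using smult_l_distr[of a b x] by simp

lemma smult_add_right: "x \<in> carrier M \<Longrightarrow> y \<in> carrier M \<Longrightarrow> a \<odot>\<^bsub>M\<^esub> (x \<oplus>\<^bsub>M\<^esub> y) = a \<odot>\<^bsub>M\<^esub> x \<oplus>\<^bsub>M\<^esub> a \<odot>\<^bsub>M\<^esub> y"
  using smult_r_distr[of a x y] by simp

lemma smult_smult: "x \<in> carrier M \<Longrightarrow> a \<odot>\<^bsub>M\<^esub> (b \<odot>\<^bsub>M\<^esub> x) = (a * b) \<odot>\<^bsub>M\<^esub> x"
  using smult_assoc1[of a b x] by simp

lemma smult_zero [simp]: "x \<in> carrier M \<Longrightarrow> 0 \<odot>\<^bsub>M\<^esub> x = \<zero>\<^bsub>M\<^esub>"
  using smult_l_null[of x] by simp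

lemma smult_zero_right [simp]: "a \<odot>\<^bsub>M\<^esub> \<zero>\<^bsub>M\<^esub> = \<zero>\<^bsub>M\<^esub>"
  using smult_r_null[of a] by simp

lemma smult_1 [simp]: "x \<in> carrier M \<Longrightarrow> 1 \<odot>\<^bsub>M\<^esub> x = x"
  using smult_one[of x] by simp

lemma smult_m1: "x \<in> carrier M \<Longrightarrow> (- 1) \<odot>\<^bsub>M\<^esub> x = \<ominus>\<^bsub>M\<^esub> x"
  by (rule sym, rule M.minus_equality) (use smult_add[of x "-1" 1] in simp_all)

lemma smult_eq_0: "x \<in> carrier M \<Longrightarrow> c \<noteq> 0 \<Longrightarrow> c \<odot>\<^bsub>M\<^esub> x = \<zero>\<^bsub>M\<^esub> \<Longrightarrow> x = \<zero>\<^bsub>M\<^esub>"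
  by (metis smult_smult smult_zero_right smult_1 left_inverse)

lemma lincomb_closed: "h \<in> Poly_Mapping.keys p \<rightarrow> carrier M \<Longrightarrow> lincomb h p \<in> carrier M"
  unfolding lincomb_def by (intro M.finsum_closed) auto

lemma lincomb_0 [simp]: "lincomb h 0 = \<zero>\<^bsub>M\<^esub>"
  by (simp add: lincomb_def)

lemma lincomb_single [simp]: "h k \<in> carrier M \<Longrightarrow> lincomb h (Poly_Mapping.single k c) = c \<odot>\<^bsub>M\<^esub> h k"
  by (subst lincomb_superset[of "{k}"]) auto

lemma lincomb_add:
  assumes "h \<in> Poly_Mapping.keys p \<rightarrow> carrier M" "h \<in> Poly_Mapping.keys q \<rightarrow> carrier M"
  shows "lincomb h (p + q) = lincomb h p \<oplus>\<^bsub>M\<^esub> lincomb h q"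
proof -
  let ?A = "Poly_Mapping.keys p \<union> Poly_Mapping.keys q"
  have h: "h \<in> ?A \<rightarrow> carrier M" using assms by auto
  have "lincomb h (p + q) = (\<Oplus>\<^bsub>M\<^esub>k\<in>?A. Poly_Mapping.lookup (p + q) k \<odot>\<^bsub>M\<^esub> h k)"
    using h Poly_Mapping.keys_add[of p q] by (intro lincomb_superset) auto
  also have "\<dots> = (\<Oplus>\<^bsub>M\<^esub>k\<in>?A. Poly_Mapping.lookup p k \<odot>\<^bsub>M\<^esub> h k \<oplus>\<^bsub>M\<^esub> Poly_Mapping.lookup q k \<odot>\<^bsub>M\<^esub> h k)"
    by (rule M.finsum_cong'[OF refl]) (use h in \<open>auto simp: lookup_add smult_add Pi_iff\<close>)
  also have "\<dots> = lincomb h p \<oplus>\<^bsub>M\<^esub> lincomb h q"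
    using h by (subst (1 2) lincomb_superset[of ?A]) (auto intro!: M.finsum_addf)
  finally show ?thesis .
qed

lemma lincomb_pscale:
  assumes "h \<in> Poly_Mapping.keys p \<rightarrow> carrier M"
  shows "lincomb h (pscale c p) = c \<odot>\<^bsub>M\<^esub> lincomb h p"
proof -
  have "lincomb h (pscale c p) =
      (\<Oplus>\<^bsub>M\<^esub>k\<in>Poly_Mapping.keys p. c \<odot>\<^bsub>M\<^esub> (Poly_Mapping.lookup p k \<odot>\<^bsub>M\<^esub> h k))"
    using assms keys_pscale[of c p]
    by (subst lincomb_superset[of "Poly_Mapping.keys p"]) (auto simp: smult_smult Pi_iff intro!: M.finsum_cong')
  also have "\<dots> = c \<odot>\<^bsub>M\<^esub> lincomb h p"
    unfolding lincomb_def using assms by (intro finsum_smult_ldistr[symmetric]) auto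
  finally show ?thesis .
qed

lemma submoduleI':
  assumes "H \<subseteq> carrier M" "\<zero>\<^bsub>M\<^esub> \<in> H" "\<And>a b. a \<in> H \<Longrightarrow> b \<in> H \<Longrightarrow> a \<oplus>\<^bsub>M\<^esub> b \<in> H"
    "\<And>c a. a \<in> H \<Longrightarrow> c \<odot>\<^bsub>M\<^esub> a \<in> H"
  shows "submodule H CC M"
proof (rule submoduleI)
  fix a assume a: "a \<in> H"
  then have "\<ominus>\<^bsub>M\<^esub> a = (- 1) \<odot>\<^bsub>M\<^esub> a" using assms(1) smult_m1 by auto
  then show "\<ominus>\<^bsub>M\<^esub> a \<in> H" using assms(4)[OF a] by simp
qed (use assms in auto)

lemma submodule_closed:
  assumes "submodule H CC M"
  shows "H \<subseteq> carrier M" "\<zero>\<^bsub>M\<^esub> \<in> H" "a \<in> H \<Longrightarrow> b \<in> H \<Longrightarrow> a \<oplus>\<^bsub>M\<^esub> b \<in> H"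
    "a \<in> H \<Longrightarrow> c \<odot>\<^bsub>M\<^esub> a \<in> H" "a \<in> H \<Longrightarrow> \<ominus>\<^bsub>M\<^esub> a \<in> H" "a \<in> H \<Longrightarrow> b \<in> H \<Longrightarrow> a \<ominus>\<^bsub>M\<^esub> b \<in> H"
proof -
  show 1: "H \<subseteq> carrier M" "a \<in> H \<Longrightarrow> b \<in> H \<Longrightarrow> a \<oplus>\<^bsub>M\<^esub> b \<in> H" "a \<in> H \<Longrightarrow> \<ominus>\<^bsub>M\<^esub> a \<in> H"
    for a b
    using submoduleE[OF assms] by auto
  show 2: "a \<in> H \<Longrightarrow> c \<odot>\<^bsub>M\<^esub> a \<in> H" for a
    using submoduleE(4)[OF assms, of c a] by simp
  show "\<zero>\<^bsub>M\<^esub> \<in> H" using subgroup.one_closed[OF submodule.axioms(1)[OF assms]] by simp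
  show "a \<in> H \<Longrightarrow> b \<in> H \<Longrightarrow> a \<ominus>\<^bsub>M\<^esub> b \<in> H"
    unfolding a_minus_def using 1 by blast
qed

end

context superspace
begin

sublocale cmodule M by unfold_locales

lemma hpart_carrier: "x \<in> hpart M i \<Longrightarrow> x \<in> carrier M"
  using submodule_closed(1)[OF hpart_submodule] by auto

lemmas hpart_closed = submodule_closed(2-)[OF hpart_submodule]

lemma decompose:
  assumes "x \<in> carrier M"
  obtains y z where "x = y \<oplus> z" "y \<in> hpart M 0" "z \<in> hpart M 1"
  using assms hpart_sum unfolding set_add_def' by blast

lemma hpart_add_eq_0:
  assumes "y \<in> hpart M 0" "z \<in> hpart M 1" "y \<oplus> z = \<zero>"
  shows "y = \<zero>" "z = \<zero>"
proof -
  have "y = \<ominus> z" using assms hpart_carrier M.minus_equality by metis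
  then have "y \<in> hpart M 1" using hpart_closed assms by simp
  then show y: "y = \<zero>" using assms hpart_Int by auto
  show "z = \<zero>" using assms(3) hpart_carrier[OF assms(2)] unfolding y by simp
qed

end

lemma bit_01: "(i::bit) = 0 \<or> i = 1"
  by (cases i) auto

context supermodule
begin

text \<open>The axioms give closure for homogeneous arguments only, so both arguments are split into
  their parts.\<close>

lemma act_closed: "x \<in> carrier G \<Longrightarrow> v \<in> carrier M \<Longrightarrow> act M x v \<in> carrier M"
proof -
  assume "x \<in> carrier G" "v \<in> carrier M"
  then obtain x0 x1 v0 v1 where x: "x = x0 \<oplus>\<^bsub>G\<^esub> x1" "x0 \<in> hpart G 0" "x1 \<in> hpart G 1"
    and v: "v = v0 \<oplus>\<^bsub>M\<^esub> v1" "v0 \<in> hpart M 0" "v1 \<in> hpart M 1"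
    using G.decompose M.decompose by metis
  have "act M x0 v0 \<in> carrier M" "act M x0 v1 \<in> carrier M" "act M x1 v0 \<in> carrier M" "act M x1 v1 \<in> carrier M"
    using x v act_hpart M.hpart_carrier by blast+
  with x v show ?thesis
    by (simp add: act_add_left act_add_right G.hpart_carrier M.hpart_carrier)
qed

lemma act_zero_right: "x \<in> carrier G \<Longrightarrow> act M x \<zero>\<^bsub>M\<^esub> = \<zero>\<^bsub>M\<^esub>"
  using act_smult_right[of x "\<zero>\<^bsub>M\<^esub>" 0] act_closed[of x "\<zero>\<^bsub>M\<^esub>"] by simp

lemma foldr_closed: "set xs \<subseteq> carrier G \<Longrightarrow> v \<in> carrier M \<Longrightarrow> foldr (act M) xs v \<in> carrier M"
  by (induction xs) (auto intro: act_closed)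

lemma word_act_lincomb: "word_act M p v = M.lincomb (\<lambda>xs. foldr (act M) xs v) p"
  by (simp add: word_act_def M.lincomb_def)

abbreviation polys where "polys \<equiv> {p. Poly_Mapping.keys p \<subseteq> lists (carrier G)}"

lemma word_fun: "p \<in> polys \<Longrightarrow> v \<in> carrier M \<Longrightarrow> (\<lambda>xs. foldr (act M) xs v) \<in> Poly_Mapping.keys p \<rightarrow> carrier M"
  by (auto intro!: foldr_closed)

lemma word_act_closed: "p \<in> polys \<Longrightarrow> v \<in> carrier M \<Longrightarrow> word_act M p v \<in> carrier M"
  unfolding word_act_lincomb by (intro M.lincomb_closed word_fun)

lemma word_act_add: "p \<in> polys \<Longrightarrow> q \<in> polys \<Longrightarrow> v \<in> carrier M \<Longrightarrow>
    word_act M (p + q) v = word_act M p v \<oplus>\<^bsub>M\<^esub> word_act M q v"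
  unfolding word_act_lincomb by (intro M.lincomb_add word_fun)

lemma word_act_pscale: "p \<in> polys \<Longrightarrow> v \<in> carrier M \<Longrightarrow>
    word_act M (pscale c p) v = c \<odot>\<^bsub>M\<^esub> word_act M p v"
  unfolding word_act_lincomb by (intro M.lincomb_pscale word_fun)

lemma word_act_single: "set xs \<subseteq> carrier G \<Longrightarrow> v \<in> carrier M \<Longrightarrow>
    word_act M (Poly_Mapping.single xs c) v = c \<odot>\<^bsub>M\<^esub> foldr (act M) xs v"
  unfolding word_act_lincomb by (simp add: foldr_closed)

lemma word_act_0 [simp]: "word_act M 0 v = \<zero>\<^bsub>M\<^esub>"
  unfolding word_act_lincomb by simp

lemma minus_pscale: "- p = pscale (- 1) (p :: 'k \<Rightarrow>\<^sub>0 complex)"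
  by (rule poly_mapping_eqI) simp

lemma word_act_minus: "p \<in> polys \<Longrightarrow> v \<in> carrier M \<Longrightarrow> word_act M (- p) v = \<ominus>\<^bsub>M\<^esub> word_act M p v"
  unfolding minus_pscale by (simp add: word_act_pscale word_act_closed M.smult_m1)

lemma word_act_diff: "p \<in> polys \<Longrightarrow> q \<in> polys \<Longrightarrow> v \<in> carrier M \<Longrightarrow>
    word_act M (p - q) v = word_act M p v \<ominus>\<^bsub>M\<^esub> word_act M q v"
  using word_act_add[of p "- q" v] by (simp add: word_act_minus a_minus_def)

lemma word_act_linear:
  assumes "p \<in> polys" "v \<in> carrier M" "w \<in> carrier M"
  shows "word_act M p (v \<oplus>\<^bsub>M\<^esub> w) = word_act M p v \<oplus>\<^bsub>M\<^esub> word_act M p w"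
    and "word_act M p (c \<odot>\<^bsub>M\<^esub> v) = c \<odot>\<^bsub>M\<^esub> word_act M p v"
proof -
  have f: "foldr (act M) xs (v \<oplus>\<^bsub>M\<^esub> w) = foldr (act M) xs v \<oplus>\<^bsub>M\<^esub> foldr (act M) xs w"
     "foldr (act M) xs (c \<odot>\<^bsub>M\<^esub> v) = c \<odot>\<^bsub>M\<^esub> foldr (act M) xs v"
    if "set xs \<subseteq> carrier G" for xs
    using that assms by (induction xs) (auto simp: act_add_right act_smult_right foldr_closed)
  have "p \<in> polys \<and> word_act M p (v \<oplus>\<^bsub>M\<^esub> w) = word_act M p v \<oplus>\<^bsub>M\<^esub> word_act M p w \<and>
      word_act M p (c \<odot>\<^bsub>M\<^esub> v) = c \<odot>\<^bsub>M\<^esub> word_act M p v"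
    using assms(1)[THEN CollectD]
  proof (induction p rule: free_space_induct)
    case (single xs a)
    then have "set xs \<subseteq> carrier G" by auto
    then show ?case
      using assms by (auto simp: word_act_single f M.smult_add_right M.smult_smult foldr_closed mult.commute)
  next
    case (add p q)
    then have "p + q \<in> polys" using keys_add_subset[of p _ q] by simp
    with add assms show ?case
      by (simp add: word_act_add M.smult_add_right word_act_closed M.a_ac)
  qed auto
  then show "word_act M p (v \<oplus>\<^bsub>M\<^esub> w) = word_act M p v \<oplus>\<^bsub>M\<^esub> word_act M p w"
    "word_act M p (c \<odot>\<^bsub>M\<^esub> v) = c \<odot>\<^bsub>M\<^esub> word_act M p v" by auto
qed

lemma word_act_zero_right: "p \<in> polys \<Longrightarrow> word_act M p \<zero>\<^bsub>M\<^esub> = \<zero>\<^bsub>M\<^esub>"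
  using word_act_linear(2)[of p "\<zero>\<^bsub>M\<^esub>" "\<zero>\<^bsub>M\<^esub>" 0] word_act_closed[of p "\<zero>\<^bsub>M\<^esub>"] by simp

lemma polys_mult: "p \<in> polys \<Longrightarrow> q \<in> polys \<Longrightarrow> p * q \<in> polys"
  using keys_mult[of p q] by (fastforce simp: plus_list_def)

lemma word_act_mult:
  assumes "p \<in> polys" "q \<in> polys" "v \<in> carrier M"
  shows "word_act M (p * q) v = word_act M p (word_act M q v)"
proof -
  have wq: "word_act M q v \<in> carrier M" by (rule word_act_closed[OF assms(2,3)])
  have "p \<in> polys \<and> word_act M (p * q) v = word_act M p (word_act M q v)"
    using assms(1)[THEN CollectD]
  proof (induction p rule: free_space_induct)
    case (single xs a)
    then have xs: "Poly_Mapping.single xs a \<in> polys" "set xs \<subseteq> carrier G" by auto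
    have "q \<in> polys \<and> word_act M (Poly_Mapping.single xs a * q) v = word_act M (Poly_Mapping.single xs a) (word_act M q v)"
      using assms(2)[THEN CollectD]
    proof (induction q rule: free_space_induct)
      case (single ys b)
      then have ys: "Poly_Mapping.single ys b \<in> polys" "set ys \<subseteq> carrier G" by auto
      have "word_act M (Poly_Mapping.single xs a) (b \<odot>\<^bsub>M\<^esub> foldr (act M) ys v) =
          b \<odot>\<^bsub>M\<^esub> word_act M (Poly_Mapping.single xs a) (foldr (act M) ys v)"
        using xs ys assms by (intro word_act_linear) (auto simp: foldr_closed)
      then show ?case
        using xs ys assms
        by (simp add: mult_single plus_list_def word_act_single foldr_closed M.smult_smult mult.commute)
    next
      case (add p q)
      then have "p + q \<in> polys" using keys_add_subset[of p _ q] by simp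
      with add xs assms show ?case
        by (simp add: word_act_add word_act_linear word_act_closed polys_mult[simplified] distrib_left)
    next
      case zero
      show ?case using word_act_zero_right[OF xs(1)] by simp
    qed
    then show ?case using xs by simp
  next
    case (add p p')
    then have "p + p' \<in> polys" using keys_add_subset[of p _ p'] by simp
    with add assms wq show ?case
      by (simp add: word_act_add polys_mult[simplified] distrib_right)
  qed auto
  then show ?thesis by simp
qed

end

section \<open>The free algebra, its ideals and the enveloping algebra\<close>

lemma free_algebra_simps [simp]:
  "carrier (free_algebra A) = {p. Poly_Mapping.keys p \<subseteq> lists A}" "monoid.mult (free_algebra A) = (*)"
  "one (free_algebra A) = 1" "zero (free_algebra A) = 0" "add (free_algebra A) = (+)"
  by (simp_all add: free_algebra_def)

lemma keys_mult_lists: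
  "Poly_Mapping.keys p \<subseteq> lists A \<Longrightarrow> Poly_Mapping.keys q \<subseteq> lists A \<Longrightarrow> Poly_Mapping.keys (p * q) \<subseteq> lists A"
  using keys_mult[of p q] by (fastforce simp: plus_list_def)

lemma keys_diff_subset: "Poly_Mapping.keys x \<subseteq> S \<Longrightarrow> Poly_Mapping.keys y \<subseteq> S \<Longrightarrow> Poly_Mapping.keys (x - y) \<subseteq> S"
  using keys_diff[of x y] by blast

lemma free_algebra_ring: "ring (free_algebra A)"
proof (rule ringI)
  show "abelian_group (free_algebra A)"
  proof (rule abelian_groupI)
    fix x assume "x \<in> carrier (free_algebra A)"
    then show "\<exists>y\<in>carrier (free_algebra A). y \<oplus>\<^bsub>free_algebra A\<^esub> x = \<zero>\<^bsub>free_algebra A\<^esub>"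
      by (intro bexI[of _ "- x"]) auto
  qed (auto simp: keys_add_subset add_ac)
  show "Group.monoid (free_algebra A)"
    by (rule monoidI) (auto simp: keys_mult_lists zero_list_def mult.assoc)
qed (auto simp: distrib_left distrib_right)

lemma free_algebra_idealI:
  assumes "J \<subseteq> carrier (free_algebra A)" "0 \<in> J" "\<And>p q. p \<in> J \<Longrightarrow> q \<in> J \<Longrightarrow> p + q \<in> J" "\<And>p. p \<in> J \<Longrightarrow> - p \<in> J"
    and "\<And>p q. p \<in> J \<Longrightarrow> Poly_Mapping.keys q \<subseteq> lists A \<Longrightarrow> q * p \<in> J"
    and "\<And>p q. p \<in> J \<Longrightarrow> Poly_Mapping.keys q \<subseteq> lists A \<Longrightarrow> p * q \<in> J"
  shows "ideal J (free_algebra A)"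
proof (rule idealI[OF free_algebra_ring])
  interpret ring "free_algebra A" by (rule free_algebra_ring)
  have neg: "\<ominus>\<^bsub>free_algebra A\<^esub> p = - p" if "p \<in> J" for p
    using that assms(1) by (intro minus_equality) auto
  show "subgroup J (add_monoid (free_algebra A))"
  proof (rule subgroup.intro)
    show "inv\<^bsub>add_monoid (free_algebra A)\<^esub> x \<in> J" if "x \<in> J" for x
      using neg[OF that] assms(4)[OF that] by (simp add: a_inv_def)
  qed (use assms in auto)
qed (use assms(5,6) in auto)

context lie_superalgebra
begin

abbreviation FA where "FA \<equiv> free_algebra (carrier G)"

lemma uea_rels_carrier: "uea_rels G \<subseteq> carrier FA"
proof -
  have "bracket G x y \<in> carrier G" if "x \<in> hpart G i" "y \<in> hpart G j" for x y i j
    using that bracket_hpart hpart_carrier by blast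
  then show ?thesis
    unfolding uea_rels_def
    by (auto simp: hpart_carrier intro!: keys_diff_subset split: if_splits dest!: keys_diff[THEN subsetD])
qed

lemma uea_ideal_ideal: "ideal (uea_ideal G) FA"
  unfolding uea_ideal_def by (rule ring.genideal_ideal[OF free_algebra_ring uea_rels_carrier])

lemma uea_rels_ideal: "r \<in> uea_rels G \<Longrightarrow> r \<in> uea_ideal G"
  unfolding uea_ideal_def using ring.genideal_self[OF free_algebra_ring uea_rels_carrier] by auto

lemma uea_ideal_minimal: "ideal J FA \<Longrightarrow> uea_rels G \<subseteq> J \<Longrightarrow> uea_ideal G \<subseteq> J"
  unfolding uea_ideal_def by (rule ring.genideal_minimal[OF free_algebra_ring])

lemma uea_ideal_closed:
  "uea_ideal G \<subseteq> carrier FA" "0 \<in> uea_ideal G"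
  "p \<in> uea_ideal G \<Longrightarrow> q \<in> uea_ideal G \<Longrightarrow> p + q \<in> uea_ideal G"
  "p \<in> uea_ideal G \<Longrightarrow> - p \<in> uea_ideal G"
  "p \<in> uea_ideal G \<Longrightarrow> q \<in> uea_ideal G \<Longrightarrow> p - q \<in> uea_ideal G"
  "p \<in> uea_ideal G \<Longrightarrow> r \<in> carrier FA \<Longrightarrow> r * p \<in> uea_ideal G"
  "p \<in> uea_ideal G \<Longrightarrow> r \<in> carrier FA \<Longrightarrow> p * r \<in> uea_ideal G"
proof -
  interpret ideal "uea_ideal G" FA by (rule uea_ideal_ideal)
  show 1: "uea_ideal G \<subseteq> carrier FA" using a_subset .
  show "0 \<in> uea_ideal G" using additive_subgroup.zero_closed[OF is_additive_subgroup] by simp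
  show add: "p \<in> uea_ideal G \<Longrightarrow> q \<in> uea_ideal G \<Longrightarrow> p + q \<in> uea_ideal G" for p q
    using additive_subgroup.a_closed[OF is_additive_subgroup, of p q] by simp
  show neg: "p \<in> uea_ideal G \<Longrightarrow> - p \<in> uea_ideal G" for p
  proof -
    assume p: "p \<in> uea_ideal G"
    then have "\<ominus>\<^bsub>FA\<^esub> p = - p" using 1 by (intro minus_equality) auto
    then show ?thesis using additive_subgroup.a_inv_closed[OF is_additive_subgroup p] by simp
  qed
  show "p \<in> uea_ideal G \<Longrightarrow> q \<in> uea_ideal G \<Longrightarrow> p - q \<in> uea_ideal G"
    using add[of p "- q"] neg by simp
  show "p \<in> uea_ideal G \<Longrightarrow> r \<in> carrier FA \<Longrightarrow> r * p \<in> uea_ideal G"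
    "p \<in> uea_ideal G \<Longrightarrow> r \<in> carrier FA \<Longrightarrow> p * r \<in> uea_ideal G"
    using I_l_closed[of p r] I_r_closed[of p r] by simp_all
qed

lemma uea_class_alt: "uea_class G p = {h + p | h. h \<in> uea_ideal G}"
  by (auto simp: uea_class_def a_r_coset_def')

lemma uea_class_self: "p \<in> uea_class G p"
  unfolding uea_class_alt using uea_ideal_closed(2) by force

lemma uea_class_eq: "uea_class G p = uea_class G q \<longleftrightarrow> p - q \<in> uea_ideal G"
proof
  assume "uea_class G p = uea_class G q"
  with uea_class_self[of p] have "p \<in> uea_class G q" by simp
  then show "p - q \<in> uea_ideal G" by (auto simp: uea_class_alt)
next
  assume pq: "p - q \<in> uea_ideal G"
  have "h + p \<in> uea_class G q" "h + q \<in> uea_class G p" if "h \<in> uea_ideal G" for h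
    unfolding uea_class_alt using uea_ideal_closed(3)[OF that pq] uea_ideal_closed(5)[OF that pq]
    by (auto intro: exI[of _ "h + (p - q)"] exI[of _ "h - (p - q)"])
  then show "uea_class G p = uea_class G q" by (auto simp: uea_class_alt[of p] uea_class_alt[of q])
qed

lemma uea_carrier: "carrier (uea G) = uea_class G ` carrier FA"
  by (auto simp: uea_def FactRing_def A_RCOSETS_def' uea_class_def)

lemma uea_add: "uea_class G p \<oplus>\<^bsub>uea G\<^esub> uea_class G q = uea_class G (p + q)"
proof -
  have "h + p + (k + q) \<in> uea_class G (p + q)" if "h \<in> uea_ideal G" "k \<in> uea_ideal G" for h k
    unfolding uea_class_alt using uea_ideal_closed(3)[OF that] by (auto intro!: exI[of _ "h + k"])
  moreover have "\<exists>a\<in>uea_class G p. \<exists>b\<in>uea_class G q. h + (p + q) = a + b" if "h \<in> uea_ideal G" for h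
    using that uea_class_self[of q] by (intro bexI[of _ "h + p"] bexI[of _ q]) (auto simp: uea_class_alt[of p])
  ultimately show ?thesis
    by (auto simp: uea_def FactRing_def set_add_def' uea_class_alt[of p] uea_class_alt[of q])
      (auto simp: uea_class_alt)
qed

lemma uea_mult:
  assumes "p \<in> carrier FA" "q \<in> carrier FA"
  shows "uea_class G p \<otimes>\<^bsub>uea G\<^esub> uea_class G q = uea_class G (p * q)"
  using ideal.rcoset_mult_add[OF uea_ideal_ideal assms]
  by (simp add: uea_def FactRing_def uea_class_def)

lemma uea_class_bracket:
  assumes "x \<in> hpart G i" "y \<in> hpart G j"
  shows "uea_class G (Poly_Mapping.single [x, y] 1) =
    uea_class G (Poly_Mapping.single [y, x] (ksign i j) + Poly_Mapping.single [bracket G x y] 1)"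
proof -
  have "Poly_Mapping.single [x, y] 1 - Poly_Mapping.single [y, x] (ksign i j)
      - Poly_Mapping.single [bracket G x y] 1 \<in> uea_rels G"
    unfolding uea_rels_def using assms by blast
  then show ?thesis unfolding uea_class_eq using uea_rels_ideal by (simp add: algebra_simps)
qed

lemma uea_class_letter_add:
  assumes "x \<in> carrier G" "y \<in> carrier G"
  shows "uea_class G (Poly_Mapping.single [x \<oplus> y] 1) =
    uea_class G (Poly_Mapping.single [x] 1 + Poly_Mapping.single [y] 1)"
proof -
  have "Poly_Mapping.single [x \<oplus> y] 1 - Poly_Mapping.single [x] 1 - Poly_Mapping.single [y] 1 \<in> uea_rels G"
    unfolding uea_rels_def using assms by blast
  then show ?thesis unfolding uea_class_eq using uea_rels_ideal by (simp add: algebra_simps)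
qed

lemma uea_class_letter_smult:
  assumes "x \<in> carrier G"
  shows "uea_class G (Poly_Mapping.single [c \<odot> x] 1) = uea_class G (Poly_Mapping.single [x] c)"
proof -
  have "Poly_Mapping.single [c \<odot> x] 1 - Poly_Mapping.single [x] c \<in> uea_rels G"
    unfolding uea_rels_def using assms by blast
  then show ?thesis unfolding uea_class_eq by (rule uea_rels_ideal)
qed

end

context supermodule
begin

text \<open>The annihilator of the module in the free algebra is an ideal, and it contains the
  defining relations because they mirror the axioms of the action. This makes \<open>uea_act\<close>
  well defined on cosets.\<close>

lemma word_act_ideal:
  assumes "p \<in> uea_ideal G" "v \<in> carrier M"
  shows "word_act M p v = \<zero>\<^bsub>M\<^esub>"
proof -
  let ?J = "{p \<in> carrier G.FA. \<forall>v\<in>carrier M. word_act M p v = \<zero>\<^bsub>M\<^esub>}"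
  have J: "ideal ?J G.FA"
  proof (rule free_algebra_idealI)
    fix p q :: "'g list \<Rightarrow>\<^sub>0 complex" assume p: "p \<in> ?J" and q: "Poly_Mapping.keys q \<subseteq> lists (carrier G)"
    show "q * p \<in> ?J" "p * q \<in> ?J"
      using p q by (auto simp: word_act_mult word_act_zero_right word_act_closed
        dest: subsetD[OF keys_mult_lists])
  qed (auto simp: word_act_add word_act_minus keys_add_subset)
  have cancel: "a \<oplus>\<^bsub>M\<^esub> b \<ominus>\<^bsub>M\<^esub> a \<ominus>\<^bsub>M\<^esub> b = \<zero>\<^bsub>M\<^esub>"
    if "a \<in> carrier M" "b \<in> carrier M" for a b
  proof -
    have "a \<oplus>\<^bsub>M\<^esub> b \<ominus>\<^bsub>M\<^esub> a \<ominus>\<^bsub>M\<^esub> b = (a \<oplus>\<^bsub>M\<^esub> \<ominus>\<^bsub>M\<^esub> a) \<oplus>\<^bsub>M\<^esub> (b \<oplus>\<^bsub>M\<^esub> \<ominus>\<^bsub>M\<^esub> b)"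
      using that unfolding a_minus_def by (simp only: M.a_ac M.a_closed M.a_inv_closed)
    then show ?thesis using that by (simp add: M.r_neg)
  qed
  have "uea_rels G \<subseteq> ?J"
  proof
    fix r assume r: "r \<in> uea_rels G"
    then have rc: "r \<in> carrier G.FA" using G.uea_rels_carrier by auto
    have "word_act M r v = \<zero>\<^bsub>M\<^esub>" if v: "v \<in> carrier M" for v
      using r unfolding uea_rels_def
    proof (elim UnE CollectE exE conjE)
      fix x y assume "r = Poly_Mapping.single [x \<oplus>\<^bsub>G\<^esub> y] 1 - Poly_Mapping.single [x] 1 - Poly_Mapping.single [y] 1"
        "x \<in> carrier G" "y \<in> carrier G"
      then show ?thesis
        using v by (simp add: word_act_diff word_act_single act_closed act_add_left keys_diff_subset cancel)
    next
      fix c x assume "r = Poly_Mapping.single [c \<odot>\<^bsub>G\<^esub> x] 1 - Poly_Mapping.single [x] c" "x \<in> carrier G"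
      then show ?thesis
        using v by (simp add: word_act_diff word_act_single act_closed act_smult_left M.r_neg a_minus_def)
    next
      fix x y i j
      assume r: "r = Poly_Mapping.single [x, y] 1 - Poly_Mapping.single [y, x] (ksign i j) - Poly_Mapping.single [bracket G x y] 1"
        and xy: "x \<in> hpart G i" "y \<in> hpart G j"
      have c: "x \<in> carrier G" "y \<in> carrier G" "bracket G x y \<in> carrier G"
        using xy G.hpart_carrier G.bracket_hpart by blast+
      have "word_act M r v = act M x (act M y v) \<ominus>\<^bsub>M\<^esub> ksign i j \<odot>\<^bsub>M\<^esub> act M y (act M x v) \<ominus>\<^bsub>M\<^esub> act M (bracket G x y) v"
        unfolding r using c v
        by (subst word_act_diff, simp add: keys_diff_subset, simp, simp, subst word_act_diff)
          (simp_all add: word_act_single act_closed)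
      also have "\<dots> = \<zero>\<^bsub>M\<^esub>"
        using c v by (subst act_bracket[OF xy v]) (simp add: act_closed a_minus_def M.r_neg)
      finally show ?thesis .
    qed
    then show "r \<in> ?J" using rc by simp
  qed
  with J have "uea_ideal G \<subseteq> ?J" by (rule G.uea_ideal_minimal)
  then show ?thesis using assms by auto
qed

lemma uea_act_class:
  assumes "p \<in> carrier G.FA" "v \<in> carrier M"
  shows "uea_act M (uea_class G p) v = word_act M p v"
proof -
  have "word_act M (h + p) v = word_act M p v" if "h \<in> uea_ideal G" for h
    using that G.uea_ideal_closed(1) assms
    by (subst word_act_add) (auto simp: word_act_ideal word_act_closed)
  then have "(\<lambda>q. word_act M q v) ` uea_class G p = {word_act M p v}"
    using G.uea_class_self[of p] by (force simp: G.uea_class_alt)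
  then show ?thesis by (simp add: uea_act_def)
qed

end

section \<open>The induced module\<close>

lemma OR_simps [simp]:
  "carrier OR = UNIV" "zero OR = 0" "add OR = (+)" "module.smult OR = pscale" "bracket OR = or_bracket"
  "hpart OR i = {x. Poly_Mapping.keys x \<subseteq> {b. or_degree b = i}}"
  by (simp_all add: OR_def)

lemma T_simps [simp]:
  "carrier (T d) = {x. Poly_Mapping.keys x \<subseteq> T_basis d}" "zero (T d) = 0" "add (T d) = (+)"
  "module.smult (T d) = pscale" "bracket (T d) = or_bracket"
  "hpart (T d) i = {x. Poly_Mapping.keys x \<subseteq> {b. or_degree b = i}} \<inter> {x. Poly_Mapping.keys x \<subseteq> T_basis d}"
  by (simp_all add: T_def T_space_def)

interpretation OR: lie_superalgebra OR by (rule OR_lie_superalgebra)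

text \<open>A relation of \<open>T d\<close> is a relation of \<open>OR\<close>, and
  \<open>uea_ideal OR\<close> cuts out an ideal in the smaller free algebra. The inclusion makes
  \<open>uea_incl\<close> well defined on cosets.\<close>

lemma uea_ideal_T_subset: "uea_ideal (T d) \<subseteq> uea_ideal OR"
proof -
  interpret T: lie_superalgebra "T d" by (rule T_lie_superalgebra)
  have "ideal (uea_ideal OR \<inter> carrier T.FA) T.FA"
    by (rule free_algebra_idealI)
      (use OR.uea_ideal_closed in \<open>auto simp: keys_add_subset keys_mult_lists\<close>)
  moreover have "uea_rels (T d) \<subseteq> uea_ideal OR \<inter> carrier T.FA"
  proof -
    have "uea_rels (T d) \<subseteq> uea_rels OR"
      unfolding uea_rels_def by (intro Un_mono) (simp; blast)+
    then show ?thesis using OR.uea_rels_ideal T.uea_rels_carrier by blast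
  qed
  ultimately show ?thesis using T.uea_ideal_minimal by blast
qed

abbreviation cls where "cls \<equiv> uea_class OR"

lemma OR_uea_carrier: "carrier (uea OR) = range cls"
  by (simp add: OR.uea_carrier)

lemma OR_uea_mult: "cls p \<otimes>\<^bsub>uea OR\<^esub> cls q = cls (p * q)"
  by (rule OR.uea_mult) simp_all

lemma uea_incl_class:
  assumes "p \<in> carrier (free_algebra (carrier (T d)))"
  shows "uea_incl (T d) OR (uea_class (T d) p) = cls p"
proof -
  interpret T: lie_superalgebra "T d" by (rule T_lie_superalgebra)
  have "cls (h + p) = cls p" if "h \<in> uea_ideal (T d)" for h
    using that uea_ideal_T_subset by (auto simp: OR.uea_class_eq)
  then have "cls ` uea_class (T d) p = {cls p}"
    using T.uea_class_self[of p] by (force simp: T.uea_class_alt)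
  then show ?thesis by (simp add: uea_incl_def)
qed

lemma single_Nil_mult: "Poly_Mapping.single [] c * (p :: 'a list \<Rightarrow>\<^sub>0 complex) = pscale c p"
  by (induction p rule: free_space_induct[OF subset_UNIV])
    (simp_all add: mult_single plus_list_def pscale_simps distrib_left)

definition restr :: "('g, 'v, 'n) supermodule_scheme \<Rightarrow> 'v set \<Rightarrow> ('g, 'v, 'n) supermodule_scheme" where
  "restr P Y = P\<lparr>carrier := Y, hpart := \<lambda>i. hpart P i \<inter> Y\<rparr>"

lemma restr_simps [simp]:
  "carrier (restr P Y) = Y" "zero (restr P Y) = zero P" "add (restr P Y) = add P"
  "module.smult (restr P Y) = module.smult P" "act (restr P Y) = act P" "hpart (restr P Y) i = hpart P i \<inter> Y"
  by (simp_all add: restr_def)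

definition pm_sum :: "('k \<Rightarrow> complex \<Rightarrow> 'a::ab_group_add) \<Rightarrow> ('k \<Rightarrow>\<^sub>0 complex) \<Rightarrow> 'a" where
  "pm_sum F f = (\<Sum>k\<in>Poly_Mapping.keys f. F k (Poly_Mapping.lookup f k))"

lemma pm_sum_superset:
  assumes "finite A" "Poly_Mapping.keys f \<subseteq> A" "\<And>k. F k 0 = 0"
  shows "pm_sum F f = (\<Sum>k\<in>A. F k (Poly_Mapping.lookup f k))"
  unfolding pm_sum_def by (rule sum.mono_neutral_left) (use assms in \<open>auto simp: in_keys_iff\<close>)

lemma pm_sum_add:
  assumes "\<And>k. F k 0 = 0" "\<And>k a b. F k (a + b) = F k a + F k b"
  shows "pm_sum F (f + g) = pm_sum F f + pm_sum F g"
  using Poly_Mapping.keys_add[of f g]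
  by (subst (1 2 3) pm_sum_superset[of "Poly_Mapping.keys f \<union> Poly_Mapping.keys g"])
    (auto simp: assms lookup_add sum.distrib)

lemma pm_sum_single: "(\<And>k. F k 0 = 0) \<Longrightarrow> pm_sum F (Poly_Mapping.single k c) = F k c"
  by (subst pm_sum_superset[of "{k}"]) auto

interpretation pm: vector_space "pscale :: complex \<Rightarrow> ('k \<Rightarrow>\<^sub>0 complex) \<Rightarrow> _"
  by (rule vector_space.intro; rule pscale_simps)

text \<open>A basis of \<open>N\<close> is extended to one of \<open>A\<close>; the map kills the
  first part and fixes the rest. Its values represent the quotient of \<open>A\<close> by
  \<open>N\<close> inside \<open>A\<close>.\<close>

lemma (in vector_space) projection_exists:
  assumes "subspace N" "subspace A" "N \<subseteq> A"
  shows "\<exists>\<pi>. (\<forall>x y. \<pi> (x + y) = \<pi> x + \<pi> y) \<and> (\<forall>c x. \<pi> (scale c x) = scale c (\<pi> x)) \<and>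
    (\<forall>x. \<pi> x \<in> A) \<and> (\<forall>x\<in>A. x - \<pi> x \<in> N) \<and> (\<forall>x\<in>N. \<pi> x = 0)"
proof -
  interpret pair: vector_space_pair scale scale by unfold_locales
  obtain B where B: "B \<subseteq> N" "independent B" "N \<subseteq> span B" "card B = dim N"
    by (rule basis_exists)
  obtain B' where B': "B \<subseteq> B'" "B' \<subseteq> A" "independent B'" "A \<subseteq> span B'"
    by (rule maximal_independent_subset_extend[of B A]) (use B assms(3) in auto)
  let ?g = "\<lambda>b. if b \<in> B then 0 else b"
  let ?p = "pair.construct B' ?g"
  have lin: "Vector_Spaces.linear scale scale ?p" by (rule pair.linear_construct[OF B'(3)])
  interpret p: Vector_Spaces.linear scale scale ?p by (rule lin)
  have pb: "?p b = ?g b" if "b \<in> B'" for b by (rule pair.construct_basis[OF B'(3) that])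
  have "?p x \<in> A" for x
  proof -
    have "?p x \<in> span (?g ` B')" by (rule pair.construct_in_span[OF B'(3)])
    moreover have "span (?g ` B') \<subseteq> A"
      by (rule span_minimal) (use B'(2) assms(2) subspace_0 in auto)
    ultimately show ?thesis by blast
  qed
  moreover have "x - ?p x \<in> N" if "x \<in> A" for x
  proof -
    have "x \<in> span B'" using that B'(4) by blast
    then show ?thesis
    proof (induction rule: span_induct_alt)
      case base
      show ?case using assms(1) subspace_0 by (simp add: p.zero)
    next
      case (step c b y)
      have "b - ?p b \<in> N" using pb[OF step(1)] B(1) subspace_0[OF assms(1)] by auto
      then have "scale c (b - ?p b) + (y - ?p y) \<in> N"
        using step assms(1) by (intro subspace_add subspace_scale)
      then show ?case by (simp add: p.add p.scale algebra_simps)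
    qed
  qed
  moreover have "?p x = 0" if "x \<in> N" for x
  proof -
    have "x \<in> span B" using that B(3) by blast
    then show ?thesis
    proof (induction rule: span_induct_alt)
      case (step c b y)
      then have "?p b = 0" using pb[of b] B'(1) by auto
      with step show ?case by (simp add: p.add p.scale)
    qed (simp add: p.zero)
  qed
  ultimately show ?thesis by (intro exI[of _ ?p]) (simp add: p.add p.scale)
qed

text \<open>The ambient module \<open>P\<close> is kept because it receives the evaluation map,
  which shows that the tensor product does not collapse.\<close>

locale induced = supermodule OR P
  for P :: "(or_space, 'p) supermodule" +
  fixes d :: nat and Y :: "'p set"
  assumes V_supermodule: "supermodule (T d) (restr P Y)" and Y_carrier: "Y \<subseteq> carrier P"
begin

abbreviation V where "V \<equiv> restr P Y"
abbreviation null where "null \<equiv> tensor_null OR (T d) V"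

definition A :: "(or_space, 'p) pretensor set" where
  "A = {f. Poly_Mapping.keys f \<subseteq> range cls \<times> Y}"

sublocale V: supermodule "T d" V by (rule V_supermodule)

lemma Y_closed: "v \<in> Y \<Longrightarrow> w \<in> Y \<Longrightarrow> v \<oplus>\<^bsub>P\<^esub> w \<in> Y" "v \<in> Y \<Longrightarrow> c \<odot>\<^bsub>P\<^esub> v \<in> Y" "\<zero>\<^bsub>P\<^esub> \<in> Y"
    "v \<in> Y \<Longrightarrow> Poly_Mapping.keys x \<subseteq> T_basis d \<Longrightarrow> act P x v \<in> Y"
  using V.M.a_closed[of v w] V.M.smult_mem[of v c] V.M.zero_closed V.act_closed[of x v] by simp_all

lemma word_act_V: 
  assumes "p \<in> carrier (free_algebra (carrier (T d)))" "v \<in> Y"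
  shows "word_act V p v = word_act P p v"
proof -
  have vP: "v \<in> carrier P" using assms Y_carrier by auto
  from assms(1) have p: "Poly_Mapping.keys p \<subseteq> lists (carrier (T d))" by simp
  then have "Poly_Mapping.keys p \<subseteq> lists (carrier (T d)) \<and> word_act V p v = word_act P p v"
  proof (induction p rule: free_space_induct)
    case (single xs c)
    then have "set xs \<subseteq> carrier (T d)" by auto
    then show ?case using single vP assms(2) by (subst V.word_act_single) (auto simp: word_act_single)
  next
    case (add p q)
    then have "word_act V (p + q) v = word_act V p v \<oplus>\<^bsub>V\<^esub> word_act V q v"
      using assms(2) by (intro V.word_act_add) simp_all
    with add vP show ?case by (simp add: word_act_add keys_add_subset)
  qed simp
  then show ?thesis by simp
qed

lemma space_simps: "carrier (pretensor_space OR V) = A" "zero (pretensor_space OR V) = 0"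
  "add (pretensor_space OR V) = (+)" "module.smult (pretensor_space OR V) = pscale"
  by (simp_all add: pretensor_space_def free_space_def OR_uea_carrier A_def)

lemma A_subspace: "pm.subspace A"
  by (rule pm.subspaceI) (auto simp: A_def keys_add_subset keys_pscale_subset)

lemma single_A [simp]: "v \<in> Y \<Longrightarrow> Poly_Mapping.single (cls p, v) c \<in> A"
  by (auto simp: A_def)

lemma space_module: "module CC (pretensor_space OR V)"
proof (rule moduleI)
  show "cring CC" by (rule cring_from_type_algebra)
  show "abelian_group (pretensor_space OR V)"
  proof (rule abelian_groupI)
    fix x assume "x \<in> carrier (pretensor_space OR V)"
    then show "\<exists>y\<in>carrier (pretensor_space OR V). y \<oplus>\<^bsub>pretensor_space OR V\<^esub> x = \<zero>\<^bsub>pretensor_space OR V\<^esub>"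
      by (intro bexI[of _ "- x"]) (auto simp: space_simps pm.subspace_neg[OF A_subspace])
  qed (auto simp: space_simps add_ac pm.subspace_add[OF A_subspace] pm.subspace_0[OF A_subspace])
qed (auto simp: space_simps pscale_simps pm.subspace_scale[OF A_subspace])

lemma submodule_iff: "submodule N CC (pretensor_space OR V) \<longleftrightarrow> pm.subspace N \<and> N \<subseteq> A"
proof -
  interpret S: cmodule "pretensor_space OR V" unfolding cmodule_def by (rule space_module)
  show ?thesis
    using S.submoduleI'[of N] S.submodule_closed[of N] by (auto simp: space_simps pm.subspace_def)
qed

lemma null_subspace: "pm.subspace null" and null_A: "null \<subseteq> A" and null_rels: "tensor_rels OR (T d) V \<subseteq> null"
proof -
  have in_A: "Poly_Mapping.single (Q, v) c \<in> A" if "Q \<in> range cls" "v \<in> Y" for Q v c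
    using that by (auto simp: A_def)
  have "tensor_rels OR (T d) V \<subseteq> A"
  proof -
    have "uea_incl (T d) OR R \<in> range cls \<and> uea_act V R v \<in> Y"
      if R: "R \<in> carrier (uea (T d))" and v: "v \<in> Y" for R v
    proof -
      obtain p where p: "R = uea_class (T d) p" "p \<in> carrier (free_algebra (carrier (T d)))"
        using R V.G.uea_carrier by auto
      then show ?thesis
        using V.word_act_closed[of p v] V.uea_act_class[of p v] uea_incl_class[of p d] v by simp
    qed
    moreover have "Q \<otimes>\<^bsub>uea OR\<^esub> R \<in> range cls \<and> Q \<oplus>\<^bsub>uea OR\<^esub> R \<in> range cls" if "Q \<in> range cls" "R \<in> range cls" for Q R
      using that OR_uea_mult OR.uea_add by auto
    ultimately show ?thesis
      unfolding tensor_rels_def OR_uea_carrier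
      by (intro Un_least subsetI; elim CollectE exE conjE)
        (auto simp: Y_closed intro!: pm.subspace_diff[OF A_subspace] in_A)
  qed
  then have "submodule A CC (pretensor_space OR V) \<and> tensor_rels OR (T d) V \<subseteq> A"
    by (simp add: submodule_iff A_subspace)
  then show "null \<subseteq> A" unfolding tensor_null_def by blast
  show "pm.subspace null"
    unfolding tensor_null_def submodule_iff by (auto simp: pm.subspace_def)
  show "tensor_rels OR (T d) V \<subseteq> null"
    unfolding tensor_null_def by blast
qed

lemmas null_add = pm.subspace_add[OF null_subspace] and null_diff = pm.subspace_diff[OF null_subspace]
  and null_scale = pm.subspace_scale[OF null_subspace] and null_0 = pm.subspace_0[OF null_subspace]

lemma null_tensor:
  assumes "v \<in> Y"
  shows "Poly_Mapping.single (cls (p + q), v) 1 - Poly_Mapping.single (cls p, v) 1 - Poly_Mapping.single (cls q, v) 1 \<in> null"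
    and "w \<in> Y \<Longrightarrow> Poly_Mapping.single (cls p, v \<oplus>\<^bsub>P\<^esub> w) 1 - Poly_Mapping.single (cls p, v) 1 - Poly_Mapping.single (cls p, w) 1 \<in> null"
    and "Poly_Mapping.single (cls (pscale c p), v) 1 - Poly_Mapping.single (cls p, v) c \<in> null"
    and "Poly_Mapping.single (cls p, c \<odot>\<^bsub>P\<^esub> v) 1 - Poly_Mapping.single (cls p, v) c \<in> null"
    and "r \<in> carrier (free_algebra (carrier (T d))) \<Longrightarrow>
      Poly_Mapping.single (cls (p * r), v) 1 - Poly_Mapping.single (cls p, word_act P r v) 1 \<in> null"
proof -
  have c: "cls p \<in> carrier (uea OR)" for p by (simp add: OR_uea_carrier)
  have tr1: "Poly_Mapping.single (Q \<oplus>\<^bsub>uea OR\<^esub> R, v) 1 - Poly_Mapping.single (Q, v) 1 - Poly_Mapping.single (R, v) 1 \<in> null"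
    if "Q \<in> carrier (uea OR)" "R \<in> carrier (uea OR)" "v \<in> carrier V" for Q R v
    using that null_rels unfolding tensor_rels_def Un_subset_iff by blast
  have tr2: "Poly_Mapping.single (Q, v \<oplus>\<^bsub>V\<^esub> w) 1 - Poly_Mapping.single (Q, v) 1 - Poly_Mapping.single (Q, w) 1 \<in> null"
    if "Q \<in> carrier (uea OR)" "v \<in> carrier V" "w \<in> carrier V" for Q v w
    using that null_rels unfolding tensor_rels_def Un_subset_iff by blast
  have tr3: "Poly_Mapping.single (cls (Poly_Mapping.single [] c) \<otimes>\<^bsub>uea OR\<^esub> Q, v) 1 - Poly_Mapping.single (Q, v) c \<in> null"
    if "Q \<in> carrier (uea OR)" "v \<in> carrier V" for c Q v
    using that null_rels unfolding tensor_rels_def Un_subset_iff by blast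
  have tr4: "Poly_Mapping.single (Q, c \<odot>\<^bsub>V\<^esub> v) 1 - Poly_Mapping.single (Q, v) c \<in> null"
    if "Q \<in> carrier (uea OR)" "v \<in> carrier V" for c Q v
    using that null_rels unfolding tensor_rels_def Un_subset_iff by blast
  have tr5: "Poly_Mapping.single (Q \<otimes>\<^bsub>uea OR\<^esub> uea_incl (T d) OR R, v) 1 - Poly_Mapping.single (Q, uea_act V R v) 1 \<in> null"
    if "Q \<in> carrier (uea OR)" "R \<in> carrier (uea (T d))" "v \<in> carrier V" for Q R v
    using that null_rels unfolding tensor_rels_def Un_subset_iff by blast
  show "Poly_Mapping.single (cls (p + q), v) 1 - Poly_Mapping.single (cls p, v) 1 - Poly_Mapping.single (cls q, v) 1 \<in> null"
    unfolding OR.uea_add[symmetric] using assms c tr1 by simp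
  show "w \<in> Y \<Longrightarrow> Poly_Mapping.single (cls p, v \<oplus>\<^bsub>P\<^esub> w) 1 - Poly_Mapping.single (cls p, v) 1 - Poly_Mapping.single (cls p, w) 1 \<in> null"
    using assms c[of p] tr2 by simp
  have "cls (pscale c p) = cls (Poly_Mapping.single [] c) \<otimes>\<^bsub>uea OR\<^esub> cls p"
    by (simp add: OR_uea_mult single_Nil_mult)
  then show "Poly_Mapping.single (cls (pscale c p), v) 1 - Poly_Mapping.single (cls p, v) c \<in> null"
    using assms c[of p] tr3 by simp
  show "Poly_Mapping.single (cls p, c \<odot>\<^bsub>P\<^esub> v) 1 - Poly_Mapping.single (cls p, v) c \<in> null"
    using assms c[of p] tr4 by simp
  show "Poly_Mapping.single (cls (p * r), v) 1 - Poly_Mapping.single (cls p, word_act P r v) 1 \<in> null"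
    if r: "r \<in> carrier (free_algebra (carrier (T d)))"
  proof -
    have "cls (p * r) = cls p \<otimes>\<^bsub>uea OR\<^esub> uea_incl (T d) OR (uea_class (T d) r)"
      using r by (simp only: OR_uea_mult uea_incl_class)
    moreover have "word_act P r v = uea_act V (uea_class (T d) r) v"
      using r assms V.uea_act_class[of r v] word_act_V[of r v] by simp
    moreover have "uea_class (T d) r \<in> carrier (uea (T d))"
      using r V.G.uea_carrier by blast
    ultimately show ?thesis
      using assms c[of p] tr5[of "cls p" "uea_class (T d) r" v] by simp
  qed
qed

text \<open>Applied with \<open>N\<close> the kernel of a map, or a preimage of \<open>null\<close>,
  to let that map pass to the tensor product.\<close>

lemma null_minimal:
  assumes N: "pm.subspace N"
    and "\<And>p q v. v \<in> Y \<Longrightarrow> Poly_Mapping.single (cls (p + q), v) 1 - Poly_Mapping.single (cls p, v) 1 - Poly_Mapping.single (cls q, v) 1 \<in> N"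
    and "\<And>p v w. v \<in> Y \<Longrightarrow> w \<in> Y \<Longrightarrow> Poly_Mapping.single (cls p, v \<oplus>\<^bsub>P\<^esub> w) 1 - Poly_Mapping.single (cls p, v) 1 - Poly_Mapping.single (cls p, w) 1 \<in> N"
    and "\<And>c p v. v \<in> Y \<Longrightarrow> Poly_Mapping.single (cls (pscale c p), v) 1 - Poly_Mapping.single (cls p, v) c \<in> N"
    and "\<And>c p v. v \<in> Y \<Longrightarrow> Poly_Mapping.single (cls p, c \<odot>\<^bsub>P\<^esub> v) 1 - Poly_Mapping.single (cls p, v) c \<in> N"
    and "\<And>p r v. v \<in> Y \<Longrightarrow> r \<in> carrier (free_algebra (carrier (T d))) \<Longrightarrow>
      Poly_Mapping.single (cls (p * r), v) 1 - Poly_Mapping.single (cls p, word_act P r v) 1 \<in> N"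
  shows "null \<subseteq> N"
proof -
  have "tensor_rels OR (T d) V \<subseteq> N"
  proof
    fix r assume "r \<in> tensor_rels OR (T d) V"
    then show "r \<in> N"
      unfolding tensor_rels_def
    proof (elim UnE CollectE exE conjE, goal_cases)
      case (1 Q R v)
      then show ?case using assms(2) by (auto simp: OR_uea_carrier OR.uea_add)
    next
      case (2 Q v w)
      then show ?case using assms(3) by (auto simp: OR_uea_carrier)
    next
      case (3 c Q v)
      then show ?case using assms(4) by (auto simp: OR_uea_carrier OR_uea_mult single_Nil_mult)
    next
      case (4 c Q v)
      then show ?case using assms(5) by (auto simp: OR_uea_carrier)
    next
      case (5 Q R v)
      then obtain p q where p: "Q = cls p" and q: "R = uea_class (T d) q" "q \<in> carrier (free_algebra (carrier (T d)))"
        by (auto simp: OR_uea_carrier V.G.uea_carrier)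
      have "uea_act V R v = word_act P q v"
        using q V.uea_act_class[of q v] word_act_V[of q v] 5 by simp
      then show ?case using assms(6)[of v q p] 5 p q by (simp add: OR_uea_mult uea_incl_class)
    qed
  qed
  then have "submodule (N \<inter> A) CC (pretensor_space OR V) \<and> tensor_rels OR (T d) V \<subseteq> N \<inter> A"
    using N A_subspace null_rels null_A by (auto simp: submodule_iff pm.subspace_inter)
  then show ?thesis unfolding tensor_null_def by blast
qed

end

lemma pscale_mult: "pscale c p * q = pscale c (p * q)" for p :: "'k list \<Rightarrow>\<^sub>0 complex"
  by (simp add: mult.assoc flip: single_Nil_mult)

lemma mult_pscale: "p * pscale c q = pscale c (p * q)" for p :: "'k list \<Rightarrow>\<^sub>0 complex"
proof (induction p rule: free_space_induct[OF subset_UNIV])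
  case (1 xs a)
  show ?case
    by (induction q rule: free_space_induct[OF subset_UNIV])
      (simp_all add: mult_single pscale_simps distrib_left mult_ac)
qed (simp_all add: distrib_right pscale_simps)

section \<open>Left multiplication on the tensor product\<close>

context induced
begin

definition lmul :: "(or_space list \<Rightarrow>\<^sub>0 complex) \<Rightarrow> (or_space, 'p) pretensor \<Rightarrow> (or_space, 'p) pretensor" where
  "lmul p = pm_sum (\<lambda>(Q, v). Poly_Mapping.single (cls p \<otimes>\<^bsub>uea OR\<^esub> Q, v))"

lemma left_mult_lmul: "left_mult OR x = lmul (Poly_Mapping.single [x] 1)"
  by (rule ext) (simp add: left_mult_def lmul_def pm_sum_def case_prod_unfold)

lemma lmul_add: "lmul p (f + g) = lmul p f + lmul p g"
  unfolding lmul_def by (rule pm_sum_add) (auto simp: single_add)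

lemma lmul_single [simp]: "lmul p (Poly_Mapping.single (cls q, v) c) = Poly_Mapping.single (cls (p * q), v) c"
  unfolding lmul_def by (subst pm_sum_single) (auto simp: OR_uea_mult)

lemma lmul_0 [simp]: "lmul p 0 = 0"
  by (simp add: lmul_def pm_sum_def)

lemma lmul_minus: "lmul p (- f) = - lmul p f"
  using lmul_add[of p f "- f"] by (simp add: add_eq_0_iff)

lemma lmul_diff: "lmul p (f - g) = lmul p f - lmul p g"
  using lmul_add[of p f "- g"] by (simp add: lmul_minus)

lemma lmul_class: "cls p = cls q \<Longrightarrow> lmul p = lmul q"
  by (simp add: lmul_def)

lemma A_induct [consumes 1, case_names single add zero]:
  assumes "f \<in> A" "\<And>p v c. v \<in> Y \<Longrightarrow> Q (Poly_Mapping.single (cls p, v) c)"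
    "\<And>f g. Q f \<Longrightarrow> Q g \<Longrightarrow> Q (f + g)" "Q 0"
  shows "Q f"
  by (rule free_space_induct[OF assms(1)[unfolded A_def, THEN CollectD]]) (use assms in auto)

lemmas A_add = pm.subspace_add[OF A_subspace] and A_scale = pm.subspace_scale[OF A_subspace]
  and A_0 = pm.subspace_0[OF A_subspace] and A_diff = pm.subspace_diff[OF A_subspace]

lemma lmul_A: "f \<in> A \<Longrightarrow> lmul p f \<in> A"
  by (induction rule: A_induct) (auto simp: lmul_add A_add A_0)

lemma lmul_pscale: "f \<in> A \<Longrightarrow> lmul p (pscale c f) = pscale c (lmul p f)"
  by (induction rule: A_induct) (simp_all add: lmul_add pscale_simps)

lemma lmul_lmul: "f \<in> A \<Longrightarrow> lmul p (lmul q f) = lmul (p * q) f"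
  by (induction rule: A_induct) (simp_all add: lmul_add mult.assoc)

text \<open>Left multiplication is linear in the left factor and commutes with the right
  multiplication by elements of U(T_d) in the balancing relations.\<close>

lemma lmul_null: "f \<in> null \<Longrightarrow> lmul p f \<in> null"
proof -
  have "null \<subseteq> {f \<in> A. lmul p f \<in> null}"
  proof (rule null_minimal)
    show "pm.subspace {f \<in> A. lmul p f \<in> null}"
      by (rule pm.subspaceI) (auto simp: lmul_add lmul_pscale A_add A_scale A_0 null_add null_scale null_0)
  next
    fix q r v assume v: "v \<in> Y"
    show "Poly_Mapping.single (cls (q + r), v) 1 - Poly_Mapping.single (cls q, v) 1 - Poly_Mapping.single (cls r, v) 1 \<in> {f \<in> A. lmul p f \<in> null}"
      using v null_tensor(1)[of v "p * q" "p * r"] by (auto intro!: A_diff simp: lmul_diff distrib_left)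
  next
    fix q v w assume "v \<in> Y" "w \<in> Y"
    then show "Poly_Mapping.single (cls q, v \<oplus>\<^bsub>P\<^esub> w) 1 - Poly_Mapping.single (cls q, v) 1 - Poly_Mapping.single (cls q, w) 1 \<in> {f \<in> A. lmul p f \<in> null}"
      using null_tensor(2)[of v w "p * q"] by (auto intro!: A_diff simp: lmul_diff Y_closed)
  next
    fix c q v assume v: "v \<in> Y"
    show "Poly_Mapping.single (cls (pscale c q), v) 1 - Poly_Mapping.single (cls q, v) c \<in> {f \<in> A. lmul p f \<in> null}"
      using v null_tensor(3)[of v c "p * q"] by (auto intro!: A_diff simp: lmul_diff mult_pscale)
  next
    fix c q v assume v: "v \<in> Y"
    then show "Poly_Mapping.single (cls q, c \<odot>\<^bsub>P\<^esub> v) 1 - Poly_Mapping.single (cls q, v) c \<in> {f \<in> A. lmul p f \<in> null}"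
      using null_tensor(4)[of v "p * q" c] by (auto intro!: A_diff simp: lmul_diff Y_closed)
  next
    fix q r v assume v: "v \<in> Y" and r: "r \<in> carrier (free_algebra (carrier (T d)))"
    have "word_act P r v \<in> Y"
      using V.word_act_closed[of r v] word_act_V[of r v] r v by simp
    then show "Poly_Mapping.single (cls (q * r), v) 1 - Poly_Mapping.single (cls q, word_act P r v) 1 \<in> {f \<in> A. lmul p f \<in> null}"
      using v r null_tensor(5)[of v r "p * q"] by (auto intro!: A_diff simp: lmul_diff mult.assoc)
  qed
  then show "f \<in> null \<Longrightarrow> lmul p f \<in> null" by auto
qed

text \<open>This holds only modulo \<open>null\<close>: as formal symbols, the pairs for
  \<open>p + q\<close>, \<open>p\<close> and \<open>q\<close> are unrelated.\<close>

lemma lmul_add_left: "f \<in> A \<Longrightarrow> lmul (p + q) f - lmul p f - lmul q f \<in> null"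
proof (induction rule: A_induct)
  case (single r v c)
  have "pscale c (Poly_Mapping.single (cls (p * r + q * r), v) 1 - Poly_Mapping.single (cls (p * r), v) 1
      - Poly_Mapping.single (cls (q * r), v) 1) \<in> null"
    by (rule null_scale[OF null_tensor(1)[OF single]])
  then show ?case by (simp add: pscale_simps distrib_right)
next
  case (add f g)
  from null_add[OF this] show ?case by (simp add: lmul_add algebra_simps)
qed (simp add: null_0)

lemma lmul_pscale_left: "f \<in> A \<Longrightarrow> lmul (pscale a p) f - pscale a (lmul p f) \<in> null"
proof (induction rule: A_induct)
  case (single r v c)
  have "pscale c (Poly_Mapping.single (cls (pscale a (p * r)), v) 1 - Poly_Mapping.single (cls (p * r), v) a) \<in> null"
    by (rule null_scale[OF null_tensor(3)[OF single]])
  then show ?case by (simp add: pscale_simps pscale_mult mult.commute)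
next
  case (add f g)
  from null_add[OF this] show ?case by (simp add: lmul_add pscale_simps algebra_simps)
qed (simp add: null_0 pscale_simps)

definition bs :: "or_basis \<Rightarrow> (or_space list \<Rightarrow>\<^sub>0 complex)" where
  "bs b = Poly_Mapping.single [Poly_Mapping.single b 1] 1"

text \<open>A letter may be any element of the algebra. The linear relations of
  \<open>uea_rels\<close> and of the tensor product reduce it to basis letters.\<close>

lemma lmul_letter:
  assumes f: "f \<in> A"
  shows "lmul (Poly_Mapping.single [x] 1) f - pm_sum (\<lambda>k c. pscale c (lmul (bs k) f)) x \<in> null"
proof (induction x rule: free_space_induct[OF subset_UNIV])
  case (1 b c)
  have "cls (Poly_Mapping.single [Poly_Mapping.single b c] 1) = cls (pscale c (bs b))"
    using OR.uea_class_letter_smult[of "Poly_Mapping.single b 1" c] by (simp add: bs_def pscale_simps)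
  from lmul_class[OF this] show ?case
    using lmul_pscale_left[OF f] by (simp add: pm_sum_single pscale_simps)
next
  case (2 x y)
  have "cls (Poly_Mapping.single [x + y] 1) = cls (Poly_Mapping.single [x] 1 + Poly_Mapping.single [y] 1)"
    using OR.uea_class_letter_add[of x y] by simp
  note * = lmul_class[OF this]
  show ?case
    using null_add[OF lmul_add_left[OF f, of "Poly_Mapping.single [x] 1" "Poly_Mapping.single [y] 1"] null_add[OF 2]]
    by (simp add: * pm_sum_add pscale_simps algebra_simps)
next
  case 3
  \<comment> \<open>The letter 0 is not the zero of the free algebra; it becomes zero through the
    scaling relation with scalar 0.\<close>
  have "cls (Poly_Mapping.single [0] 1) = cls (pscale 0 0)"
    using OR.uea_class_letter_smult[of 0 0] by (simp add: pscale_simps)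
  from lmul_class[OF this] show ?case
    using lmul_pscale_left[OF f, of 0 0] by (simp add: pm_sum_def pscale_simps)
qed

text \<open>
  The image of \<open>proj\<close> is a copy of the induced module inside the type of pretensors, on which no
  carrier sets are needed.
\<close>

definition proj :: "(or_space, 'p) pretensor \<Rightarrow> (or_space, 'p) pretensor" where
  "proj = (SOME \<pi>. (\<forall>x y. \<pi> (x + y) = \<pi> x + \<pi> y) \<and> (\<forall>c x. \<pi> (pscale c x) = pscale c (\<pi> x)) \<and>
    (\<forall>x. \<pi> x \<in> A) \<and> (\<forall>x\<in>A. x - \<pi> x \<in> null) \<and> (\<forall>x\<in>null. \<pi> x = 0))"

lemma proj: "proj (f + g) = proj f + proj g" "proj (pscale c f) = pscale c (proj f)" "proj f \<in> A"
  "f \<in> A \<Longrightarrow> f - proj f \<in> null" "f \<in> null \<Longrightarrow> proj f = 0"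
  using someI_ex[OF pm.projection_exists[OF null_subspace A_subspace null_A], folded proj_def] by auto

lemma proj_diff: "proj (f - g) = proj f - proj g"
  using proj(1)[of "f - g" g] by simp

lemma proj_0 [simp]: "proj 0 = 0"
  using proj(5)[OF null_0] .

lemma proj_cong: "f - g \<in> null \<Longrightarrow> proj f = proj g"
  using proj(5)[of "f - g"] by (simp add: proj_diff)

lemma proj_proj [simp]: "proj (proj f) = proj f" if "f \<in> A"
  using proj_cong[OF proj(4)[OF that]] by simp

text \<open>The inner \<open>proj\<close> sends an arbitrary member of the type into
  \<open>A\<close>, so that the bracket relations hold on the whole type, as \<open>or_rep\<close>
  demands.\<close>

definition ac :: "or_basis \<Rightarrow> (or_space, 'p) pretensor \<Rightarrow> (or_space, 'p) pretensor" where
  "ac b f = proj (lmul (bs b) (proj f))"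

lemma ac_proj: "f \<in> A \<Longrightarrow> ac b (proj f) = proj (lmul (bs b) f)"
proof -
  assume f: "f \<in> A"
  have "(proj (proj f) - proj f) + (proj f - f) \<in> null"
    using null_add[OF null_scale[OF proj(4)[OF proj(3)[of f]], of "-1"] null_scale[OF proj(4)[OF f], of "-1"]]
    by (simp add: pscale_simps)
  then have "lmul (bs b) (proj (proj f)) - lmul (bs b) f \<in> null"
    using lmul_null[of "proj (proj f) - f" "bs b"] by (simp add: lmul_diff)
  then show ?thesis unfolding ac_def by (rule proj_cong)
qed

lemma proj_pm_sum:
  fixes g :: "'k \<Rightarrow> (or_space, 'p) pretensor"
  shows "proj (pm_sum (\<lambda>k c. pscale c (g k)) x) = pm_sum (\<lambda>k c. pscale c (proj (g k))) x"
proof -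
  have "proj (sum h B) = (\<Sum>k\<in>B. proj (h k))" for h and B :: "'k set"
    by (induction B rule: infinite_finite_induct) (simp_all add: proj)
  then show ?thesis by (simp add: pm_sum_def proj)
qed

lemma proj_letter:
  "f \<in> A \<Longrightarrow> proj (lmul (Poly_Mapping.single [x] 1) f) = pm_sum (\<lambda>k c. pscale c (ac k (proj f))) x"
  using proj_cong[OF lmul_letter[of f x]] by (simp add: proj_pm_sum ac_proj)

lemma ac_rep: "or_rep pscale ac"
proof (intro or_rep.intro pm.vector_space_axioms or_rep_axioms.intro)
  fix a b f g c
  show "ac b (f + g) = ac b f + ac b g" by (simp add: ac_def proj lmul_add)
  show "ac b (pscale c f) = pscale c (ac b f)" by (simp add: ac_def proj lmul_pscale)
  let ?k = "ksign (or_degree a) (or_degree b)" and ?g = "proj f"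
  let ?a = "Poly_Mapping.single a 1 :: or_space" and ?b = "Poly_Mapping.single b 1 :: or_space"
  let ?r = "Poly_Mapping.single [basis_bracket a b] 1"
  have 2: "ac a (ac b f) = proj (lmul (bs a * bs b) ?g)" for a b
    unfolding ac_def[of b] using ac_proj[OF lmul_A[OF proj(3)]] by (simp add: lmul_lmul[OF proj(3)])
  have acp: "ac k (proj (proj f)) = ac k f" for k
    unfolding ac_def[of k f] by (rule ac_proj[OF proj(3)])
  have "cls (Poly_Mapping.single [?a, ?b] 1) = cls (Poly_Mapping.single [?b, ?a] ?k + Poly_Mapping.single [bracket OR ?a ?b] 1)"
    by (rule OR.uea_class_bracket) (auto split: if_splits)
  then have "cls (bs a * bs b) = cls (pscale ?k (bs b * bs a) + ?r)"
    by (simp add: bs_def mult_single plus_list_def pscale_simps or_bracket_single)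
  from lmul_class[OF this]
  have "proj (lmul (bs a * bs b) ?g) = proj (lmul (pscale ?k (bs b * bs a) + ?r) ?g)"
    by (rule arg_cong)
  also have "\<dots> = proj (lmul (pscale ?k (bs b * bs a)) ?g) + proj (lmul ?r ?g)"
    using proj_cong[of "lmul (pscale ?k (bs b * bs a) + ?r) ?g" "lmul (pscale ?k (bs b * bs a)) ?g + lmul ?r ?g"]
      lmul_add_left[OF proj(3), of "pscale ?k (bs b * bs a)" ?r] by (simp add: proj diff_diff_eq)
  also have "proj (lmul (pscale ?k (bs b * bs a)) ?g) = pscale ?k (proj (lmul (bs b * bs a) ?g))"
    using proj_cong[OF lmul_pscale_left[OF proj(3)]] by (simp add: proj)
  also have "proj (lmul ?r ?g) = pm_sum (\<lambda>k c. pscale c (ac k f)) (basis_bracket a b)"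
    by (simp add: proj_letter[OF proj(3)] acp)
  finally show "ac a (ac b f) = pscale ?k (ac b (ac a f)) +
      (\<Sum>k\<in>Poly_Mapping.keys (basis_bracket a b). pscale (Poly_Mapping.lookup (basis_bracket a b) k) (ac k f))"
    by (simp add: 2 pm_sum_def)
qed

sublocale R: or_rep pscale ac by (rule ac_rep)

section \<open>The evaluation map from the tensor product to \<open>P\<close>\<close>

definition ev :: "(or_space, 'p) pretensor \<Rightarrow> 'p" where
  "ev = M.lincomb (\<lambda>(Q, v). uea_act P Q v)"

lemma word_closed [simp]: "v \<in> carrier P \<Longrightarrow> word_act P p v \<in> carrier P"
  by (rule word_act_closed) simp

lemma Y_P [simp]: "v \<in> Y \<Longrightarrow> v \<in> carrier P"
  using Y_carrier by auto

lemma act_class: "v \<in> carrier P \<Longrightarrow> uea_act P (cls p) v = word_act P p v"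
  by (rule uea_act_class) simp_all

lemma ev_fun: "f \<in> A \<Longrightarrow> (\<lambda>(Q, v). uea_act P Q v) \<in> Poly_Mapping.keys f \<rightarrow> carrier P"
  by (auto simp: A_def act_class dest!: subsetD)

lemma ev_closed: "f \<in> A \<Longrightarrow> ev f \<in> carrier P"
  unfolding ev_def by (intro M.lincomb_closed ev_fun)

lemma ev_single [simp]: "v \<in> Y \<Longrightarrow> ev (Poly_Mapping.single (cls p, v) c) = c \<odot>\<^bsub>P\<^esub> word_act P p v"
  unfolding ev_def by (subst M.lincomb_single) (simp_all add: act_class)

lemma ev_add: "f \<in> A \<Longrightarrow> g \<in> A \<Longrightarrow> ev (f + g) = ev f \<oplus>\<^bsub>P\<^esub> ev g"
  unfolding ev_def by (intro M.lincomb_add ev_fun)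

lemma ev_pscale: "f \<in> A \<Longrightarrow> ev (pscale c f) = c \<odot>\<^bsub>P\<^esub> ev f"
  unfolding ev_def by (intro M.lincomb_pscale ev_fun)

lemma ev_0 [simp]: "ev 0 = \<zero>\<^bsub>P\<^esub>"
  by (simp add: ev_def)

lemma ev_diff:
  assumes "f \<in> A" "g \<in> A"
  shows "ev (f - g) = ev f \<ominus>\<^bsub>P\<^esub> ev g"
proof -
  have "ev (f + pscale (-1) g) = ev f \<oplus>\<^bsub>P\<^esub> (-1) \<odot>\<^bsub>P\<^esub> ev g"
    using assms by (simp only: ev_add ev_pscale A_scale)
  then show ?thesis using assms by (simp add: M.smult_m1 ev_closed a_minus_def pscale_simps)
qed

lemma ev_lmul: "f \<in> A \<Longrightarrow> ev (lmul p f) = word_act P p (ev f)"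
proof -
  assume "f \<in> A"
  then have "f \<in> A \<and> ev (lmul p f) = word_act P p (ev f)"
  proof (induction rule: A_induct)
    case (single q v c)
    then show ?case using word_act_mult[of p q v] word_act_linear(2)[of p "word_act P q v" "word_act P q v" c] by simp
  next
    case (add f g)
    then show ?case using word_act_linear(1)[of p "ev f" "ev g"] by (simp add: lmul_add lmul_A A_add ev_add ev_closed)
  next
    case zero
    show ?case using word_act_zero_right[of p] by (simp add: A_0)
  qed
  then show ?thesis by simp
qed

text \<open>The tensor relations hold in \<open>P\<close> because the enveloping algebra acts on
  \<open>P\<close> and this action extends the one of U(T_d) on \<open>Y\<close>.\<close>

lemma ev_null: "f \<in> null \<Longrightarrow> ev f = \<zero>\<^bsub>P\<^esub>"
proof -
  have cancel: "a \<ominus>\<^bsub>P\<^esub> b = \<zero>\<^bsub>P\<^esub>" if "a = b" "a \<in> carrier P" for a b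
    using that by (simp add: a_minus_def M.r_neg)
  have cancel': "a \<ominus>\<^bsub>P\<^esub> b \<ominus>\<^bsub>P\<^esub> c = \<zero>\<^bsub>P\<^esub>" if "a = b \<oplus>\<^bsub>P\<^esub> c" "b \<in> carrier P" "c \<in> carrier P" for a b c
  proof -
    have "b \<oplus>\<^bsub>P\<^esub> c \<ominus>\<^bsub>P\<^esub> b \<ominus>\<^bsub>P\<^esub> c = (b \<oplus>\<^bsub>P\<^esub> \<ominus>\<^bsub>P\<^esub> b) \<oplus>\<^bsub>P\<^esub> (c \<oplus>\<^bsub>P\<^esub> \<ominus>\<^bsub>P\<^esub> c)"
      using that unfolding a_minus_def by (simp only: M.a_ac M.a_closed M.a_inv_closed)
    then show ?thesis using that by (simp add: M.r_neg)
  qed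
  have "null \<subseteq> {f \<in> A. ev f = \<zero>\<^bsub>P\<^esub>}"
  proof (rule null_minimal)
    show "pm.subspace {f \<in> A. ev f = \<zero>\<^bsub>P\<^esub>}"
      by (rule pm.subspaceI) (auto simp: ev_add ev_pscale A_add A_scale A_0)
  next
    fix p q v assume "v \<in> Y"
    then show "Poly_Mapping.single (cls (p + q), v) 1 - Poly_Mapping.single (cls p, v) 1 - Poly_Mapping.single (cls q, v) 1 \<in> {f \<in> A. ev f = \<zero>\<^bsub>P\<^esub>}"
      using word_act_add[of p q v] by (auto intro!: A_diff cancel' simp: ev_diff A_diff)
  next
    fix p v w assume "v \<in> Y" "w \<in> Y"
    then show "Poly_Mapping.single (cls p, v \<oplus>\<^bsub>P\<^esub> w) 1 - Poly_Mapping.single (cls p, v) 1 - Poly_Mapping.single (cls p, w) 1 \<in> {f \<in> A. ev f = \<zero>\<^bsub>P\<^esub>}"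
      using word_act_linear(1)[of p v w] by (auto intro!: A_diff cancel' Y_closed simp: ev_diff A_diff Y_closed)
  next
    fix c p v assume "v \<in> Y"
    then show "Poly_Mapping.single (cls (pscale c p), v) 1 - Poly_Mapping.single (cls p, v) c \<in> {f \<in> A. ev f = \<zero>\<^bsub>P\<^esub>}"
      using word_act_pscale[of p v c] by (auto intro!: A_diff cancel simp: ev_diff)
  next
    fix c p v assume "v \<in> Y"
    then show "Poly_Mapping.single (cls p, c \<odot>\<^bsub>P\<^esub> v) 1 - Poly_Mapping.single (cls p, v) c \<in> {f \<in> A. ev f = \<zero>\<^bsub>P\<^esub>}"
      using word_act_linear(2)[of p v v c] by (auto intro!: A_diff cancel Y_closed simp: ev_diff Y_closed)
  next
    fix p r v assume v: "v \<in> Y" and r: "r \<in> carrier (free_algebra (carrier (T d)))"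
    have "word_act P r v \<in> Y"
      using V.word_act_closed[of r v] word_act_V[of r v] r v by simp
    then show "Poly_Mapping.single (cls (p * r), v) 1 - Poly_Mapping.single (cls p, word_act P r v) 1 \<in> {f \<in> A. ev f = \<zero>\<^bsub>P\<^esub>}"
      using v word_act_mult[of p r v] by (auto intro!: A_diff cancel simp: ev_diff)
  qed
  then show "f \<in> null \<Longrightarrow> ev f = \<zero>\<^bsub>P\<^esub>" by auto
qed

lemma ev_proj: "f \<in> A \<Longrightarrow> ev (proj f) = ev f"
proof -
  assume f: "f \<in> A"
  have "ev (f - (f - proj f)) = ev f \<ominus>\<^bsub>P\<^esub> \<zero>\<^bsub>P\<^esub>"
    using f proj(3,4)[of f] ev_null by (subst ev_diff) (auto intro: A_diff)
  then show ?thesis using f by (simp add: ev_closed a_minus_def)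
qed

definition iota :: "'p \<Rightarrow> (or_space, 'p) pretensor" where
  "iota v = proj (Poly_Mapping.single (cls 1, v) 1)"

lemma iota_add: "v \<in> Y \<Longrightarrow> w \<in> Y \<Longrightarrow> iota (v \<oplus>\<^bsub>P\<^esub> w) = iota v + iota w"
  using proj_cong[of "Poly_Mapping.single (cls 1, v \<oplus>\<^bsub>P\<^esub> w) 1" "Poly_Mapping.single (cls 1, v) 1 + Poly_Mapping.single (cls 1, w) 1"]
    null_tensor(2)[of v w 1] by (simp add: iota_def proj diff_diff_eq)

lemma iota_scale: "v \<in> Y \<Longrightarrow> iota (c \<odot>\<^bsub>P\<^esub> v) = pscale c (iota v)"
  using proj_cong[OF null_tensor(4)[of v 1 c]] single_pscale[of "(cls 1, v)" c] by (simp add: iota_def flip: proj)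

lemma iota_0: "iota \<zero>\<^bsub>P\<^esub> = 0"
  using iota_scale[of "\<zero>\<^bsub>P\<^esub>" 0] Y_closed by (simp add: pscale_simps)

lemma word_act_bs: "v \<in> carrier P \<Longrightarrow> word_act P (bs b) v = act P (Poly_Mapping.single b 1) v"
  by (simp add: bs_def word_act_single act_closed)

text \<open>The balancing relation carries an element of T_d from the left factor over to the
  vector.\<close>

lemma ac_iota:
  assumes "v \<in> Y" "b \<in> T_basis d"
  shows "ac b (iota v) = iota (act P (Poly_Mapping.single b 1) v)"
proof -
  have "ac b (iota v) = proj (Poly_Mapping.single (cls (1 * bs b), v) 1)"
    unfolding iota_def using assms by (subst ac_proj) auto
  also have "\<dots> = proj (Poly_Mapping.single (cls 1, word_act P (bs b) v) 1)"
    by (intro proj_cong null_tensor(5)) (use assms in \<open>auto simp: bs_def split: if_splits\<close>)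
  finally show ?thesis using assms by (simp add: iota_def word_act_bs)
qed

lemma word_act_1: "v \<in> carrier P \<Longrightarrow> word_act P 1 v = v"
  using word_act_single[of "[]" v 1] by (simp add: zero_list_def flip: single_one)

lemma iota_A: "iota v \<in> A"
  by (simp add: iota_def proj)

text \<open>Hence \<open>iota\<close> is injective on \<open>Y\<close>: \<open>V\<close> embeds in
  the induced module because it already sits in \<open>P\<close>.\<close>

lemma ev_iota: "v \<in> Y \<Longrightarrow> ev (iota v) = v"
  by (simp add: iota_def ev_proj word_act_1)

lemma ev_ac: "f \<in> A \<Longrightarrow> ev (ac b f) = act P (Poly_Mapping.single b 1) (ev f)"
  by (simp add: ac_def ev_proj lmul_A proj ev_lmul ev_closed word_act_bs)

lemma stable_pm_sum:
  assumes "R.stable UNIV H" "f \<in> H"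
  shows "pm_sum (\<lambda>k c. pscale c (ac k f)) x \<in> H"
  unfolding pm_sum_def
  by (intro pm.subspace_sum[OF R.stable_subspace[OF assms(1)]] pm.subspace_scale[OF R.stable_subspace[OF assms(1)]]
      R.stableD[OF assms(1)] assms) simp

text \<open>Words are built letter by letter from the empty word, whose tensors are the values of
  \<open>iota\<close>; linearity does the rest.\<close>

lemma proj_gen: "f \<in> A \<Longrightarrow> proj f \<in> R.gen (iota ` Y)"
proof (induction rule: A_induct)
  let ?H = "R.gen (iota ` Y)"
  have H: "pm.subspace ?H" by (rule R.stable_subspace[OF R.gen_stable])
  {
    case (single p v c)
    have word: "proj (Poly_Mapping.single (cls (Poly_Mapping.single xs 1), v) 1) \<in> ?H" for xs
    proof (induction xs)
      case Nil
      have "iota v \<in> ?H" using R.gen_base[of "iota ` Y"] single by auto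
      then show ?case using single_one[where ?'a = "or_space list" and ?'b = complex]
        by (simp add: iota_def zero_list_def)
    next
      case (Cons x xs)
      have "Poly_Mapping.single (cls (Poly_Mapping.single (x # xs) 1), v) (1 :: complex) =
          lmul (Poly_Mapping.single [x] 1) (Poly_Mapping.single (cls (Poly_Mapping.single xs 1), v) 1)"
        by (simp add: mult_single plus_list_def)
      then show ?case
        using proj_letter[of "Poly_Mapping.single (cls (Poly_Mapping.single xs 1), v) 1" x] single
          stable_pm_sum[OF R.gen_stable Cons] by simp
    qed
    have "proj (Poly_Mapping.single (cls p, v) 1) \<in> ?H"
    proof (induction p rule: free_space_induct[OF subset_UNIV])
      case (1 xs a)
      have "proj (Poly_Mapping.single (cls (pscale a (Poly_Mapping.single xs 1)), v) 1) =
          proj (Poly_Mapping.single (cls (Poly_Mapping.single xs 1), v) a)"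
        by (rule proj_cong[OF null_tensor(3)[OF single]])
      also have "\<dots> = pscale a (proj (Poly_Mapping.single (cls (Poly_Mapping.single xs 1), v) 1))"
        by (simp add: pscale_simps flip: proj)
      finally show ?case using pm.subspace_scale[OF H word] by (simp add: pscale_simps)
    next
      case (2 p q)
      have "proj (Poly_Mapping.single (cls (p + q), v) 1) =
          proj (Poly_Mapping.single (cls p, v) 1 + Poly_Mapping.single (cls q, v) 1)"
        using null_tensor(1)[OF single, of p q] by (intro proj_cong) (simp add: diff_diff_eq)
      then show ?case using 2 pm.subspace_add[OF H] by (simp add: proj)
    next
      case 3
      have "proj (Poly_Mapping.single (cls (pscale 0 0), v) 1) = proj (Poly_Mapping.single (cls 0, v) 0)"
        by (rule proj_cong[OF null_tensor(3)[OF single]])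
      then show ?case using pm.subspace_0[OF H] by (simp add: pscale_simps)
    qed
    then have "proj (pscale c (Poly_Mapping.single (cls p, v) 1)) \<in> ?H"
      unfolding proj(2) by (rule pm.subspace_scale[OF H])
    then show ?case by (simp add: pscale_simps)
  next
    case (add f g)
    then show ?case using pm.subspace_add[OF H] by (simp add: proj)
  next
    case zero
    show ?case using pm.subspace_0[OF H] by simp
  }
qed

end

text \<open>\<open>W_t_Y\<close> and \<open>C2_Y\<close> are the two cases of injectivity of Z_t,
  which is t W_t for t > 0 and C_2 for t = 0.\<close>

locale induced_t = induced P d Y
  for P :: "(or_space, 'p) supermodule" and d Y +
  fixes t :: nat
  assumes W_Y: "i > int t \<Longrightarrow> v \<in> Y \<Longrightarrow> act P (W i) v = \<zero>\<^bsub>P\<^esub>"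
    and L_Y: "i > int t + int d \<Longrightarrow> v \<in> Y \<Longrightarrow> act P (L i) v = \<zero>\<^bsub>P\<^esub>"
    and G_Y: "i \<ge> int t \<Longrightarrow> v \<in> Y \<Longrightarrow> act P (G_half i) v = \<zero>\<^bsub>P\<^esub>"
    and W_t_Y: "v \<in> Y \<Longrightarrow> t > 0 \<Longrightarrow> act P (W (int t)) v = \<zero>\<^bsub>P\<^esub> \<Longrightarrow> v = \<zero>\<^bsub>P\<^esub>"
    and C2_Y: "v \<in> Y \<Longrightarrow> act P C2 v = \<zero>\<^bsub>P\<^esub> \<Longrightarrow> v = \<zero>\<^bsub>P\<^esub>"
begin

lemma iota_rep:
  assumes N: "N \<subseteq> Y" "\<zero>\<^bsub>P\<^esub> \<in> N" "\<And>v w. v \<in> N \<Longrightarrow> w \<in> N \<Longrightarrow> v \<oplus>\<^bsub>P\<^esub> w \<in> N"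
    "\<And>c v. v \<in> N \<Longrightarrow> c \<odot>\<^bsub>P\<^esub> v \<in> N"
    "\<And>b v. b \<in> T_basis d \<Longrightarrow> v \<in> N \<Longrightarrow> act P (Poly_Mapping.single b 1) v \<in> N"
    and K: "R.stable UNIV K" "K \<inter> iota ` N \<subseteq> {0}"
  shows "or_rep_T pscale ac t d (iota ` N) K"
proof (intro or_rep_T.intro ac_rep or_rep_T_axioms.intro)
  have NY: "v \<in> Y" if "v \<in> N" for v using N(1) that by auto
  show "R.stable (T_basis d) (iota ` N)"
    unfolding R.stable_def
  proof (intro conjI ballI pm.subspaceI)
    show "0 \<in> iota ` N" using N(2) iota_0 by (metis image_eqI)
    fix f g assume "f \<in> iota ` N" "g \<in> iota ` N"
    then show "f + g \<in> iota ` N" using N(3) NY by (auto simp flip: iota_add)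
  next
    fix c f assume "f \<in> iota ` N"
    then show "pscale c f \<in> iota ` N" using N(4) NY by (auto simp flip: iota_scale)
  next
    fix b f assume "b \<in> T_basis d" "f \<in> iota ` N"
    then show "ac b f \<in> iota ` N" using N(5) NY by (auto simp: ac_iota)
  qed
  show "ac (bW i) f = 0" if "i > int t" "f \<in> iota ` N" for i f
    using that NY W_Y[of i, unfolded W_def] by (auto simp: ac_iota iota_0)
  show "ac (bL i) f = 0" if "i > int t + int d" "f \<in> iota ` N" for i f
    using that NY L_Y[of i, unfolded L_def] by (auto simp: ac_iota iota_0)
  show "ac (bG i) f = 0" if "i \<ge> int t" "f \<in> iota ` N" for i f
    using that NY G_Y[of i, unfolded G_half_def] by (auto simp: ac_iota iota_0)
  show "f = 0" if f: "f \<in> iota ` N" and z: "R.Z (int t) f = 0" for f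
  proof -
    obtain v where v: "f = iota v" "v \<in> Y" using f NY by auto
    have "v = \<zero>\<^bsub>P\<^esub>"
    proof (cases "t = 0")
      case True
      have "ev (ac bC2 f) = \<zero>\<^bsub>P\<^esub>" using z True by (simp add: R.Z_def)
      then show ?thesis using v by (simp add: ev_ac iota_A ev_iota C2_Y C2_def)
    next
      case False
      then have "ac (bW (int t)) f = 0" using z by (simp add: R.Z_def)
      then have "ev (ac (bW (int t)) f) = \<zero>\<^bsub>P\<^esub>" by simp
      then show ?thesis using v False by (simp add: ev_ac iota_A ev_iota W_t_Y W_def)
    qed
    then show ?thesis by (simp add: v iota_0)
  qed
qed (use K in auto)

lemma Y_rep: "R.stable UNIV K \<Longrightarrow> K \<inter> iota ` Y \<subseteq> {0} \<Longrightarrow> or_rep_T pscale ac t d (iota ` Y) K"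
  by (rule iota_rep) (auto simp: Y_closed split: if_splits)

text \<open>The kernel meets the image of \<open>iota\<close> trivially, since \<open>ev\<close>
  undoes \<open>iota\<close>, and lies in the module generated by that image;
  \<open>K_trivial\<close> applies.\<close>

lemma ev_inj:
  assumes "f \<in> A" "ev f = \<zero>\<^bsub>P\<^esub>"
  shows "f \<in> null"
proof -
  let ?K = "proj ` {f \<in> A. ev f = \<zero>\<^bsub>P\<^esub>}"
  have K: "R.stable UNIV ?K"
    unfolding R.stable_def
  proof (intro conjI ballI pm.subspaceI)
    show "0 \<in> ?K" by (rule image_eqI[of _ _ 0]) (simp_all add: A_0)
    fix f g assume "f \<in> ?K" "g \<in> ?K"
    then obtain f' g' where "f = proj f'" "g = proj g'" "f' \<in> A" "g' \<in> A" "ev f' = \<zero>\<^bsub>P\<^esub>" "ev g' = \<zero>\<^bsub>P\<^esub>"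
      by auto
    then show "f + g \<in> ?K" by (intro image_eqI[of _ _ "f' + g'"]) (simp_all add: proj A_add ev_add)
  next
    fix c f assume "f \<in> ?K"
    then obtain f' where "f = proj f'" "f' \<in> A" "ev f' = \<zero>\<^bsub>P\<^esub>" by auto
    then show "pscale c f \<in> ?K" by (intro image_eqI[of _ _ "pscale c f'"]) (simp_all add: proj A_scale ev_pscale)
  next
    fix b f assume "f \<in> ?K"
    then obtain f' where f: "f = proj f'" "f' \<in> A" "ev f' = \<zero>\<^bsub>P\<^esub>" by auto
    then have "ev (lmul (bs b) f') = \<zero>\<^bsub>P\<^esub>" by (simp add: ev_lmul word_act_zero_right)
    then show "ac b f \<in> ?K" using f by (intro image_eqI[of _ _ "lmul (bs b) f'"]) (simp_all add: ac_proj lmul_A)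
  qed
  have "?K \<inter> iota ` Y \<subseteq> {0}"
  proof
    fix g assume "g \<in> ?K \<inter> iota ` Y"
    then obtain f v where f: "f \<in> A" "ev f = \<zero>\<^bsub>P\<^esub>" "proj f = iota v" "v \<in> Y" "g = iota v" by auto
    then have "v = \<zero>\<^bsub>P\<^esub>" using ev_iota[of v] ev_proj[of f] by simp
    then show "g \<in> {0}" using f by (simp add: iota_0)
  qed
  then interpret T: or_rep_T pscale ac t d "iota ` Y" ?K by (rule Y_rep[OF K])
  have "?K \<subseteq> {0}" by (rule T.K_trivial) (use proj_gen in auto)
  then have "proj f = 0" using assms by auto
  then show ?thesis using proj(4)[OF assms(1)] by simp
qed

text \<open>Simplicity speaks of graded submodules only, so \<open>S\<close> is replaced by the sum
  of its homogeneous parts. This graded core is again a submodule, and the homogeneous vector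
  \<open>v\<close> keeps it nonzero.\<close>

lemma graded_full:
  assumes "simple_supermodule OR P" "submodule S CC P" "\<And>x v. v \<in> S \<Longrightarrow> act P x v \<in> S"
    and "v \<in> S" "v \<in> hpart P i" "v \<noteq> \<zero>\<^bsub>P\<^esub>"
  shows "S = carrier P"
proof -
  note S = M.submodule_closed[OF assms(2)]
  let ?N = "(S \<inter> hpart P 0) <+>\<^bsub>P\<^esub> (S \<inter> hpart P 1)"
  have N: "x \<in> ?N \<longleftrightarrow> (\<exists>a b. a \<in> S \<and> a \<in> hpart P 0 \<and> b \<in> S \<and> b \<in> hpart P 1 \<and> x = a \<oplus>\<^bsub>P\<^esub> b)" for x
    by (auto simp: set_add_def')
  have hom: "a \<in> ?N" if "a \<in> S" "a \<in> hpart P k" for a k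
    using bit_01[of k]
  proof
    assume "k = 0"
    then have "a = a \<oplus>\<^bsub>P\<^esub> \<zero>\<^bsub>P\<^esub>" using that M.hpart_carrier by simp
    then show ?thesis unfolding N using that \<open>k = 0\<close> S(2) M.hpart_closed(1) by blast
  next
    assume "k = 1"
    then have "a = \<zero>\<^bsub>P\<^esub> \<oplus>\<^bsub>P\<^esub> a" using that M.hpart_carrier by simp
    then show ?thesis unfolding N using that \<open>k = 1\<close> S(2) M.hpart_closed(1) by blast
  qed
  have NS: "?N \<subseteq> S" using S(3) by (auto simp: set_add_def')
  have add: "x \<oplus>\<^bsub>P\<^esub> y \<in> ?N" if xy: "x \<in> ?N" "y \<in> ?N" for x y
  proof -
    obtain a b a' b' where *: "a \<in> S" "a \<in> hpart P 0" "b \<in> S" "b \<in> hpart P 1" "x = a \<oplus>\<^bsub>P\<^esub> b"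
      "a' \<in> S" "a' \<in> hpart P 0" "b' \<in> S" "b' \<in> hpart P 1" "y = a' \<oplus>\<^bsub>P\<^esub> b'"
      using xy unfolding N by blast
    then have "x \<oplus>\<^bsub>P\<^esub> y = (a \<oplus>\<^bsub>P\<^esub> a') \<oplus>\<^bsub>P\<^esub> (b \<oplus>\<^bsub>P\<^esub> b')"
      using M.hpart_carrier by (simp add: M.a_ac)
    moreover have "a \<oplus>\<^bsub>P\<^esub> a' \<in> S" "a \<oplus>\<^bsub>P\<^esub> a' \<in> hpart P 0" "b \<oplus>\<^bsub>P\<^esub> b' \<in> S" "b \<oplus>\<^bsub>P\<^esub> b' \<in> hpart P 1"
      using * S(3) M.hpart_closed(2) by auto
    ultimately show ?thesis unfolding N by blast
  qed
  have "graded_submodule ?N OR P"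
    unfolding graded_submodule_def
  proof (intro conjI ballI)
    show "submodule ?N CC P"
    proof (rule M.submoduleI')
      show "?N \<subseteq> carrier P" using NS S(1) by auto
      show "\<zero>\<^bsub>P\<^esub> \<in> ?N" using hom[OF S(2), of 0] M.hpart_closed(1) by blast
      fix c x assume "x \<in> ?N"
      then obtain a b where *: "a \<in> S" "a \<in> hpart P 0" "b \<in> S" "b \<in> hpart P 1" "x = a \<oplus>\<^bsub>P\<^esub> b"
        unfolding N by blast
      then have "c \<odot>\<^bsub>P\<^esub> x = c \<odot>\<^bsub>P\<^esub> a \<oplus>\<^bsub>P\<^esub> c \<odot>\<^bsub>P\<^esub> b"
        using M.hpart_carrier by (simp add: M.smult_add_right)
      moreover have "c \<odot>\<^bsub>P\<^esub> a \<in> S" "c \<odot>\<^bsub>P\<^esub> a \<in> hpart P 0" "c \<odot>\<^bsub>P\<^esub> b \<in> S" "c \<odot>\<^bsub>P\<^esub> b \<in> hpart P 1"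
        using * S(4) M.hpart_closed(3) by auto
      ultimately show "c \<odot>\<^bsub>P\<^esub> x \<in> ?N" unfolding N by blast
    qed (rule add)
    fix x v assume x: "x \<in> carrier OR" and v: "v \<in> ?N"
    obtain x0 x1 where x01: "x = x0 \<oplus>\<^bsub>OR\<^esub> x1" "x0 \<in> hpart OR 0" "x1 \<in> hpart OR 1"
      using G.decompose[OF x] .
    obtain a b where *: "a \<in> S" "a \<in> hpart P 0" "b \<in> S" "b \<in> hpart P 1" "v = a \<oplus>\<^bsub>P\<^esub> b"
      using v unfolding N by blast
    have c: "a \<in> carrier P" "b \<in> carrier P" using * M.hpart_carrier by auto
    have "act P x v = (act P x0 a \<oplus>\<^bsub>P\<^esub> act P x0 b) \<oplus>\<^bsub>P\<^esub> (act P x1 a \<oplus>\<^bsub>P\<^esub> act P x1 b)"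
      using c x01(1) *(5) act_add_left[of x0 x1 v] act_add_right[of x0 a b] act_add_right[of x1 a b] by simp
    moreover have "act P x0 a \<in> ?N" "act P x0 b \<in> ?N" "act P x1 a \<in> ?N" "act P x1 b \<in> ?N"
      using * assms(3) act_hpart[OF x01(2)] act_hpart[OF x01(3)] by (blast intro: hom)+
    ultimately show "act P x v \<in> ?N" using add by simp
  next
    show "?N = (?N \<inter> hpart P 0) <+>\<^bsub>P\<^esub> (?N \<inter> hpart P 1)"
    proof
      show "?N \<subseteq> (?N \<inter> hpart P 0) <+>\<^bsub>P\<^esub> (?N \<inter> hpart P 1)"
      proof
        fix x assume "x \<in> ?N"
        then obtain a b where *: "a \<in> S" "a \<in> hpart P 0" "b \<in> S" "b \<in> hpart P 1" "x = a \<oplus>\<^bsub>P\<^esub> b"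
          unfolding N by blast
        have mem: "a \<oplus>\<^bsub>P\<^esub> b \<in> A <+>\<^bsub>P\<^esub> B" if "a \<in> A" "b \<in> B" for A B
          using that by (auto simp: set_add_def')
        show "x \<in> (?N \<inter> hpart P 0) <+>\<^bsub>P\<^esub> (?N \<inter> hpart P 1)"
          unfolding *(5) using hom[OF *(1,2)] hom[OF *(3,4)] *(2,4) by (intro mem IntI)
      qed
      show "(?N \<inter> hpart P 0) <+>\<^bsub>P\<^esub> (?N \<inter> hpart P 1) \<subseteq> ?N"
      proof
        fix x assume "x \<in> (?N \<inter> hpart P 0) <+>\<^bsub>P\<^esub> (?N \<inter> hpart P 1)"
        then obtain a b where "a \<in> ?N" "b \<in> ?N" "x = a \<oplus>\<^bsub>P\<^esub> b"
          unfolding set_add_def'[of P "?N \<inter> _"] by blast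
        then show "x \<in> ?N" using add by simp
      qed
    qed
  qed
  then have "?N = {\<zero>\<^bsub>P\<^esub>} \<or> ?N = carrier P"
    using assms(1) unfolding simple_supermodule_def by blast
  moreover have "v \<in> ?N" using hom assms(4,5) by blast
  ultimately show ?thesis using assms(6) NS S(1) by blast
qed

lemma V_simple:
  assumes P: "simple_supermodule OR P" and ne: "Y \<noteq> {\<zero>\<^bsub>P\<^esub>}"
  shows "simple_supermodule (T d) V"
  unfolding simple_supermodule_def
proof (intro conjI allI impI)
  show "supermodule (T d) V" by (rule V_supermodule)
  obtain v where v: "v \<in> Y" "v \<noteq> \<zero>\<^bsub>P\<^esub>" using ne Y_closed(3) by blast
  \<comment> \<open>Non-triviality is witnessed by the central element, which acts
    injectively.\<close>
  then have "act V C2 v \<noteq> \<zero>\<^bsub>V\<^esub>" using C2_Y by auto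
  then show "\<exists>x\<in>carrier (T d). \<exists>v\<in>carrier V. act V x v \<noteq> \<zero>\<^bsub>V\<^esub>"
    using v by (intro bexI[of _ C2] bexI[of _ v]) (auto simp: C2_def)
next
  fix N assume gr: "graded_submodule N (T d) V"
  then have sub: "submodule N CC V" and N_act: "\<And>x v. Poly_Mapping.keys x \<subseteq> T_basis d \<Longrightarrow> v \<in> N \<Longrightarrow> act P x v \<in> N"
    and N_gr: "N = (N \<inter> hpart V 0) <+>\<^bsub>V\<^esub> (N \<inter> hpart V 1)"
    unfolding graded_submodule_def by auto
  note N = V.M.submodule_closed[OF sub, simplified]
  show "N = {\<zero>\<^bsub>V\<^esub>} \<or> N = carrier V"
  proof (cases "N = {\<zero>\<^bsub>P\<^esub>}")
    case False
    obtain w k where w: "w \<in> N" "w \<in> hpart P k" "w \<noteq> \<zero>\<^bsub>P\<^esub>"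
    proof -
      obtain n where n: "n \<in> N" "n \<noteq> \<zero>\<^bsub>P\<^esub>" using False N(2) by blast
      have "n \<in> (N \<inter> hpart V 0) <+>\<^bsub>V\<^esub> (N \<inter> hpart V 1)" by (subst N_gr[symmetric]) (rule n)
      then obtain a b where ab: "n = a \<oplus>\<^bsub>P\<^esub> b" "a \<in> N" "a \<in> hpart P 0" "b \<in> N" "b \<in> hpart P 1"
        by (auto simp: set_add_def')
      show ?thesis
      proof (cases "a = \<zero>\<^bsub>P\<^esub>")
        case True
        with n ab have "b \<noteq> \<zero>\<^bsub>P\<^esub>" by auto
        with ab show ?thesis using that by blast
      qed (use ab that in blast)
    qed
    let ?H = "R.gen (iota ` N)"
    \<comment> \<open>The submodule of \<open>P\<close> generated by \<open>N\<close>, described so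
      that each element comes with a preimage in the submodule of the induced module generated by
      \<open>N\<close>.\<close>
    let ?S = "{p \<in> carrier P. \<exists>f\<in>A. ev f = p \<and> proj f \<in> ?H}"
    have H: "pm.subspace ?H" by (rule R.stable_subspace[OF R.gen_stable])
    have NS: "n \<in> ?S" if "n \<in> N" for n
    proof -
      have n: "n \<in> Y" using that N(1) by auto
      have "proj (iota n) = iota n" by (simp add: iota_def proj_proj n)
      then have "proj (iota n) \<in> ?H" using R.gen_base[of "iota ` N"] that by auto
      then show ?thesis using n iota_A ev_iota by auto
    qed
    have "?S = carrier P"
    proof (rule graded_full[OF P _ _ NS[OF w(1)] w(2,3)])
      show "submodule ?S CC P"
      proof (rule M.submoduleI')
        show "\<zero>\<^bsub>P\<^esub> \<in> ?S" using A_0 pm.subspace_0[OF H] by (auto intro!: bexI[of _ 0])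
        fix a b assume "a \<in> ?S" "b \<in> ?S"
        then obtain f g where "f \<in> A" "ev f = a" "proj f \<in> ?H" "g \<in> A" "ev g = b" "proj g \<in> ?H" by auto
        then show "a \<oplus>\<^bsub>P\<^esub> b \<in> ?S"
          using pm.subspace_add[OF H] by (auto simp: A_add proj ev_add ev_closed intro!: bexI[of _ "f + g"])
      next
        fix c a assume "a \<in> ?S"
        then obtain f where "f \<in> A" "ev f = a" "proj f \<in> ?H" by auto
        then show "c \<odot>\<^bsub>P\<^esub> a \<in> ?S"
          using pm.subspace_scale[OF H] by (auto simp: A_scale proj ev_pscale ev_closed intro!: bexI[of _ "pscale c f"])
      qed auto
      fix x p assume "p \<in> ?S"
      then obtain f where f: "f \<in> A" "ev f = p" "proj f \<in> ?H" and p: "p \<in> carrier P" by auto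
      have "proj (lmul (Poly_Mapping.single [x] 1) f) \<in> ?H"
        using proj_letter[OF f(1), of x] stable_pm_sum[OF R.gen_stable f(3)] by simp
      moreover have "ev (lmul (Poly_Mapping.single [x] 1) f) = act P x p"
        using f p by (simp add: ev_lmul word_act_single act_closed)
      ultimately show "act P x p \<in> ?S"
        using f(1) p by (auto simp: act_closed intro!: bexI[of _ "lmul (Poly_Mapping.single [x] 1) f"] lmul_A)
    qed
    \<comment> \<open>With \<open>K\<close> = 0, \<open>singular_in_V\<close> can be applied to
      \<open>N\<close> in the role of \<open>V\<close>.\<close>
    have "{0} \<inter> iota ` N \<subseteq> {0}" by auto
    moreover have "R.stable UNIV {0}" by (simp add: R.stable_def pm.subspace_single_0)
    ultimately interpret T: or_rep_T pscale ac t d "iota ` N" "{0}"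
      by (intro iota_rep) (use N N_act in \<open>auto split: if_splits\<close>)
    have "Y \<subseteq> N"
    proof
      fix v assume v: "v \<in> Y"
      then have "v \<in> ?S" using \<open>?S = carrier P\<close> by simp
      then obtain f where f: "f \<in> A" "ev f = v" "proj f \<in> ?H" by auto
      let ?s = "Poly_Mapping.single (cls 1, v) (1 :: complex)"
      \<comment> \<open>Both tensors evaluate to \<open>v\<close>, so by \<open>ev_inj\<close> they
        agree in the induced module; thus 1 \<otimes> v lies in the part generated by
        \<open>N\<close>.\<close>
      have "ev (?s - f) = \<zero>\<^bsub>P\<^esub>"
        using f v by (subst ev_diff) (auto simp: word_act_1 a_minus_def M.r_neg)
      then have "?s - f \<in> null" using f v by (intro ev_inj A_diff) auto
      then have "iota v = proj f" unfolding iota_def by (rule proj_cong)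
      then have "iota v \<in> ?H" using f(3) by simp
      then have "iota v \<in> iota ` N"
        using v W_Y[unfolded W_def] L_Y[unfolded L_def] G_Y[unfolded G_half_def]
        by (intro T.singular_in_V) (auto simp: ac_iota iota_0)
      then obtain n where n: "n \<in> N" "iota v = iota n" by auto
      then have "v = n" using v N(1) ev_iota by (metis subsetD)
      then show "v \<in> N" using n(1) by simp
    qed
    then show ?thesis using N(1) by auto
  qed simp
qed

text \<open>Since \<open>ev\<close> is injective modulo \<open>null\<close>, a nonempty fibre is a
  coset of \<open>null\<close>: \<open>fiber\<close> is the inverse of the map Ind V \<rightarrow>
  P.\<close>

definition fiber :: "'p \<Rightarrow> (or_space, 'p) pretensor set" where
  "fiber p = {f \<in> A. ev f = p}"

lemma tensor_class_fiber: "f \<in> A \<Longrightarrow> tensor_class OR (T d) V f = fiber (ev f)"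
proof -
  assume f: "f \<in> A"
  have "tensor_class OR (T d) V f = {h + f | h. h \<in> null}"
    by (auto simp: tensor_class_def a_r_coset_def' space_simps)
  also have "\<dots> = fiber (ev f)"
  proof (intro equalityI subsetI)
    fix g assume "g \<in> {h + f | h. h \<in> null}"
    then obtain h where h: "g = h + f" "h \<in> null" by auto
    then have "h \<in> A" using null_A by auto
    then show "g \<in> fiber (ev f)" using f h by (simp add: fiber_def A_add ev_add ev_null ev_closed)
  next
    fix g assume "g \<in> fiber (ev f)"
    then have g: "g \<in> A" "ev g = ev f" by (auto simp: fiber_def)
    then have "g - f \<in> null"
      using f by (intro ev_inj A_diff) (simp_all add: ev_diff ev_closed a_minus_def M.r_neg)
    then show "g \<in> {h + f | h. h \<in> null}" by (intro CollectI exI[of _ "g - f"]) simp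
  qed
  finally show ?thesis .
qed

section \<open>The grading of the induced module\<close>

definition homog :: "bit \<Rightarrow> (or_space, 'p) pretensor set" where
  "homog k = {f. Poly_Mapping.keys f \<subseteq> {(Q, v). \<exists>i j. Q \<in> uea_part OR i \<and> v \<in> hpart V j \<and> i + j = k}}"

definition word_degree :: "bit \<Rightarrow> or_space list set" where
  "word_degree i = {xs. \<exists>ds. list_all2 (\<lambda>x d. x \<in> hpart OR d) xs ds \<and> sum_list ds = i}"

lemma uea_part_alt: "uea_part OR i = cls ` {p. Poly_Mapping.keys p \<subseteq> word_degree i}"
  by (simp add: uea_part_def word_degree_def)

lemma homog_A: "homog k \<subseteq> A"
  by (auto simp: homog_def A_def uea_part_alt dest!: subsetD)

lemma homog_subspace: "pm.subspace (homog k)"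
  by (rule pm.subspaceI) (auto simp: homog_def keys_add_subset keys_pscale_subset)

lemma homog_induct [consumes 1, case_names single add zero]:
  assumes "f \<in> homog k"
    "\<And>p v c i j. Poly_Mapping.keys p \<subseteq> word_degree i \<Longrightarrow> v \<in> Y \<Longrightarrow> v \<in> hpart P j \<Longrightarrow> i + j = k \<Longrightarrow>
      Q (Poly_Mapping.single (cls p, v) c)"
    "\<And>f g. Q f \<Longrightarrow> Q g \<Longrightarrow> Q (f + g)" "Q 0"
  shows "Q f"
  by (rule free_space_induct[OF assms(1)[unfolded homog_def, THEN CollectD]])
    (use assms(2-) in \<open>auto simp: uea_part_alt\<close>)

lemma homog_single:
  "Poly_Mapping.keys p \<subseteq> word_degree i \<Longrightarrow> v \<in> Y \<Longrightarrow> v \<in> hpart P j \<Longrightarrow>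
    Poly_Mapping.single (cls p, v) c \<in> homog (i + j)"
  by (auto simp: homog_def uea_part_alt)

lemma word_act_homog:
  assumes "Poly_Mapping.keys p \<subseteq> word_degree i" "v \<in> hpart P j"
  shows "word_act P p v \<in> hpart P (i + j)"
proof -
  have v: "v \<in> carrier P" using assms(2) M.hpart_carrier by auto
  have word: "foldr (act P) xs v \<in> hpart P (sum_list ds + j)"
    if "list_all2 (\<lambda>x d. x \<in> hpart OR d) xs ds" for xs ds
    using that
  proof (induction rule: list_all2_induct)
    case (Cons x xs d ds)
    from act_hpart[OF Cons(1) Cons(3)] show ?case
      by (simp only: foldr.simps comp_apply sum_list.Cons add.assoc)
  next
    case Nil
    from assms(2) show ?case by (simp only: foldr.simps id_apply sum_list.Nil add_0)
  qed
  from assms(1) show ?thesis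
  proof (induction p rule: free_space_induct)
    case (single xs c)
    then obtain ds where ds: "list_all2 (\<lambda>x d. x \<in> hpart OR d) xs ds" "sum_list ds = i"
      unfolding word_degree_def by blast
    have "word_act P (Poly_Mapping.single xs c) v = c \<odot>\<^bsub>P\<^esub> foldr (act P) xs v"
      using v by (intro word_act_single) simp_all
    with M.hpart_closed(3)[OF word[OF ds(1)]] ds(2) show ?case by (simp only:)
  next
    case (add p q)
    then have "word_act P (p + q) v = word_act P p v \<oplus>\<^bsub>P\<^esub> word_act P q v"
      using v by (intro word_act_add) simp_all
    with M.hpart_closed(2)[OF add] show ?case by (simp only:)
  next
    case zero
    show ?case unfolding word_act_0 by (rule M.hpart_closed(1))
  qed
qed

lemma ev_homog: "f \<in> homog k \<Longrightarrow> ev f \<in> hpart P k"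
proof -
  assume "f \<in> homog k"
  then have "f \<in> A \<and> ev f \<in> hpart P k"
  proof (induction rule: homog_induct)
    case (single p v c i j)
    then show ?case using M.hpart_closed(3)[OF word_act_homog[OF single(1,3)]]
      by (simp only: ev_single single_A simp_thms)
  next
    case (add f g)
    then show ?case using M.hpart_closed(2) by (simp add: ev_add A_add)
  qed (simp add: A_0 M.hpart_closed)
  then show ?thesis by simp
qed

lemma lmul_homog:
  assumes "x \<in> hpart OR i" "f \<in> homog k"
  shows "lmul (Poly_Mapping.single [x] 1) f \<in> homog (i + k)"
  using assms(2)
proof (induction rule: homog_induct)
  case (single p v c i' j)
  have "Poly_Mapping.keys (Poly_Mapping.single [x] 1 * p) \<subseteq> word_degree (i + i')"
  proof
    fix ys assume "ys \<in> Poly_Mapping.keys (Poly_Mapping.single [x] 1 * p)"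
    then obtain xs where "ys = x # xs" "xs \<in> word_degree i'"
      using keys_mult[of "Poly_Mapping.single [x] (1::complex)" p] single(1) by (auto simp: plus_list_def)
    then obtain ds where "ys = x # xs" "list_all2 (\<lambda>x d. x \<in> hpart OR d) xs ds" "sum_list ds = i'"
      by (auto simp: word_degree_def)
    then show "ys \<in> word_degree (i + i')"
      using assms(1) unfolding word_degree_def by (intro CollectI exI[of _ "i # ds"]) simp
  qed
  from homog_single[OF this single(2,3)] show ?case
    unfolding lmul_single single(4)[symmetric] by (simp only: add.assoc)
next
  case (add f g)
  then show ?case using pm.subspace_add[OF homog_subspace] by (simp add: lmul_add)
qed (simp add: pm.subspace_0[OF homog_subspace])

text \<open>The images of even and odd tensors add up to a submodule with a nonzero homogeneous
  vector, hence to \<open>P\<close>. A vector of degree k then has its other component in both parts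
  of \<open>P\<close>, so that component is 0.\<close>

lemma homog_onto:
  assumes P: "simple_supermodule OR P" and ne: "Y \<noteq> {\<zero>\<^bsub>P\<^esub>}"
  shows "ev ` homog k = hpart P k"
proof -
  let ?S = "{a \<oplus>\<^bsub>P\<^esub> b | a b. a \<in> ev ` homog 0 \<and> b \<in> ev ` homog 1}"
  have S_I: "a \<oplus>\<^bsub>P\<^esub> b \<in> ?S" if "a \<in> ev ` homog 0" "b \<in> ev ` homog 1" for a b
    using that by blast
  have hom_add: "a \<oplus>\<^bsub>P\<^esub> b \<in> ev ` homog k" if ab: "a \<in> ev ` homog k" "b \<in> ev ` homog k" for a b k
  proof -
    obtain f g where "f \<in> homog k" "g \<in> homog k" "a = ev f" "b = ev g" using ab by auto
    then show ?thesis
      using homog_A pm.subspace_add[OF homog_subspace] by (intro image_eqI[of _ _ "f + g"]) (auto simp: ev_add subset_iff)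
  qed
  have hom_scale: "c \<odot>\<^bsub>P\<^esub> a \<in> ev ` homog k" if a: "a \<in> ev ` homog k" for a c k
  proof -
    obtain f where "f \<in> homog k" "a = ev f" using a by auto
    then show ?thesis
      using homog_A pm.subspace_scale[OF homog_subspace] by (intro image_eqI[of _ _ "pscale c f"]) (auto simp: ev_pscale subset_iff)
  qed
  have hom_0: "\<zero>\<^bsub>P\<^esub> \<in> ev ` homog k" for k
    using pm.subspace_0[OF homog_subspace] by (intro image_eqI[of _ _ 0]) auto
  have hom_hpart: "a \<in> hpart P k" if "a \<in> ev ` homog k" for a k using that ev_homog by auto
  have hom_carrier: "a \<in> carrier P" if "a \<in> ev ` homog k" for a k using hom_hpart[OF that] M.hpart_carrier by auto
  have hom_act: "act P x a \<in> ev ` homog (i + k)" if x: "x \<in> hpart OR i" and a: "a \<in> ev ` homog k" for x i a k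
  proof -
    obtain f where f: "f \<in> homog k" "a = ev f" using a by auto
    then have "f \<in> A" using homog_A by auto
    then have "ev (lmul (Poly_Mapping.single [x] 1) f) = act P x a"
      using f by (simp add: ev_lmul word_act_single ev_closed act_closed)
    then show ?thesis using lmul_homog[OF x f(1)] by (metis image_eqI)
  qed
  have hom_S: "a \<in> ?S" if a: "a \<in> ev ` homog k" for a k
    using bit_01[of k]
  proof
    assume "k = 0"
    then show ?thesis using S_I[OF _ hom_0, of a] a hom_carrier[OF a] by simp
  next
    assume "k = 1"
    then show ?thesis using S_I[OF hom_0, of a] a hom_carrier[OF a] by simp
  qed
  have add: "x \<oplus>\<^bsub>P\<^esub> y \<in> ?S" if xy: "x \<in> ?S" "y \<in> ?S" for x y
  proof -
    obtain a b a' b' where *: "a \<in> ev ` homog 0" "b \<in> ev ` homog 1" "x = a \<oplus>\<^bsub>P\<^esub> b"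
      "a' \<in> ev ` homog 0" "b' \<in> ev ` homog 1" "y = a' \<oplus>\<^bsub>P\<^esub> b'"
      using xy by blast
    then have "x \<oplus>\<^bsub>P\<^esub> y = (a \<oplus>\<^bsub>P\<^esub> a') \<oplus>\<^bsub>P\<^esub> (b \<oplus>\<^bsub>P\<^esub> b')"
      using hom_carrier by (simp add: M.a_ac)
    then show ?thesis using S_I[OF hom_add[OF *(1,4)] hom_add[OF *(2,5)]] by (simp only:)
  qed
  obtain v j where v: "v \<in> Y" "v \<in> hpart P j" "v \<noteq> \<zero>\<^bsub>P\<^esub>"
  proof -
    obtain y where y: "y \<in> Y" "y \<noteq> \<zero>\<^bsub>P\<^esub>" using ne Y_closed(3) by blast
    then obtain a b where ab: "y = a \<oplus>\<^bsub>P\<^esub> b" "a \<in> Y" "a \<in> hpart P 0" "b \<in> Y" "b \<in> hpart P 1"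
      using V.M.decompose[of y, simplified] by blast
    show ?thesis
    proof (cases "a = \<zero>\<^bsub>P\<^esub>")
      case True
      with y ab have "b \<noteq> \<zero>\<^bsub>P\<^esub>" by auto
      with ab show ?thesis using that by blast
    qed (use ab that in blast)
  qed
  have "Poly_Mapping.keys (1 :: or_space list \<Rightarrow>\<^sub>0 complex) \<subseteq> word_degree 0"
    by (auto simp: word_degree_def zero_list_def)
  then have "Poly_Mapping.single (cls 1, v) 1 \<in> homog j"
    using homog_single[of 1 0 v j 1] v(1,2) unfolding add_0 by blast
  then have vj: "v \<in> ev ` homog j"
    using v(1) by (intro image_eqI[of _ _ "Poly_Mapping.single (cls 1, v) 1"]) (simp_all add: word_act_1)
  have "?S = carrier P"
  proof (rule graded_full[OF P _ _ hom_S[OF vj] v(2,3)])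
    show "submodule ?S CC P"
    proof (rule M.submoduleI')
      show "?S \<subseteq> carrier P" using hom_carrier by auto
      show "\<zero>\<^bsub>P\<^esub> \<in> ?S" by (rule hom_S[OF hom_0])
      fix c x assume "x \<in> ?S"
      then obtain a b where *: "a \<in> ev ` homog 0" "b \<in> ev ` homog 1" "x = a \<oplus>\<^bsub>P\<^esub> b" by blast
      then have "c \<odot>\<^bsub>P\<^esub> x = c \<odot>\<^bsub>P\<^esub> a \<oplus>\<^bsub>P\<^esub> c \<odot>\<^bsub>P\<^esub> b"
        using hom_carrier by (simp add: M.smult_add_right)
      then show "c \<odot>\<^bsub>P\<^esub> x \<in> ?S" using S_I[OF hom_scale[OF *(1)] hom_scale[OF *(2)]] by (simp only:)
    qed (rule add)
    fix x v assume "v \<in> ?S"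
    then obtain a b where *: "a \<in> ev ` homog 0" "b \<in> ev ` homog 1" "v = a \<oplus>\<^bsub>P\<^esub> b" by blast
    obtain x0 x1 where x01: "x = x0 \<oplus>\<^bsub>OR\<^esub> x1" "x0 \<in> hpart OR 0" "x1 \<in> hpart OR 1"
      using G.decompose[of x] by auto
    have c: "a \<in> carrier P" "b \<in> carrier P" using * hom_carrier by auto
    have "act P x v = (act P x0 a \<oplus>\<^bsub>P\<^esub> act P x0 b) \<oplus>\<^bsub>P\<^esub> (act P x1 a \<oplus>\<^bsub>P\<^esub> act P x1 b)"
      using c x01(1) *(3) act_add_left[of x0 x1 v] act_add_right[of x0 a b] act_add_right[of x1 a b] by simp
    moreover have "act P x0 a \<in> ?S" "act P x0 b \<in> ?S" "act P x1 a \<in> ?S" "act P x1 b \<in> ?S"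
      by (fact hom_S[OF hom_act[OF x01(2) *(1)]] hom_S[OF hom_act[OF x01(2) *(2)]]
          hom_S[OF hom_act[OF x01(3) *(1)]] hom_S[OF hom_act[OF x01(3) *(2)]])+
    ultimately show "act P x v \<in> ?S" using add by simp
  qed
  show ?thesis
  proof
    show "ev ` homog k \<subseteq> hpart P k" using ev_homog by auto
    show "hpart P k \<subseteq> ev ` homog k"
    proof
      fix p assume p: "p \<in> hpart P k"
      then have "p \<in> ?S" using M.hpart_carrier \<open>?S = carrier P\<close> by auto
      then obtain a b where ab: "a \<in> ev ` homog 0" "b \<in> ev ` homog 1" "p = a \<oplus>\<^bsub>P\<^esub> b" by blast
      have c: "a \<in> carrier P" "b \<in> carrier P" "p \<in> carrier P" using ab hom_carrier p M.hpart_carrier by auto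
      from bit_01[of k] show "p \<in> ev ` homog k"
      proof
        assume k: "k = 0"
        have "b = p \<ominus>\<^bsub>P\<^esub> a" unfolding ab(3) a_minus_def M.a_comm[OF c(1,2)] using c by (simp add: M.a_assoc M.r_neg)
        then have "b \<in> hpart P 0" using p ab(1) k hom_hpart M.hpart_closed(5) by simp
        then have "b = \<zero>\<^bsub>P\<^esub>" using hom_hpart[OF ab(2)] M.hpart_Int by blast
        then show ?thesis using ab c k by simp
      next
        assume k: "k = 1"
        have "a = p \<ominus>\<^bsub>P\<^esub> b" unfolding ab(3) a_minus_def using c by (simp add: M.a_assoc M.r_neg)
        then have "a \<in> hpart P 1" using p ab(2) k hom_hpart M.hpart_closed(5) by simp
        then have "a = \<zero>\<^bsub>P\<^esub>" using hom_hpart[OF ab(1)] M.hpart_Int by blast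
        then show ?thesis using ab c k by simp
      qed
    qed
  qed
qed

lemma isomorphic_induced:
  assumes P: "simple_supermodule OR P" and ne: "Y \<noteq> {\<zero>\<^bsub>P\<^esub>}"
  shows "isomorphic_supermodules OR P (induced_module OR (T d) V)"
proof -
  let ?I = "induced_module OR (T d) V"
  have onto: "\<exists>f\<in>A. ev f = p" if p: "p \<in> carrier P" for p
  proof -
    obtain a b where ab: "p = a \<oplus>\<^bsub>P\<^esub> b" "a \<in> hpart P 0" "b \<in> hpart P 1" using M.decompose[OF p] .
    then obtain f g where "f \<in> homog 0" "g \<in> homog 1" "ev f = a" "ev g = b"
      using homog_onto[OF assms] by (metis imageE)
    then show ?thesis using ab homog_A by (intro bexI[of _ "f + g"]) (auto simp: ev_add A_add subset_iff)
  qed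
  have fiber_ne: "\<exists>f. f \<in> fiber p" if "p \<in> carrier P" for p
    using onto[OF that] by (auto simp: fiber_def)
  have fiber_inj: "p = q" if "fiber p = fiber q" "p \<in> carrier P" for p q
    using fiber_ne[OF that(2)] that(1) by (auto simp: fiber_def)
  \<comment> \<open>Coset operations are unions over representatives. Every representative yields
    the same fibre and there is at least one, so the union is that fibre.\<close>
  have cong: "(\<Union>f\<in>fiber p. tensor_class OR (T d) V (h f)) = fiber q"
    if "p \<in> carrier P" "\<And>f. f \<in> A \<Longrightarrow> ev f = p \<Longrightarrow> h f \<in> A \<and> ev (h f) = q" for p q h
  proof -
    have "tensor_class OR (T d) V (h f) = fiber q" if "f \<in> fiber p" for f
      using that \<open>\<And>f. f \<in> A \<Longrightarrow> ev f = p \<Longrightarrow> h f \<in> A \<and> ev (h f) = q\<close>[of f]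
      by (simp add: fiber_def tensor_class_fiber)
    then show ?thesis using fiber_ne[OF that(1)] by auto
  qed
  have carrier: "carrier ?I = fiber ` carrier P"
  proof -
    have "carrier ?I = tensor_class OR (T d) V ` A"
      by (auto simp: induced_module_def A_RCOSETS_def' tensor_class_def space_simps)
    also have "\<dots> = fiber ` carrier P"
      using tensor_class_fiber ev_closed onto by force
    finally show ?thesis .
  qed
  show ?thesis
    unfolding isomorphic_supermodules_def
  proof (intro exI[of _ fiber] conjI ballI allI)
    show "bij_betw fiber (carrier P) (carrier ?I)"
      unfolding carrier by (rule inj_on_imp_bij_betw) (auto intro: inj_onI fiber_inj)
  next
    fix v w assume vw: "v \<in> carrier P" "w \<in> carrier P"
    \<comment> \<open>Cosets are added as sets; a tensor over the sum splits with its first summand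
      chosen freely over \<open>v\<close>.\<close>
    have "fiber (v \<oplus>\<^bsub>P\<^esub> w) = (\<Union>f\<in>fiber v. \<Union>g\<in>fiber w. {f + g})"
    proof (intro equalityI subsetI)
      fix h assume h: "h \<in> fiber (v \<oplus>\<^bsub>P\<^esub> w)"
      obtain f where f: "f \<in> A" "ev f = v" using onto[OF vw(1)] by auto
      have "h - f \<in> fiber w"
        using f h vw unfolding fiber_def
        by (auto simp: A_diff ev_diff a_minus_def M.a_ac M.r_neg M.r_neg1 M.r_neg2)
      then show "h \<in> (\<Union>f\<in>fiber v. \<Union>g\<in>fiber w. {f + g})"
        using f by (intro UN_I[of f] UN_I[of "h - f"]) (auto simp: fiber_def)
    qed (auto simp: fiber_def A_add ev_add)
    then show "fiber (v \<oplus>\<^bsub>P\<^esub> w) = fiber v \<oplus>\<^bsub>?I\<^esub> fiber w"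
      by (simp add: induced_module_def set_add_def' space_simps)
  next
    fix c v assume v: "v \<in> carrier P"
    show "fiber (c \<odot>\<^bsub>P\<^esub> v) = c \<odot>\<^bsub>?I\<^esub> fiber v"
      by (simp add: induced_module_def) (rule cong[OF v, symmetric], simp add: A_scale ev_pscale)
  next
    fix x v assume v: "v \<in> carrier P"
    show "fiber (act P x v) = act ?I x (fiber v)"
      by (simp add: induced_module_def)
        (rule cong[OF v, symmetric], use v in \<open>simp add: left_mult_lmul lmul_A ev_lmul word_act_single act_closed\<close>)
  next
    fix k
    have "hpart ?I k = tensor_class OR (T d) V ` homog k"
      by (simp add: induced_module_def homog_def)
    also have "\<dots> = fiber ` ev ` homog k"
      unfolding image_image using homog_A tensor_class_fiber by (intro image_cong) auto
    finally show "fiber ` hpart P k = hpart ?I k"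
      using homog_onto[OF assms] by simp
  qed
qed

end

section \<open>Singular vectors of a restricted module\<close>

definition raising :: "nat \<Rightarrow> nat \<Rightarrow> or_basis set" where
  "raising t d = bW ` {int t<..} \<union> bL ` {int t + int d<..} \<union> bG ` {int t..}"

lemma raising_iff [simp]:
  "bW i \<in> raising t d \<longleftrightarrow> i > int t" "bL i \<in> raising t d \<longleftrightarrow> i > int t + int d" "bG i \<in> raising t d \<longleftrightarrow> i \<ge> int t"
  "bC1 \<notin> raising t d" "bC2 \<notin> raising t d"
  by (auto simp: raising_def)

text \<open>The only elements of T_d that lower indices are W_{-1}, ..., W_{-d}, and among the
  raising elements only the L fail to commute with them: hence the bound t + d for L. The resulting
  indices are positive, so no central term appears.\<close>

lemma raising_bracket:
  assumes "y \<in> raising t d" "b \<in> T_basis d"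
  shows "Poly_Mapping.keys (basis_bracket y b) \<subseteq> raising t d"
  using assms
  by (cases y; cases b) (auto dest!: Poly_Mapping.keys_add[THEN subsetD] split: if_splits)

context supermodule
begin

lemma act_zero_left: "v \<in> carrier M \<Longrightarrow> act M \<zero>\<^bsub>G\<^esub> v = \<zero>\<^bsub>M\<^esub>"
  using act_smult_left[of "\<zero>\<^bsub>G\<^esub>" v 0] act_closed[of "\<zero>\<^bsub>G\<^esub>" v] by simp

end

locale or_module = supermodule OR P for P :: "(or_space, 'p) supermodule"
begin

abbreviation bact :: "or_basis \<Rightarrow> 'p \<Rightarrow> 'p" where
  "bact b \<equiv> act P (Poly_Mapping.single b 1)"

lemma act_mem [simp]: "v \<in> carrier P \<Longrightarrow> act P x v \<in> carrier P"
  by (rule act_closed) simp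

lemma act_linear: "v \<in> carrier P \<Longrightarrow> act P (x + y) v = act P x v \<oplus>\<^bsub>P\<^esub> act P y v"
  "v \<in> carrier P \<Longrightarrow> act P (pscale c x) v = c \<odot>\<^bsub>P\<^esub> act P x v"
  "v \<in> carrier P \<Longrightarrow> act P 0 v = \<zero>\<^bsub>P\<^esub>"
  "v \<in> carrier P \<Longrightarrow> w \<in> carrier P \<Longrightarrow> act P x (v \<oplus>\<^bsub>P\<^esub> w) = act P x v \<oplus>\<^bsub>P\<^esub> act P x w"
  "v \<in> carrier P \<Longrightarrow> act P x (c \<odot>\<^bsub>P\<^esub> v) = c \<odot>\<^bsub>P\<^esub> act P x v"
  "act P x \<zero>\<^bsub>P\<^esub> = \<zero>\<^bsub>P\<^esub>"
  using act_add_left[of x y v] act_smult_left[of x v c] act_zero_left[of v] act_add_right[of x v w]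
    act_smult_right[of x v c] act_zero_right[of x] by simp_all

lemma neg_zero: "\<ominus>\<^bsub>P\<^esub> \<zero>\<^bsub>P\<^esub> = \<zero>\<^bsub>P\<^esub>"
  using M.smult_m1[of "\<zero>\<^bsub>P\<^esub>"] by simp

lemma single_hpart: "Poly_Mapping.single b 1 \<in> hpart OR (or_degree b)"
  by simp

lemma basis_act_bracket:
  "v \<in> carrier P \<Longrightarrow> act P (basis_bracket a b) v =
    bact a (bact b v) \<ominus>\<^bsub>P\<^esub> ksign (or_degree a) (or_degree b) \<odot>\<^bsub>P\<^esub> bact b (bact a v)"
  using act_bracket[OF single_hpart single_hpart, of v a b]
  by (simp add: or_bracket_single pscale_simps)

lemma act_keys_0:
  assumes "v \<in> carrier P" "Poly_Mapping.keys x \<subseteq> B" "\<And>b. b \<in> B \<Longrightarrow> bact b v = \<zero>\<^bsub>P\<^esub>"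
  shows "act P x v = \<zero>\<^bsub>P\<^esub>"
  using assms(2)
proof (induction x rule: free_space_induct)
  case (single b c)
  then show ?case using assms by (subst single_pscale) (simp add: act_linear)
qed (use assms in \<open>simp_all add: act_linear\<close>)

lemma restr_supermodule:
  assumes Y: "submodule Y CC P"
    and gr: "\<And>a b. a \<in> hpart P 0 \<Longrightarrow> b \<in> hpart P 1 \<Longrightarrow> a \<oplus>\<^bsub>P\<^esub> b \<in> Y \<Longrightarrow> a \<in> Y \<and> b \<in> Y"
    and T: "\<And>b v. b \<in> T_basis d \<Longrightarrow> v \<in> Y \<Longrightarrow> bact b v \<in> Y"
  shows "supermodule (T d) (restr P Y)"
proof -
  note cl = M.submodule_closed[OF Y]
  have YP: "v \<in> carrier P" if "v \<in> Y" for v using cl(1) that by auto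
  have act_Y: "act P x v \<in> Y" if x: "Poly_Mapping.keys x \<subseteq> T_basis d" and v: "v \<in> Y" for x v
    using x
  proof (induction x rule: free_space_induct)
    case (single b c)
    then show ?case using T v cl(4) YP by (subst single_pscale) (simp add: act_linear)
  qed (use v cl YP in \<open>simp_all add: act_linear\<close>)
  have mod: "module CC (restr P Y)"
  proof (rule moduleI)
    show "cring CC" by (rule cring_from_type_algebra)
    show "abelian_group (restr P Y)"
    proof (rule abelian_groupI)
      fix x assume "x \<in> carrier (restr P Y)"
      then show "\<exists>y\<in>carrier (restr P Y). y \<oplus>\<^bsub>restr P Y\<^esub> x = \<zero>\<^bsub>restr P Y\<^esub>"
        using cl(5) YP by (intro bexI[of _ "\<ominus>\<^bsub>P\<^esub> x"]) (simp_all add: M.l_neg)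
    qed (use cl YP in \<open>auto simp: M.a_ac\<close>)
  qed (use cl YP in \<open>auto simp: M.smult_add M.smult_add_right M.smult_smult\<close>)
  interpret S: cmodule "restr P Y" unfolding cmodule_def by (rule mod)
  have "superspace (restr P Y)"
  proof (intro superspace.intro superspace_axioms.intro mod)
    show "submodule (hpart (restr P Y) i) CC (restr P Y)" for i
      by (rule S.submoduleI') (use cl M.hpart_closed in auto)
    show "hpart (restr P Y) 0 \<inter> hpart (restr P Y) 1 = {\<zero>\<^bsub>restr P Y\<^esub>}"
      using M.hpart_Int cl(2) by auto
    show "hpart (restr P Y) 0 <+>\<^bsub>restr P Y\<^esub> hpart (restr P Y) 1 = carrier (restr P Y)"
    proof (intro equalityI subsetI)
      fix v assume "v \<in> carrier (restr P Y)"
      then have v: "v \<in> Y" by simp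
      then obtain a b where ab: "v = a \<oplus>\<^bsub>P\<^esub> b" "a \<in> hpart P 0" "b \<in> hpart P 1"
        using M.decompose[OF YP] by blast
      with gr v show "v \<in> hpart (restr P Y) 0 <+>\<^bsub>restr P Y\<^esub> hpart (restr P Y) 1"
        by (auto simp: set_add_def')
    qed (use cl(3) in \<open>auto simp: set_add_def'\<close>)
  qed
  moreover have "supermodule_axioms (T d) (restr P Y)"
  proof (rule supermodule_axioms.intro)
    show "act (restr P Y) x v \<in> hpart (restr P Y) (i + j)"
      if "x \<in> hpart (T d) i" "v \<in> hpart (restr P Y) j" for x i v j
      using act_hpart[of x i v j] act_Y[of x v] that by simp
    show "act (restr P Y) (bracket (T d) x y) v = act (restr P Y) x (act (restr P Y) y v)
        \<ominus>\<^bsub>restr P Y\<^esub> ksign i j \<odot>\<^bsub>restr P Y\<^esub> act (restr P Y) y (act (restr P Y) x v)"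
      if "x \<in> hpart (T d) i" "y \<in> hpart (T d) j" "v \<in> carrier (restr P Y)" for x i y j v
    proof -
      have x: "Poly_Mapping.keys x \<subseteq> T_basis d" and y: "Poly_Mapping.keys y \<subseteq> T_basis d" and v: "v \<in> Y"
        using that by auto
      \<comment> \<open>Negation depends on the carrier of the record; both negations are the scalar
        -1, which the records share.\<close>
      have "\<ominus>\<^bsub>restr P Y\<^esub> w = \<ominus>\<^bsub>P\<^esub> w" if "w \<in> Y" for w
        using S.smult_m1[of w] M.smult_m1[of w] that YP by simp
      moreover have "ksign i j \<odot>\<^bsub>P\<^esub> act P y (act P x v) \<in> Y"
        by (intro cl(4) act_Y x y v)
      ultimately show ?thesis
        using act_bracket[of x i y j v] that(1,2) YP[OF v] by (simp add: a_minus_def)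
    qed
  qed (use YP in \<open>simp_all add: act_linear\<close>)
  ultimately show ?thesis
    using T_lie_superalgebra by (intro supermodule.intro)
qed

definition singular :: "nat \<Rightarrow> nat \<Rightarrow> 'p set" where
  "singular t d = {v \<in> carrier P. \<forall>y\<in>raising t d. bact y v = \<zero>\<^bsub>P\<^esub>}"

text \<open>As b y v = 0, the vector y b v equals [y, b] v, and [y, b] is a combination of raising
  elements.\<close>

lemma singular_closed:
  assumes "b \<in> T_basis d" "v \<in> singular t d"
  shows "bact b v \<in> singular t d"
  unfolding singular_def
proof (intro CollectI conjI ballI)
  have v: "v \<in> carrier P" "\<And>y. y \<in> raising t d \<Longrightarrow> bact y v = \<zero>\<^bsub>P\<^esub>"
    using assms(2) by (auto simp: singular_def)
  show "bact b v \<in> carrier P" using v by simp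
  fix y assume y: "y \<in> raising t d"
  have "act P (basis_bracket y b) v = \<zero>\<^bsub>P\<^esub>"
    by (rule act_keys_0[OF v(1) raising_bracket[OF y assms(1)] v(2)])
  then have "bact y (bact b v) \<ominus>\<^bsub>P\<^esub> \<zero>\<^bsub>P\<^esub> = \<zero>\<^bsub>P\<^esub>"
    using v y by (simp add: basis_act_bracket act_linear)
  then show "bact y (bact b v) = \<zero>\<^bsub>P\<^esub>" using v by (simp add: a_minus_def neg_zero)
qed

lemma singular_submodule: "submodule (singular t d) CC P"
  by (rule M.submoduleI') (auto simp: singular_def act_linear)

text \<open>A raising basis vector is homogeneous, so it sends the two components into different
  parts of \<open>P\<close>; the images cancel only if both are 0.\<close>

lemma singular_graded:
  assumes a: "a \<in> hpart P 0" and b: "b \<in> hpart P 1" and ab: "a \<oplus>\<^bsub>P\<^esub> b \<in> singular t d"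
  shows "a \<in> singular t d \<and> b \<in> singular t d"
proof -
  have c: "a \<in> carrier P" "b \<in> carrier P" using a b M.hpart_carrier by auto
  have "bact y a = \<zero>\<^bsub>P\<^esub> \<and> bact y b = \<zero>\<^bsub>P\<^esub>" if y: "y \<in> raising t d" for y
  proof -
    have sum: "bact y a \<oplus>\<^bsub>P\<^esub> bact y b = \<zero>\<^bsub>P\<^esub>"
      using ab y c by (simp add: singular_def flip: act_linear)
    have h: "bact y a \<in> hpart P (or_degree y + 0)" "bact y b \<in> hpart P (or_degree y + 1)"
      by (rule act_hpart[OF single_hpart a], rule act_hpart[OF single_hpart b])
    from bit_01[of "or_degree y"] show ?thesis
    proof
      assume "or_degree y = 0"
      then show ?thesis using h M.hpart_add_eq_0[of "bact y a" "bact y b"] sum by simp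
    next
      assume "or_degree y = 1"
      then show ?thesis using h M.hpart_add_eq_0[of "bact y b" "bact y a"] sum c by (simp add: M.a_comm)
    qed
  qed
  then show ?thesis using c by (auto simp: singular_def)
qed

lemma singular_supermodule: "supermodule (T d) (restr P (singular t d))"
  using restr_supermodule[OF singular_submodule singular_graded singular_closed] by blast

text \<open>
  If \<open>v\<close> itself is not killed by \<open>G\<^bsub>t+1/2\<^esub>\<close>, then \<open>G\<^bsub>t+1/2\<^esub> v\<close> is, because the square of
  \<open>G\<^bsub>t+1/2\<^esub>\<close> is a multiple of \<open>W\<^bsub>2t+1\<^esub>\<close>.
\<close>

lemma singular_descend:
  assumes v: "v \<in> singular (Suc t) d" "v \<noteq> \<zero>\<^bsub>P\<^esub>" and W: "bact (bW (int (Suc t))) v = \<zero>\<^bsub>P\<^esub>"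
  shows "singular t (Suc d) \<noteq> {\<zero>\<^bsub>P\<^esub>}"
proof -
  let ?g = "bG (int t)"
  \<comment> \<open>Lowering \<open>t\<close> by 1 while raising \<open>d\<close> by 1 keeps t + d
    and with it the condition on L; only W_{t+1} and G_{t+1/2} are new.\<close>
  have down: "w \<in> singular t (Suc d)"
    if w: "w \<in> singular (Suc t) d" "bact (bW (int (Suc t))) w = \<zero>\<^bsub>P\<^esub>" "bact ?g w = \<zero>\<^bsub>P\<^esub>" for w
    unfolding singular_def
  proof (intro CollectI conjI ballI)
    show "w \<in> carrier P" using w by (simp add: singular_def)
    fix y assume "y \<in> raising t (Suc d)"
    then have "y \<in> raising (Suc t) d \<or> y = bW (int (Suc t)) \<or> y = ?g" by (cases y) auto
    then show "bact y w = \<zero>\<^bsub>P\<^esub>" using w by (auto simp: singular_def)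
  qed
  have vP: "v \<in> carrier P" using v by (simp add: singular_def)
  show ?thesis
  proof (cases "bact ?g v = \<zero>\<^bsub>P\<^esub>")
    case True
    then show ?thesis using down[OF v(1) W] v(2) by blast
  next
    case False
    have "bact ?g v \<in> singular (Suc t) d" by (rule singular_closed[OF _ v(1)]) simp
    moreover have "bact (bW (int (Suc t))) (bact ?g v) = \<zero>\<^bsub>P\<^esub>"
    proof -
      have "act P (basis_bracket (bW (int (Suc t))) ?g) v = \<zero>\<^bsub>P\<^esub>"
        using vP by (simp add: act_linear)
      then have "bact (bW (int (Suc t))) (bact ?g v) \<ominus>\<^bsub>P\<^esub> \<zero>\<^bsub>P\<^esub> = \<zero>\<^bsub>P\<^esub>"
        unfolding basis_act_bracket[OF vP] W act_linear(6) M.smult_zero_right .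
      then show ?thesis using vP by (simp add: a_minus_def neg_zero)
    qed
    moreover have "bact ?g (bact ?g v) = \<zero>\<^bsub>P\<^esub>"
    proof -
      have "act P (basis_bracket ?g ?g) v = \<zero>\<^bsub>P\<^esub>"
      proof (rule act_keys_0[OF vP])
        show "Poly_Mapping.keys (basis_bracket ?g ?g) \<subseteq> {bW (2 * int t + 1)}"
          by (auto simp: algebra_simps)
        \<comment> \<open>For t = 0 this is W_1, killed by assumption \<open>W\<close>; for t > 0
          the index 2t+1 exceeds t+1.\<close>
        show "bact b v = \<zero>\<^bsub>P\<^esub>" if "b \<in> {bW (2 * int t + 1)}" for b
          using that v(1) W by (cases "t = 0") (auto simp: singular_def)
      qed
      then have "bact ?g (bact ?g v) \<oplus>\<^bsub>P\<^esub> bact ?g (bact ?g v) = \<zero>\<^bsub>P\<^esub>"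
        unfolding basis_act_bracket[OF vP] using vP by (simp add: ksign_def M.smult_m1 a_minus_def)
      then have "(1 + 1) \<odot>\<^bsub>P\<^esub> bact ?g (bact ?g v) = \<zero>\<^bsub>P\<^esub>"
        using vP by (simp only: M.smult_add M.smult_1 act_mem)
      then show ?thesis using vP M.smult_eq_0[of "bact ?g (bact ?g v)" "1 + 1"] by simp
    qed
    ultimately have "bact ?g v \<in> singular t (Suc d)" by (rule down)
    then show ?thesis using False by blast
  qed
qed

end

theorem theorem5p2:
  fixes P :: "(or_space, 'p) supermodule" and c1 c2 :: complex
  assumes "simple_supermodule OR P"
    and "restricted P"
    and "central_scalars P c1 c2"
    and "c2 \<noteq> 0"
  shows "\<exists>(d::nat) (V :: (or_space, 'p) supermodule).
    simple_supermodule (T d) V \<and> central_scalars V c1 c2 \<and>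
    isomorphic_supermodules OR P (induced_module OR (T d) V) \<and>
    (\<exists>t::nat.
      (t > 0 \<longrightarrow> inj_on (act V (W (int t))) (carrier V)) \<and>
      (t = 0 \<longrightarrow> c2 \<noteq> 0) \<and>
      (\<forall>i > int t. \<forall>v\<in>carrier V. act V (W i) v = \<zero>\<^bsub>V\<^esub>) \<and>
      (\<forall>j > int t + int d. \<forall>v\<in>carrier V. act V (L j) v = \<zero>\<^bsub>V\<^esub>))"
proof -
  interpret or_module P
    using assms(1) unfolding or_module_def simple_supermodule_def by blast
  obtain v where v: "v \<in> carrier P" "v \<noteq> \<zero>\<^bsub>P\<^esub>"
    using assms(1) act_linear(6) unfolding simple_supermodule_def by metis
  obtain n where n: "\<And>i. i \<ge> n \<Longrightarrow> act P (L i) v = \<zero>\<^bsub>P\<^esub> \<and> act P (W i) v = \<zero>\<^bsub>P\<^esub> \<and> act P (G_half i) v = \<zero>\<^bsub>P\<^esub>"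
    using assms(2) v(1) unfolding restricted_def by blast
  \<comment> \<open>One bound serves all three families at \<open>v\<close>, so d = 0 will do.
    \<open>n\<close> is an integer and may be negative, hence \<open>nat n\<close>.\<close>
  have "v \<in> singular (nat n) 0"
    using v(1) n by (auto simp: singular_def raising_def L_def W_def G_half_def)
  then have ex: "\<exists>t d. singular t d \<noteq> {\<zero>\<^bsub>P\<^esub>}" using v(2) by blast
  \<comment> \<open>The minimum runs over all \<open>d\<close> together, because lowering
    \<open>t\<close> by \<open>singular_descend\<close> costs an increase of
    \<open>d\<close>.\<close>
  define t where "t = (LEAST t. \<exists>d. singular t d \<noteq> {\<zero>\<^bsub>P\<^esub>})"
  obtain d where ne: "singular t d \<noteq> {\<zero>\<^bsub>P\<^esub>}"
    using LeastI_ex[OF ex] unfolding t_def by blast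
  have W_t: "w = \<zero>\<^bsub>P\<^esub>" if w: "w \<in> singular t d" "t > 0" "act P (W (int t)) w = \<zero>\<^bsub>P\<^esub>" for w
  proof (rule ccontr)
    assume "w \<noteq> \<zero>\<^bsub>P\<^esub>"
    obtain t' where t': "t = Suc t'" using w(2) gr0_conv_Suc by blast
    have "singular t' (Suc d) \<noteq> {\<zero>\<^bsub>P\<^esub>}"
      using singular_descend[of w t' d] w \<open>w \<noteq> \<zero>\<^bsub>P\<^esub>\<close> by (simp add: t' W_def)
    then have "t \<le> t'" unfolding t_def by (intro Least_le) blast
    then show False using t' by simp
  qed
  have C2: "w = \<zero>\<^bsub>P\<^esub>" if "w \<in> carrier P" "act P C2 w = \<zero>\<^bsub>P\<^esub>" for w
    using that assms(3,4) M.smult_eq_0[of w c2] by (simp add: central_scalars_def)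
  have kill: "w \<in> carrier P" "y \<in> raising t d \<Longrightarrow> bact y w = \<zero>\<^bsub>P\<^esub>" if "w \<in> singular t d" for w y
    using that by (auto simp: singular_def)
  interpret I: induced P d "singular t d"
    by (intro induced.intro supermodule_axioms induced_axioms.intro singular_supermodule subsetI kill(1))
  interpret I: induced_t P d "singular t d" t
  proof unfold_locales
    fix i w assume w: "w \<in> singular t d"
    show "act P (W i) w = \<zero>\<^bsub>P\<^esub>" if "i > int t"
      using kill(2)[OF w, of "bW i"] that by (simp add: W_def)
    show "act P (L i) w = \<zero>\<^bsub>P\<^esub>" if "i > int t + int d"
      using kill(2)[OF w, of "bL i"] that by (simp add: L_def)
    show "act P (G_half i) w = \<zero>\<^bsub>P\<^esub>" if "i \<ge> int t"
      using kill(2)[OF w, of "bG i"] that by (simp add: G_half_def)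
    show "w = \<zero>\<^bsub>P\<^esub>" if "t > 0" "act P (W (int t)) w = \<zero>\<^bsub>P\<^esub>" by (rule W_t[OF w that])
    show "w = \<zero>\<^bsub>P\<^esub>" if "act P C2 w = \<zero>\<^bsub>P\<^esub>" by (rule C2[OF kill(1)[OF w] that])
  qed
  let ?V = "restr P (singular t d)"
  note cl = M.submodule_closed[OF singular_submodule[of t d]]
  have "inj_on (act ?V (W (int t))) (carrier ?V)" if t: "t > 0"
  proof (rule inj_onI)
    fix x y assume xy: "x \<in> carrier ?V" "y \<in> carrier ?V" "act ?V (W (int t)) x = act ?V (W (int t)) y"
    then have c: "x \<in> carrier P" "y \<in> carrier P" using cl(1) by auto
    have "act P (W (int t)) (x \<oplus>\<^bsub>P\<^esub> (- 1) \<odot>\<^bsub>P\<^esub> y) =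
        act P (W (int t)) x \<oplus>\<^bsub>P\<^esub> (- 1) \<odot>\<^bsub>P\<^esub> act P (W (int t)) y"
      using c by (simp only: act_linear M.smult_mem)
    also have "\<dots> = \<zero>\<^bsub>P\<^esub>" using xy c by (simp add: M.smult_m1 M.r_neg)
    finally have "act P (W (int t)) (x \<oplus>\<^bsub>P\<^esub> (- 1) \<odot>\<^bsub>P\<^esub> y) = \<zero>\<^bsub>P\<^esub>" .
    moreover have "x \<oplus>\<^bsub>P\<^esub> (- 1) \<odot>\<^bsub>P\<^esub> y \<in> singular t d" using xy cl(3,4) by simp
    ultimately have "x \<oplus>\<^bsub>P\<^esub> (- 1) \<odot>\<^bsub>P\<^esub> y = \<zero>\<^bsub>P\<^esub>" using W_t t by blast
    then have "x \<oplus>\<^bsub>P\<^esub> \<ominus>\<^bsub>P\<^esub> y = \<zero>\<^bsub>P\<^esub>" using c by (simp add: M.smult_m1)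
    then show "x = y" using c M.minus_equality[of x "\<ominus>\<^bsub>P\<^esub> y"] by simp
  qed
  moreover have "central_scalars ?V c1 c2"
    using assms(3) cl(1) by (auto simp: central_scalars_def)
  ultimately show ?thesis
    using I.V_simple[OF assms(1) ne] I.isomorphic_induced[OF assms(1) ne] I.W_Y I.L_Y assms(4)
    by (intro exI[of _ d] exI[of _ ?V] conjI exI[of _ t]) simp_all
qed

end
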